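(* List Semi-Acyclic 3-Colouring is solvable on $P_5$-free graphs in $O(n^{16})$ time.
   Context: A 3-colouring (proper colouring with colours 1,2,3) of a graph is semi-acyclic if the vertices coloured 2 or 3 induce a forest. List Semi-Acyclic 3-Colouring is the problem: given a graph G and a function $L:V(G)\to\{S : S\subseteq\{1,2,3\}\}$, does G have a semi-acyclic 3-colouring c with $c(v)\in L(v)$ for all $v\in V(G)$? $P_5$ is the path on five vertices; a graph is $P_5$-free if it has no induced subgraph isomorphic to $P_5$; n is the number of vertices. *)

theory Defs
  imports Complex_Main "HOL-Library.Landau_Symbols"
begin

type_synonym 'a graph = "'a set \<times> 'a set set"

abbreviation verts :: "'a graph \<Rightarrow> 'a set" where "verts G \<equiv> fst G"
abbreviation edges :: "'a graph \<Rightarrow> 'a set set" where "edges G \<equiv> snd G"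

definition simple_graph :: "'a graph \<Rightarrow> bool" where
  "simple_graph G \<longleftrightarrow> finite (verts G) \<and> (\<forall>e\<in>edges G. e \<subseteq> verts G \<and> card e = 2)"

definition induced_subgraph :: "'a graph \<Rightarrow> 'a set \<Rightarrow> 'a graph" where
  "induced_subgraph G X = (X, {e \<in> edges G. e \<subseteq> X})"

definition isomorphic :: "'a graph \<Rightarrow> 'b graph \<Rightarrow> bool" where
  "isomorphic G H \<longleftrightarrow>
    (\<exists>f. bij_betw f (verts G) (verts H) \<and>
         (\<forall>u\<in>verts G. \<forall>v\<in>verts G. {u, v} \<in> edges G \<longleftrightarrow> {f u, f v} \<in> edges H))"

definition path_graph :: "nat \<Rightarrow> nat graph" where
  "path_graph k = ({..<k}, {{i, Suc i} | i. Suc i < k})"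

definition P5_free :: "'a graph \<Rightarrow> bool" where
  "P5_free G \<longleftrightarrow> \<not> (\<exists>X \<subseteq> verts G. isomorphic (induced_subgraph G X) (path_graph 5))"

definition cycle :: "'a graph \<Rightarrow> 'a list \<Rightarrow> bool" where
  "cycle G xs \<longleftrightarrow> 3 \<le> length xs \<and> distinct xs \<and> set xs \<subseteq> verts G \<and>
    (\<forall>i < length xs. {xs ! i, xs ! (Suc i mod length xs)} \<in> edges G)"

definition forest :: "'a graph \<Rightarrow> bool" where
  "forest G \<longleftrightarrow> \<not> (\<exists>xs. cycle G xs)"

definition three_colouring :: "'a graph \<Rightarrow> ('a \<Rightarrow> nat) \<Rightarrow> bool" where
  "three_colouring G c \<longleftrightarrow> (\<forall>v\<in>verts G. c v \<in> {1, 2, 3}) \<and>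
    (\<forall>u v. {u, v} \<in> edges G \<longrightarrow> c u \<noteq> c v)"

definition semi_acyclic_3_colouring :: "'a graph \<Rightarrow> ('a \<Rightarrow> nat) \<Rightarrow> bool" where
  "semi_acyclic_3_colouring G c \<longleftrightarrow> three_colouring G c \<and>
    forest (induced_subgraph G {v \<in> verts G. c v \<in> {2, 3}})"

definition list_semi_acyclic_3_colourable :: "'a graph \<times> ('a \<Rightarrow> nat set) \<Rightarrow> bool" where
  "list_semi_acyclic_3_colourable = (\<lambda>(G, L).
    \<exists>c. semi_acyclic_3_colouring G c \<and> (\<forall>v\<in>verts G. c v \<in> L v))"

text \<open>
  The machine is a unit-cost random access machine, programmed in a structured imperative
  language with finitely many registers and arrays (a program mentions only finitely many,
  so they can be interleaved in a single memory with constant overhead). Subtraction is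
  truncated, division rounds down and division by zero yields 0.
\<close>

datatype expr =
    Lit nat
  | Reg string
  | Load string expr
  | Add expr expr
  | Sub expr expr
  | Mul expr expr
  | Div expr expr
  | Less expr expr
  | Equal expr expr

datatype prog =
    Skip
  | Assign string expr
  | Store string expr expr
  | Seq prog prog
  | If expr prog prog
  | While expr prog

record state =
  reg :: "string \<Rightarrow> nat"
  arr :: "string \<Rightarrow> nat \<Rightarrow> nat"

fun val :: "state \<Rightarrow> expr \<Rightarrow> nat" where
  "val s (Lit k) = k"
| "val s (Reg x) = reg s x"
| "val s (Load a e) = arr s a (val s e)"
| "val s (Add e f) = val s e + val s f"
| "val s (Sub e f) = val s e - val s f"
| "val s (Mul e f) = val s e * val s f"
| "val s (Div e f) = val s e div val s f"
| "val s (Less e f) = (if val s e < val s f then 1 else 0)"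
| "val s (Equal e f) = (if val s e = val s f then 1 else 0)"

fun subexprs :: "expr \<Rightarrow> expr list" where
  "subexprs (Lit k) = [Lit k]"
| "subexprs (Reg x) = [Reg x]"
| "subexprs (Load a e) = Load a e # subexprs e"
| "subexprs (Add e f) = Add e f # subexprs e @ subexprs f"
| "subexprs (Sub e f) = Sub e f # subexprs e @ subexprs f"
| "subexprs (Mul e f) = Mul e f # subexprs e @ subexprs f"
| "subexprs (Div e f) = Div e f # subexprs e @ subexprs f"
| "subexprs (Less e f) = Less e f # subexprs e @ subexprs f"
| "subexprs (Equal e f) = Equal e f # subexprs e @ subexprs f"

definition cost :: "expr \<Rightarrow> nat" where
  "cost e = length (subexprs e)"

definition fits :: "nat \<Rightarrow> state \<Rightarrow> expr \<Rightarrow> bool" where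
  "fits W s e \<longleftrightarrow> (\<forall>f \<in> set (subexprs e). val s f < W)"

text \<open>
  \<open>exec W p s t s'\<close>: started in \<open>s\<close>, program \<open>p\<close> terminates in \<open>s'\<close> after \<open>t\<close> steps, and
  every value computed on the way, including array indices and intermediate results, is less
  than \<open>W\<close>. There is no rule for an overflowing evaluation, so an overflowing run has no
  outcome at all. Each command costs one step plus one step per operation evaluated.
\<close>

inductive exec :: "nat \<Rightarrow> prog \<Rightarrow> state \<Rightarrow> nat \<Rightarrow> state \<Rightarrow> bool" for W where
  Skip: "exec W Skip s 1 s"
| Assign: "fits W s e \<Longrightarrow>
    exec W (Assign x e) s (1 + cost e) (s\<lparr>reg := (reg s)(x := val s e)\<rparr>)"
| Store: "fits W s i \<Longrightarrow> fits W s e \<Longrightarrow>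
    exec W (Store a i e) s (1 + cost i + cost e)
      (s\<lparr>arr := (arr s)(a := (arr s a)(val s i := val s e))\<rparr>)"
| Seq: "exec W p s t s' \<Longrightarrow> exec W q s' u s'' \<Longrightarrow> exec W (Seq p q) s (1 + t + u) s''"
| IfTrue: "fits W s b \<Longrightarrow> val s b \<noteq> 0 \<Longrightarrow> exec W p s t s' \<Longrightarrow>
    exec W (If b p q) s (1 + cost b + t) s'"
| IfFalse: "fits W s b \<Longrightarrow> val s b = 0 \<Longrightarrow> exec W q s t s' \<Longrightarrow>
    exec W (If b p q) s (1 + cost b + t) s'"
| WhileFalse: "fits W s b \<Longrightarrow> val s b = 0 \<Longrightarrow> exec W (While b p) s (1 + cost b) s"
| WhileTrue: "fits W s b \<Longrightarrow> val s b \<noteq> 0 \<Longrightarrow> exec W p s t s' \<Longrightarrow>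
    exec W (While b p) s' u s'' \<Longrightarrow> exec W (While b p) s (1 + cost b + t + u) s''"

text \<open>
  A decision problem is given by its set \<open>I\<close> of instances, the size \<open>sz\<close> and the initial state
  \<open>enc\<close> of an instance, and the set \<open>Q\<close> of yes-instances. One program has to work for all
  instances. The bound \<open>(sz x + 2) ^ k\<close> on all values, with \<open>k\<close> independent of \<open>x\<close>, means that
  machine words have \<open>O(log (sz x))\<close> bits; so unit-cost arithmetic cannot be abused to
  manipulate huge numbers.
\<close>

definition solvable_in_time ::
  "'x set \<Rightarrow> ('x \<Rightarrow> nat) \<Rightarrow> ('x \<Rightarrow> state) \<Rightarrow> ('x \<Rightarrow> bool) \<Rightarrow> (nat \<Rightarrow> real) \<Rightarrow> bool"
where
  "solvable_in_time I sz enc Q f \<longleftrightarrow>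
    (\<exists>p k (T :: nat \<Rightarrow> nat).
      (\<lambda>n. real (T n)) \<in> O(f) \<and>
      (\<forall>x\<in>I. \<exists>t s. exec ((sz x + 2) ^ k) p (enc x) t s \<and> t \<le> T (sz x) \<and>
                   reg s ''out'' = (if Q x then 1 else 0)))"

text \<open>As usual for graph algorithms, the \<open>n\<close> vertices are named \<open>0, \<dots>, n - 1\<close>.\<close>

definition P5_free_instances :: "(nat graph \<times> (nat \<Rightarrow> nat set)) set" where
  "P5_free_instances = {(G, L). simple_graph G \<and> verts G = {..<card (verts G)} \<and> P5_free G \<and>
     (\<forall>v\<in>verts G. L v \<subseteq> {1, 2, 3})}"

definition num_verts :: "nat graph \<times> (nat \<Rightarrow> nat set) \<Rightarrow> nat" where
  "num_verts = (\<lambda>(G, L). card (verts G))"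

text \<open>
  The number of vertices is passed in a register, the graph as an adjacency matrix (row-major),
  and the lists as a matrix with three columns: entry \<open>3 * v + i\<close> tells whether colour \<open>i + 1\<close>
  is in the list of \<open>v\<close>. Everything else is initially 0.
\<close>

definition encode :: "nat graph \<times> (nat \<Rightarrow> nat set) \<Rightarrow> state" where
  "encode = (\<lambda>(G, L). let n = card (verts G) in
    \<lparr> reg = (\<lambda>_. 0)(''n'' := n),
      arr = (\<lambda>_ _. 0)(
        ''adj'' := (\<lambda>j. if j < n * n \<and> {j div n, j mod n} \<in> edges G then 1 else 0),
        ''lists'' := (\<lambda>j. if j < 3 * n \<and> Suc (j mod 3) \<in> L (j div 3) then 1 else 0)) \<rparr>)"

end

theory Submission imports Defs begin

text \<open>
  A 2/3-coloured cycle of a \<open>P\<^sub>5\<close>-free graph yields a 2/3-coloured 4-cycle, so a colouring is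
  semi-acyclic iff every 4-cycle has a vertex of colour 1. Every component of a \<open>P\<^sub>5\<close>-free graph
  without \<open>K\<^sub>4\<close> is dominated by a set \<open>D\<close> of at most three vertices that is a clique or a path.
  After guessing \<open>D\<close> and its colouring, every vertex has at most two colours left. If the
  vertices of colour 2 in \<open>D\<close> are all adjacent to those of colour 3, then the 4-cycle condition amounts to
  2-clauses. Otherwise \<open>D\<close> is a path coloured 2, 1, 3; then for \<open>e = 2\<close> or \<open>e = 3\<close> at most one
  vertex \<open>g\<close> of colour \<open>e\<close> has no neighbour of colour 1 in \<open>D\<close>, and guessing \<open>e\<close> and \<open>g\<close> again
  leaves 2-clauses. So for every vertex one enumerates the guesses for a closed neighbourhood of it
  and solves a 2-SAT instance by computing the transitive closure of its implications.

  The whole algorithm is a first-order formula with bounded quantifiers and a transitive closure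
  operator, evaluated by a generic compiler from such formulas to programs: a formula with
  nesting depth \<open>d\<close> of quantifiers takes time \<open>O(n\<^sup>d)\<close>.
\<close>

subsection \<open>Model checking on the machine\<close>

text \<open>The 4-cycle condition is a clause of length four, and the guess is there to shorten it:
  a vertex that the guess keeps off colour 1 drops out. Only 4-cycles with at most two other
  vertices are encoded, so the point to be proved is that these suffice.

  The set \<open>D\<close> is a triple whose closed neighbourhood is inclusion-maximal among those
  containing the given vertex. If that neighbourhood had a neighbour \<open>u\<close> outside, the
  way in which a connecting vertex \<open>w\<close> is attached to the triple would give a larger
  neighbourhood, an induced P5 or a K4. K4 may be excluded because it has no 3-colouring.

  Components are not computed. Each vertex brings its own guess, whose neighbourhood must contain it
  and be closed under adjacency; colourings of such sets can be glued, even where they overlap.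

  The obstacle on the machine side is that running time and word size have to be tracked for an
  explicit program. The detour through formulas confines this to one induction; for the algorithm
  itself only a logical equivalence, a syntactic check and a count of nested quantifiers
  remain.\<close>

definition setr :: "state \<Rightarrow> string \<Rightarrow> nat \<Rightarrow> state" where
  "setr s x i = s\<lparr>reg := (reg s)(x := i)\<rparr>"

definition seta :: "state \<Rightarrow> string \<Rightarrow> (nat \<Rightarrow> nat) \<Rightarrow> state" where
  "seta s a h = s\<lparr>arr := (arr s)(a := h)\<rparr>"

lemma setr_seta_simps [simp]:
  "reg (setr s x i) = (reg s)(x := i)" "arr (setr s x i) = arr s"
  "reg (seta s a h) = reg s" "arr (seta s a h) = (arr s)(a := h)"
  by (simp_all add: setr_def seta_def)

section \<open>Bounds on computed values\<close>

text \<open>An exponent \<open>k\<close> such that \<open>(n + 2) ^ k\<close> exceeds every value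
  met while evaluating the expression, provided that the state is \<open>bounded\<close>. The base
  is at least 2, so a literal can use k < 2^k, and a sum costs just one more factor.\<close>

fun degree_bound :: "expr \<Rightarrow> nat" where
  "degree_bound (Lit k) = Suc k"
| "degree_bound (Reg x) = 3"
| "degree_bound (Load a e) = max 3 (degree_bound e)"
| "degree_bound (Add e f) = Suc (max (degree_bound e) (degree_bound f))"
| "degree_bound (Sub e f) = max (degree_bound e) (degree_bound f)"
| "degree_bound (Mul e f) = degree_bound e + degree_bound f"
| "degree_bound (Div e f) = max (degree_bound e) (degree_bound f)"
| "degree_bound (Less e f) = max (degree_bound e) (degree_bound f)"
| "degree_bound (Equal e f) = max (degree_bound e) (degree_bound f)"

text \<open>The bound is the largest final value of a loop counter: loops run up to
  \<open>a * n + b\<close> with \<open>a\<close> and \<open>b\<close> at most 4.\<close>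

definition bounded :: "nat \<Rightarrow> state \<Rightarrow> bool" where
  "bounded n s \<longleftrightarrow> (\<forall>x. reg s x \<le> 4 * (n + 1)) \<and> (\<forall>a i. arr s a i \<le> 4 * (n + 1))"

text \<open>Comparisons can have the value 1, which lies below a power of \<open>n + 2\<close> only
  if the exponent is positive.\<close>

lemma degree_bound_pos: "1 \<le> degree_bound e"
  by (induction e) auto

lemma self_in_subexprs: "e \<in> set (subexprs e)"
  by (cases e) auto

text \<open>The exponent 3 is due to n = 0, where the square of n + 2 equals 4 (n + 1).\<close>

lemma four_times_less: "4 * (n + 1) < (n + 2) ^ 3" for n :: nat
  by (simp add: power3_eq_cube algebra_simps)

lemma power_le_power: "a \<le> b \<Longrightarrow> x < (n + 2) ^ a \<Longrightarrow> x < (n + 2) ^ b" for x n :: nat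
  by (meson le_add2 less_le_trans one_le_numeral order_trans power_increasing)

lemma val_less_power:
  assumes "bounded n s"
  shows "f \<in> set (subexprs e) \<Longrightarrow> val s f < (n + 2) ^ degree_bound e"
proof (induction e arbitrary: f)
  case (Lit k)
  have "k < 2 ^ k" by (rule less_exp)
  also have "(2::nat) ^ k \<le> (n + 2) ^ k" by (rule power_mono) auto
  also have "\<dots> \<le> (n + 2) ^ Suc k" by (rule power_increasing) auto
  finally show ?case using Lit by simp
next
  case (Reg x)
  have "reg s x \<le> 4 * (n + 1)" using assms by (simp add: bounded_def)
  then have "reg s x < (n + 2) ^ 3" using four_times_less[of n] by linarith
  then show ?case using Reg by simp
next
  case (Load a e)
  then consider "f = Load a e" | "f \<in> set (subexprs e)" by auto
  then show ?case
  proof cases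
    case 1
    have "arr s a (val s e) \<le> 4 * (n + 1)" using assms by (simp add: bounded_def)
    then have "val s f < (n + 2) ^ 3" using 1 four_times_less[of n] by simp
    then show ?thesis by (rule power_le_power[rotated]) simp
  next
    case 2
    then show ?thesis using Load.IH power_le_power[of "degree_bound e" "max 3 (degree_bound e)"]
      by simp
  qed
next
  case (Add e1 e2)
  let ?m = "max (degree_bound e1) (degree_bound e2)"
  have 1: "g \<in> set (subexprs e1) \<union> set (subexprs e2) \<Longrightarrow> val s g < (n + 2) ^ ?m" for g
    using Add.IH power_le_power by (metis Un_iff max.cobounded1 max.cobounded2)
  have "val s e1 + val s e2 < 2 * (n + 2) ^ ?m"
    using 1[of e1] 1[of e2] self_in_subexprs[of e1] self_in_subexprs[of e2] by simp
  also have "\<dots> \<le> (n + 2) ^ Suc ?m" by simp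
  finally have 2: "val s (Add e1 e2) < (n + 2) ^ Suc ?m" by simp
  consider "f = Add e1 e2" | "f \<in> set (subexprs e1) \<union> set (subexprs e2)" using Add.prems by auto
  then show ?case
  proof cases
    case 1 then show ?thesis using 2 by simp
  next
    case 2
    show ?thesis using power_le_power[OF _ 1[OF 2], of "Suc ?m"]
      by (simp del: power_Suc add: le_SucI)
  qed
next
  case (Mul e1 e2)
  have 1: "g \<in> set (subexprs e1) \<union> set (subexprs e2) \<Longrightarrow>
      val s g < (n + 2) ^ (degree_bound e1 + degree_bound e2)" for g
    using Mul.IH power_le_power by (metis Un_iff le_add1 le_add2)
  have "val s e1 * val s e2 < (n + 2) ^ degree_bound e1 * (n + 2) ^ degree_bound e2"
    using Mul.IH(1)[OF self_in_subexprs] Mul.IH(2)[OF self_in_subexprs] by (intro mult_strict_mono) auto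
  then show ?case using 1[of f] Mul.prems by (auto simp: power_add)
next
  case (Sub e1 e2)
  let ?m = "max (degree_bound e1) (degree_bound e2)"
  have 1: "g \<in> set (subexprs e1) \<union> set (subexprs e2) \<Longrightarrow> val s g < (n + 2) ^ ?m" for g
    using Sub.IH power_le_power by (metis Un_iff max.cobounded1 max.cobounded2)
  have 2: "val s (Sub e1 e2) < (n + 2) ^ ?m"
    using le_less_trans[OF diff_le_self 1[of e1]] self_in_subexprs[of e1] by simp
  then show ?case using Sub.prems 1[of f] by (auto simp del: val.simps)
next
  case (Div e1 e2)
  let ?m = "max (degree_bound e1) (degree_bound e2)"
  have 1: "g \<in> set (subexprs e1) \<union> set (subexprs e2) \<Longrightarrow> val s g < (n + 2) ^ ?m" for g
    using Div.IH power_le_power by (metis Un_iff max.cobounded1 max.cobounded2)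
  have 2: "val s (Div e1 e2) < (n + 2) ^ ?m"
    using le_less_trans[OF div_le_dividend 1[of e1]] self_in_subexprs[of e1] by simp
  then show ?case using Div.prems 1[of f] by (auto simp del: val.simps)
next
  case (Less e1 e2)
  let ?m = "max (degree_bound e1) (degree_bound e2)"
  have 1: "g \<in> set (subexprs e1) \<union> set (subexprs e2) \<Longrightarrow> val s g < (n + 2) ^ ?m" for g
    using Less.IH power_le_power by (metis Un_iff max.cobounded1 max.cobounded2)
  have "1 < (n + 2) ^ ?m"
    by (rule one_less_power) (use degree_bound_pos[of e1] in auto)
  then show ?case using Less.prems 1[of f] by auto
next
  case (Equal e1 e2)
  let ?m = "max (degree_bound e1) (degree_bound e2)"
  have 1: "g \<in> set (subexprs e1) \<union> set (subexprs e2) \<Longrightarrow> val s g < (n + 2) ^ ?m" for g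
    using Equal.IH power_le_power by (metis Un_iff max.cobounded1 max.cobounded2)
  have "1 < (n + 2) ^ ?m"
    by (rule one_less_power) (use degree_bound_pos[of e1] in auto)
  then show ?case using Equal.prems 1[of f] by auto
qed

lemma fits_bounded: "bounded n s \<Longrightarrow> degree_bound e \<le> k \<Longrightarrow> fits ((n + 2) ^ k) s e"
  unfolding fits_def using val_less_power power_le_power by blast

text \<open>Entries of the scratch array \<open>R\<close> outside the \<open>2 n \<times> 2 n\<close> matrix are never written.\<close>

definition inv_state :: "nat \<Rightarrow> state \<Rightarrow> bool" where
  "inv_state n s \<longleftrightarrow> bounded n s \<and> reg s ''n'' = n \<and> (\<forall>j \<ge> (2 * n) * (2 * n). arr s ''R'' j = 0)"

lemma inv_state_n: "inv_state n s \<Longrightarrow> reg s ''n'' = n"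
  by (simp add: inv_state_def)

lemma inv_state_setr: "inv_state n s \<Longrightarrow> i \<le> 4 * (n + 1) \<Longrightarrow> x \<noteq> ''n'' \<Longrightarrow> inv_state n (setr s x i)"
  by (auto simp: inv_state_def bounded_def)

lemma inv_state_fits: "inv_state n s \<Longrightarrow> degree_bound e \<le> k \<Longrightarrow> fits ((n + 2) ^ k) s e"
  unfolding inv_state_def using fits_bounded by blast

lemma exec_assign:
  assumes "inv_state n s" "degree_bound e \<le> k"
  shows "exec ((n + 2) ^ k) (Assign x e) s (1 + cost e) (setr s x (val s e))"
  unfolding setr_def by (rule exec.Assign) (use assms inv_state_fits in blast)

section \<open>Counting loops\<close>

definition for_loop :: "string \<Rightarrow> nat \<Rightarrow> nat \<Rightarrow> prog \<Rightarrow> prog" where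
  "for_loop x a b p = Seq (Assign x (Lit 0))
     (While (Less (Reg x) (Add (Mul (Lit a) (Reg ''n'')) (Lit b)))
       (Seq p (Assign x (Add (Reg x) (Lit 1)))))"

text \<open>The invariant \<open>P i\<close> refers to the state in which the counter already has
  the value \<open>i\<close>. Besides the body a round costs 13 steps: 8 for the test, 1 for the
  sequencing and 4 for the increment. The number 25 bounds the exponents needed by the fixed parts
  of compiled code; the largest is 20, for the product of two matrix entries in Warshall's
  loop.\<close>

lemma exec_for_loop:
  assumes ab: "a \<le> 4" "b \<le> 4" "x \<noteq> ''n''" "25 \<le> k"
    and s: "inv_state n s" "P 0 (setr s x 0)"
    and body: "\<And>i s. i < a * n + b \<Longrightarrow> inv_state n s \<Longrightarrow> reg s x = i \<Longrightarrow> P i s \<Longrightarrow>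
      \<exists>t s'. exec ((n + 2) ^ k) p s t s' \<and> t \<le> T \<and> inv_state n s' \<and> reg s' x = i
        \<and> P (Suc i) (setr s' x (Suc i))"
  shows "\<exists>t s'. exec ((n + 2) ^ k) (for_loop x a b p) s t s' \<and> t \<le> (a * n + b) * (T + 13) + 11
    \<and> inv_state n s' \<and> P (a * n + b) s'"
proof -
  let ?W = "(n + 2) ^ k" and ?N = "a * n + b"
  let ?b = "Less (Reg x) (Add (Mul (Lit a) (Reg ''n'')) (Lit b))"
  let ?q = "Seq p (Assign x (Add (Reg x) (Lit 1)))"
  have cb: "cost ?b = 7" by (simp add: cost_def)
  have N: "?N \<le> 4 * (n + 1)" using add_mono[OF mult_le_mono1[OF ab(1), of n] ab(2)] by simp
  have loop: "\<exists>t s'. exec ?W (While ?b ?q) s t s' \<and> t \<le> (?N - i) * (T + 13) + 8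
      \<and> inv_state n s' \<and> P ?N s'"
    if "inv_state n s" "reg s x = i" "P i s" "i \<le> ?N" for i s
    using that
  proof (induction "?N - i" arbitrary: i s)
    case 0
    then have i: "i = ?N" by simp
    have f: "fits ?W s ?b" using 0 ab by (intro inv_state_fits) simp_all
    have "exec ?W (While ?b ?q) s (1 + cost ?b) s"
      by (rule exec.WhileFalse[OF f]) (use 0 i inv_state_n in simp)
    then show ?case using 0 i cb by auto
  next
    case (Suc m)
    then have i: "i < ?N" by simp
    have f: "fits ?W s ?b" using Suc.prems ab by (intro inv_state_fits) simp_all
    obtain t1 s1 where 1: "exec ?W p s t1 s1" "t1 \<le> T" "inv_state n s1" "reg s1 x = i"
      "P (Suc i) (setr s1 x (Suc i))" using body[OF i] Suc.prems by blast
    have 2: "exec ?W (Assign x (Add (Reg x) (Lit 1))) s1 4 (setr s1 x (Suc i))"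
      using exec_assign[OF 1(3), of "Add (Reg x) (Lit 1)" k x] 1(4) ab
      by (simp add: cost_def eval_nat_numeral)
    have 3: "inv_state n (setr s1 x (Suc i))" by (rule inv_state_setr) (use 1(3) ab i N in simp_all)
    obtain t2 s2 where 4: "exec ?W (While ?b ?q) (setr s1 x (Suc i)) t2 s2"
      "t2 \<le> (?N - Suc i) * (T + 13) + 8" "inv_state n s2" "P ?N s2"
    proof -
      have "m = ?N - Suc i" "reg (setr s1 x (Suc i)) x = Suc i" "Suc i \<le> ?N"
        using Suc.hyps(2) i by simp_all
      from Suc.hyps(1)[OF this(1) 3 this(2) 1(5) this(3)] show ?thesis using that by blast
    qed
    have "exec ?W (While ?b ?q) s (1 + cost ?b + (1 + t1 + 4) + t2) s2"
      by (rule exec.WhileTrue[OF f _ exec.Seq[OF 1(1) 2] 4(1)])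
        (use i Suc.prems inv_state_n in simp)
    moreover have "?N - i = Suc (?N - Suc i)" using i by simp
    then have "1 + cost ?b + (1 + t1 + 4) + t2 \<le> (?N - i) * (T + 13) + 8"
      using 1(2) 4(2) cb by simp
    ultimately show ?case using 4(3,4) by blast
  qed
  have 1: "exec ?W (Assign x (Lit 0)) s 2 (setr s x 0)"
    using exec_assign[OF s(1), of "Lit 0" k x] ab by (simp add: cost_def eval_nat_numeral)
  obtain t s' where "exec ?W (While ?b ?q) (setr s x 0) t s'" "t \<le> ?N * (T + 13) + 8"
    "inv_state n s'" "P ?N s'"
    using loop[OF inv_state_setr[OF s(1) _ ab(3), of 0] _ s(2)] by auto
  moreover from exec.Seq[OF 1 this(1)] have "exec ?W (for_loop x a b p) s (1 + 2 + t) s'"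
    unfolding for_loop_def .
  moreover have "1 + 2 + t \<le> ?N * (T + 13) + 11" using calculation by simp
  ultimately show ?thesis by blast
qed


lemma exec_store_R:
  assumes "inv_state n s" "degree_bound i \<le> k" "degree_bound e \<le> k"
    and "val s i < (2 * n) * (2 * n)" "val s e \<le> 1"
  shows "exec ((n + 2) ^ k) (Store ''R'' i e) s (1 + cost i + cost e)
      (seta s ''R'' ((arr s ''R'')(val s i := val s e)))"
    and "inv_state n (seta s ''R'' ((arr s ''R'')(val s i := val s e)))"
proof -
  show "exec ((n + 2) ^ k) (Store ''R'' i e) s (1 + cost i + cost e)
      (seta s ''R'' ((arr s ''R'')(val s i := val s e)))"
    unfolding seta_def by (intro exec.Store inv_state_fits[OF assms(1)] assms(2,3))
  show "inv_state n (seta s ''R'' ((arr s ''R'')(val s i := val s e)))"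
    unfolding inv_state_def bounded_def
  proof (intro conjI allI impI)
    fix a j
    show "arr (seta s ''R'' ((arr s ''R'')(val s i := val s e))) a j \<le> 4 * (n + 1)"
      using assms(1,5) by (simp add: inv_state_def bounded_def)
  qed (use assms(1,4) in \<open>simp_all add: inv_state_def bounded_def\<close>)
qed

section \<open>Formulas, their semantics and their compilation\<close>

text \<open>These registers hold truth values during evaluation. Their names consist of dots only,
  so they differ from all \<open>clean\<close> names, the only ones that a formula may
  mention.\<close>

definition temp :: "nat \<Rightarrow> string" where
  "temp d = replicate (Suc d) CHR ''.''"

definition clean :: "string \<Rightarrow> bool" where
  "clean x \<longleftrightarrow> CHR ''.'' \<notin> set x"

lemma clean_neq_temp: "clean x \<Longrightarrow> x \<noteq> temp d"
  by (auto simp: clean_def temp_def)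

lemma temp_eq_iff [simp]: "temp i = temp j \<longleftrightarrow> i = j"
  by (simp add: temp_def)

lemma clean_n: "clean ''n''"
  by (simp add: clean_def)

lemma temp_neq_n [simp]: "temp d \<noteq> ''n''" "''n'' \<noteq> temp d"
  using clean_neq_temp[OF clean_n, of d] by auto

text \<open>\<open>Ex x a b f\<close> lets \<open>x\<close> range below \<open>a * n + b\<close>,
  which covers vertices, literals and constant ranges. \<open>Tc x y f g\<close> evaluates
  \<open>g\<close> after the transitive closure of the relation \<open>f\<close> in \<open>x\<close>
  and \<open>y\<close> has been stored in the array \<open>R\<close>; its domain has 2 n elements
  because it is meant for literals.\<close>

datatype fm =
    At expr
  | Neg fm
  | Conj fm fm
  | Ex string nat nat fm
  | Tc string string fm fm

text \<open>Being 0 outside the block matches the condition of \<open>inv_state\<close> on the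
  scratch array, so that the computed array is equal to this function, not merely equal on the
  block.\<close>

definition matrix :: "nat \<Rightarrow> (nat \<Rightarrow> nat \<Rightarrow> bool) \<Rightarrow> nat \<Rightarrow> nat" where
  "matrix N r j = (if j < N * N \<and> r (j div N) (j mod N) then 1 else 0)"

definition closure_below :: "nat \<Rightarrow> (nat \<Rightarrow> nat \<Rightarrow> bool) \<Rightarrow> nat \<Rightarrow> nat \<Rightarrow> bool" where
  "closure_below N r i j \<longleftrightarrow> (i, j) \<in> {(i, j). i < N \<and> j < N \<and> r i j}\<^sup>+"

primrec sat :: "fm \<Rightarrow> state \<Rightarrow> bool" where
  "sat (At e) s \<longleftrightarrow> val s e \<noteq> 0"
| "sat (Neg f) s \<longleftrightarrow> \<not> sat f s"
| "sat (Conj f g) s \<longleftrightarrow> sat f s \<and> sat g s"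
| "sat (Ex x a b f) s \<longleftrightarrow> (\<exists>i < a * reg s ''n'' + b. sat f (setr s x i))"
| "sat (Tc x y f g) s \<longleftrightarrow> sat g (seta s ''R'' (matrix (2 * reg s ''n'')
     (closure_below (2 * reg s ''n'') (\<lambda>i j. sat f (setr (setr s x i) y j)))))"

fun expr_regs :: "expr \<Rightarrow> string set" where
  "expr_regs (Lit k) = {}"
| "expr_regs (Reg x) = {x}"
| "expr_regs (Load a e) = expr_regs e"
| "expr_regs (Add e f) = expr_regs e \<union> expr_regs f"
| "expr_regs (Sub e f) = expr_regs e \<union> expr_regs f"
| "expr_regs (Mul e f) = expr_regs e \<union> expr_regs f"
| "expr_regs (Div e f) = expr_regs e \<union> expr_regs f"
| "expr_regs (Less e f) = expr_regs e \<union> expr_regs f"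
| "expr_regs (Equal e f) = expr_regs e \<union> expr_regs f"

fun expr_arrs :: "expr \<Rightarrow> string set" where
  "expr_arrs (Lit k) = {}"
| "expr_arrs (Reg x) = {}"
| "expr_arrs (Load a e) = insert a (expr_arrs e)"
| "expr_arrs (Add e f) = expr_arrs e \<union> expr_arrs f"
| "expr_arrs (Sub e f) = expr_arrs e \<union> expr_arrs f"
| "expr_arrs (Mul e f) = expr_arrs e \<union> expr_arrs f"
| "expr_arrs (Div e f) = expr_arrs e \<union> expr_arrs f"
| "expr_arrs (Less e f) = expr_arrs e \<union> expr_arrs f"
| "expr_arrs (Equal e f) = expr_arrs e \<union> expr_arrs f"

primrec free_regs :: "fm \<Rightarrow> string set" where
  "free_regs (At e) = expr_regs e"
| "free_regs (Neg f) = free_regs f"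
| "free_regs (Conj f g) = free_regs f \<union> free_regs g"
| "free_regs (Ex x a b f) = insert ''n'' (free_regs f - {x})"
| "free_regs (Tc x y f g) = insert ''n'' ((free_regs f - {x, y}) \<union> free_regs g)"

primrec free_arrs :: "fm \<Rightarrow> string set" where
  "free_arrs (At e) = expr_arrs e"
| "free_arrs (Neg f) = free_arrs f"
| "free_arrs (Conj f g) = free_arrs f \<union> free_arrs g"
| "free_arrs (Ex x a b f) = free_arrs f"
| "free_arrs (Tc x y f g) = free_arrs f \<union> (free_arrs g - {''R''})"

primrec bound_regs :: "fm \<Rightarrow> string set" where
  "bound_regs (At e) = {}"
| "bound_regs (Neg f) = bound_regs f"
| "bound_regs (Conj f g) = bound_regs f \<union> bound_regs g"
| "bound_regs (Ex x a b f) = insert x (bound_regs f)"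
| "bound_regs (Tc x y f g) = {x, y, ''k''} \<union> bound_regs f \<union> bound_regs g"

text \<open>In the case of \<open>Tc\<close> the subformulas contribute nothing further:
  \<open>wf_fm\<close> demands that \<open>f\<close> clobbers no array and \<open>g\<close> none but
  \<open>R\<close>.\<close>

primrec bound_arrs :: "fm \<Rightarrow> string set" where
  "bound_arrs (At e) = {}"
| "bound_arrs (Neg f) = bound_arrs f"
| "bound_arrs (Conj f g) = bound_arrs f \<union> bound_arrs g"
| "bound_arrs (Ex x a b f) = bound_arrs f"
| "bound_arrs (Tc x y f g) = {''R''}"

text \<open>
  Evaluating a formula clobbers its bound registers and arrays; \<open>wf_fm\<close> makes sure that no
  clobbered location is read again.
\<close>

primrec wf_fm :: "fm \<Rightarrow> bool" where
  "wf_fm (At e) \<longleftrightarrow> (\<forall>x\<in>expr_regs e. clean x)"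
| "wf_fm (Neg f) \<longleftrightarrow> wf_fm f"
| "wf_fm (Conj f g) \<longleftrightarrow> wf_fm f \<and> wf_fm g \<and>
     bound_regs f \<inter> free_regs g = {} \<and> bound_arrs f \<inter> free_arrs g = {}"
| "wf_fm (Ex x a b f) \<longleftrightarrow> wf_fm f \<and> a \<le> 4 \<and> b \<le> 4 \<and> clean x \<and> x \<noteq> ''n'' \<and> x \<notin> bound_regs f \<and>
     bound_regs f \<inter> free_regs f = {} \<and> bound_arrs f \<inter> free_arrs f = {}"
| "wf_fm (Tc x y f g) \<longleftrightarrow> wf_fm f \<and> wf_fm g \<and> clean x \<and> clean y \<and> distinct [x, y, ''k'', ''n''] \<and>
     x \<notin> bound_regs f \<and> y \<notin> bound_regs f \<and> bound_regs f \<inter> free_regs f = {} \<and>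
     bound_arrs f = {} \<and> ''R'' \<notin> free_arrs f \<and> bound_arrs g \<subseteq> {''R''} \<and>
     ({x, y, ''k''} \<union> bound_regs f) \<inter> free_regs g = {}"

definition entry :: "expr \<Rightarrow> expr \<Rightarrow> expr" where
  "entry i j = Add (Mul i (Mul (Lit 2) (Reg ''n''))) j"

text \<open>The truth value ends up in \<open>temp d\<close>. Only \<open>Ex\<close> has to keep a
  value while its body is evaluated, so only there the level rises. In a conjunction the value of
  \<open>f\<close> may be overwritten by that of \<open>g\<close>, and if \<open>f\<close> is false,
  the 0 already present is the result.\<close>

primrec compile :: "fm \<Rightarrow> nat \<Rightarrow> prog" where
  "compile (At e) d = Assign (temp d) (Less (Lit 0) e)"
| "compile (Neg f) d = Seq (compile f d) (Assign (temp d) (Equal (Reg (temp d)) (Lit 0)))"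
| "compile (Conj f g) d = Seq (compile f d) (If (Reg (temp d)) (compile g d) Skip)"
| "compile (Ex x a b f) d = Seq (Assign (temp d) (Lit 0))
     (for_loop x a b (Seq (compile f (Suc d))
       (If (Reg (temp (Suc d))) (Assign (temp d) (Lit 1)) Skip)))"
| "compile (Tc x y f g) d =
     Seq (for_loop x 2 0 (for_loop y 2 0
           (Seq (compile f d) (Store ''R'' (entry (Reg x) (Reg y)) (Reg (temp d))))))
    (Seq (for_loop ''k'' 2 0 (for_loop x 2 0 (for_loop y 2 0
           (If (Mul (Load ''R'' (entry (Reg x) (Reg ''k''))) (Load ''R'' (entry (Reg ''k'') (Reg y))))
               (Store ''R'' (entry (Reg x) (Reg y)) (Lit 1)) Skip))))
         (compile g d))"

primrec time :: "fm \<Rightarrow> nat \<Rightarrow> nat" where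
  "time (At e) n = 3 + cost e"
| "time (Neg f) n = time f n + 5"
| "time (Conj f g) n = time f n + time g n + 5"
| "time (Ex x a b f) n = (a * n + b) * (time f n + 20) + 15"
| "time (Tc x y f g) n = 2 * n * (2 * n * (time f n + 30) + 30) +
     2 * n * (2 * n * (2 * n * 50 + 30) + 30) + time g n + 30"

primrec word_exponent :: "fm \<Rightarrow> nat" where
  "word_exponent (At e) = Suc (degree_bound e)"
| "word_exponent (Neg f) = word_exponent f"
| "word_exponent (Conj f g) = max (word_exponent f) (word_exponent g)"
| "word_exponent (Ex x a b f) = word_exponent f"
| "word_exponent (Tc x y f g) = max (word_exponent f) (word_exponent g)"

text \<open>For \<open>Tc\<close>, two loops surround \<open>f\<close> while the matrix is filled,
  and Warshall's algorithm takes three nested loops of its own.\<close>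

primrec depth :: "fm \<Rightarrow> nat" where
  "depth (At e) = 0"
| "depth (Neg f) = depth f"
| "depth (Conj f g) = max (depth f) (depth g)"
| "depth (Ex x a b f) = Suc (depth f)"
| "depth (Tc x y f g) = max (max (Suc (Suc (depth f))) (depth g)) 3"

lemma val_cong:
  "(\<And>x. x \<in> expr_regs e \<Longrightarrow> reg s x = reg s' x) \<Longrightarrow> (\<And>a. a \<in> expr_arrs e \<Longrightarrow> arr s a = arr s' a) \<Longrightarrow>
    val s e = val s' e"
  by (induction e) auto

lemma sat_cong:
  "\<forall>x\<in>free_regs f. reg s x = reg s' x \<Longrightarrow> \<forall>a\<in>free_arrs f. arr s a = arr s' a \<Longrightarrow>
    sat f s \<longleftrightarrow> sat f s'"
proof (induction f arbitrary: s s')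
  case (At e)
  then have "val s e = val s' e" by (intro val_cong) simp_all
  then show ?case by simp
next
  case (Neg f)
  then show ?case by simp
next
  case (Conj f g)
  have "sat f s = sat f s'" by (rule Conj.IH(1)) (use Conj.prems in simp_all)
  moreover have "sat g s = sat g s'" by (rule Conj.IH(2)) (use Conj.prems in simp_all)
  ultimately show ?case by simp
next
  case (Ex x a b f)
  have "sat f (setr s x i) = sat f (setr s' x i)" for i
    by (rule Ex.IH) (use Ex.prems in simp_all)
  moreover have "reg s ''n'' = reg s' ''n''" using Ex.prems(1) by simp
  ultimately show ?case by simp
next
  case (Tc x y f g)
  have 1: "sat f (setr (setr s x i) y j) = sat f (setr (setr s' x i) y j)" for i j
    by (rule Tc.IH(1)) (use Tc.prems in simp_all)
  have 2: "reg s ''n'' = reg s' ''n''" using Tc.prems(1) by simp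
  show ?case unfolding sat.simps 1 2 by (rule Tc.IH(2)) (use Tc.prems in simp_all)
qed

lemma free_regs_clean: "wf_fm f \<Longrightarrow> x \<in> free_regs f \<Longrightarrow> clean x"
  by (induction f) (use clean_n in auto)

lemma bound_regs_clean: "wf_fm f \<Longrightarrow> x \<in> bound_regs f \<Longrightarrow> clean x"
proof (induction f)
  case (Tc y z f g)
  have "clean ''k''" by (simp add: clean_def)
  with Tc show ?case by auto
qed auto

lemma n_not_bound: "wf_fm f \<Longrightarrow> ''n'' \<notin> bound_regs f"
  by (induction f) auto

section \<open>Warshall's algorithm\<close>

text \<open>Reachability by paths whose inner vertices are all less than \<open>k\<close>.\<close>

fun warshall :: "(nat \<Rightarrow> nat \<Rightarrow> bool) \<Rightarrow> nat \<Rightarrow> nat \<Rightarrow> nat \<Rightarrow> bool" where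
  "warshall r 0 i j \<longleftrightarrow> r i j"
| "warshall r (Suc k) i j \<longleftrightarrow> warshall r k i j \<or> (warshall r k i k \<and> warshall r k k j)"

text \<open>An intermediate vertex that has been processed may be passed through. After all N rounds
  this applies to every vertex, which lets a chain of edges be assembled one edge at a time.\<close>

lemma warshall_trans:
  "l < k \<Longrightarrow> warshall r k i l \<Longrightarrow> warshall r k l j \<Longrightarrow> warshall r k i j"
proof (induction k arbitrary: i j)
  case (Suc k)
  show ?case
  proof (cases "l = k")
    case False
    then have "l < k" using Suc.prems(1) by simp
    then show ?thesis using Suc.IH Suc.prems(2,3) unfolding warshall.simps by blast
  next
    \<comment> \<open>Each way of reaching \<open>k\<close> within the first \<open>k + 1\<close>
      vertices contains one within the first \<open>k\<close>, and likewise for leaving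
      \<open>k\<close>.\<close>
    case True
    then show ?thesis using Suc.prems(2,3) unfolding warshall.simps by blast
  qed
qed simp

lemma warshall_imp_trancl: "warshall r k i j \<Longrightarrow> (i, j) \<in> {(i, j). r i j}\<^sup>+"
proof (induction k arbitrary: i j)
  case (Suc k)
  then show ?case unfolding warshall.simps by (blast intro: trancl_trans)
qed auto

lemma warshall_mono: "r i j \<Longrightarrow> warshall r k i j"
  by (induction k) auto

lemma warshall_eq_closure:
  "warshall (\<lambda>i j. i < N \<and> j < N \<and> r i j) N i j \<longleftrightarrow> closure_below N r i j"
proof
  let ?r = "\<lambda>i j. i < N \<and> j < N \<and> r i j"
  show "warshall ?r N i j \<Longrightarrow> closure_below N r i j"
    unfolding closure_below_def by (rule warshall_imp_trancl)
  assume "closure_below N r i j"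
  then have "(i, j) \<in> {(i, j). ?r i j}\<^sup>+" by (simp add: closure_below_def)
  then show "warshall ?r N i j"
  proof induction
    case (base j)
    then show ?case by (intro warshall_mono) simp
  next
    case (step j k)
    then have "warshall ?r N j k" "j < N" by (auto intro: warshall_mono)
    then show ?case using warshall_trans step.IH by blast
  qed
qed


section \<open>Correctness of the compiler\<close>

text \<open>A frame condition. The temporaries below \<open>d\<close> are kept because they hold the
  pending results of enclosing quantifiers.\<close>

definition preserves :: "string set \<Rightarrow> nat \<Rightarrow> string set \<Rightarrow> state \<Rightarrow> state \<Rightarrow> bool" where
  "preserves X d Y s s' \<longleftrightarrow> (\<forall>x. x \<notin> X \<and> (\<forall>j\<ge>d. x \<noteq> temp j) \<longrightarrow> reg s' x = reg s x) \<and>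
     (\<forall>a. a \<notin> Y \<longrightarrow> arr s' a = arr s a)"

lemma preserves_refl: "preserves X d Y s s"
  by (simp add: preserves_def)

lemma preserves_trans: "preserves X d Y s s' \<Longrightarrow> preserves X d Y s' s'' \<Longrightarrow> preserves X d Y s s''"
  by (simp add: preserves_def)

lemma preserves_mono:
  "preserves X d Y s s' \<Longrightarrow> X \<subseteq> X' \<Longrightarrow> d' \<le> d \<Longrightarrow> Y \<subseteq> Y' \<Longrightarrow> preserves X' d' Y' s s'"
  unfolding preserves_def by (meson order_trans subsetD)

lemma preserves_setr: "x \<in> X \<or> (\<exists>j\<ge>d. x = temp j) \<Longrightarrow> preserves X d Y s (setr s x v)"
  by (auto simp: preserves_def)

lemma preserves_seta: "a \<in> Y \<Longrightarrow> preserves X d Y s (seta s a h)"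
  by (simp add: preserves_def)

lemma preserves_reg: "preserves X d Y s s' \<Longrightarrow> x \<notin> X \<Longrightarrow> clean x \<Longrightarrow> reg s' x = reg s x"
  using clean_neq_temp by (simp add: preserves_def)

lemma preserves_sat:
  assumes "preserves X d Y s s'" "wf_fm f" "X \<inter> free_regs f = {}" "Y \<inter> free_arrs f = {}"
  shows "sat f s' \<longleftrightarrow> sat f s"
proof (rule sat_cong; rule ballI)
  show "reg s' x = reg s x" if "x \<in> free_regs f" for x
    using preserves_reg[OF assms(1)] free_regs_clean[OF assms(2) that] that assms(3) by blast
  show "arr s' a = arr s a" if "a \<in> free_arrs f" for a
    using assms(1,4) that by (auto simp: preserves_def)
qed

definition evaluates :: "nat \<Rightarrow> nat \<Rightarrow> fm \<Rightarrow> nat \<Rightarrow> state \<Rightarrow> nat \<Rightarrow> state \<Rightarrow> bool" where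
  "evaluates k n f d s t s' \<longleftrightarrow> exec ((n + 2) ^ k) (compile f d) s t s' \<and> t \<le> time f n \<and>
     inv_state n s' \<and> reg s' (temp d) = of_bool (sat f s) \<and>
     preserves (bound_regs f) d (bound_arrs f) s s'"

lemma evaluates_At:
  assumes "word_exponent (At e) \<le> k" "inv_state n s"
  shows "\<exists>t s'. evaluates k n (At e) d s t s'"
proof -
  have "exec ((n + 2) ^ k) (compile (At e) d) s (1 + cost (Less (Lit 0) e))
      (setr s (temp d) (val s (Less (Lit 0) e)))"
    unfolding compile.simps by (rule exec_assign) (use assms in simp_all)
  moreover have "1 + cost (Less (Lit 0) e) \<le> time (At e) n" by (simp add: cost_def)
  moreover have "inv_state n (setr s (temp d) (val s (Less (Lit 0) e)))"
    by (rule inv_state_setr) (use assms in simp_all)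
  moreover have "preserves {} d {} s (setr s (temp d) (val s (Less (Lit 0) e)))"
    by (rule preserves_setr) blast
  ultimately show ?thesis unfolding evaluates_def
    by (intro exI[of _ "1 + cost (Less (Lit 0) e)"]
        exI[of _ "setr s (temp d) (val s (Less (Lit 0) e))"]) simp
qed

lemma evaluates_Neg:
  assumes "25 \<le> k" "evaluates k n f d s t s'"
  shows "\<exists>t s'. evaluates k n (Neg f) d s t s'"
proof -
  note f = assms(2)[unfolded evaluates_def]
  let ?e = "Equal (Reg (temp d)) (Lit 0)"
  let ?s = "setr s' (temp d) (val s' ?e)"
  have "exec ((n + 2) ^ k) (Assign (temp d) ?e) s' (1 + cost ?e) ?s"
    by (rule exec_assign) (use f assms(1) in simp_all)
  with f have "exec ((n + 2) ^ k) (compile (Neg f) d) s (1 + t + (1 + cost ?e)) ?s"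
    unfolding compile.simps using exec.Seq by blast
  moreover have "1 + t + (1 + cost ?e) \<le> time (Neg f) n" using f by (simp add: cost_def)
  moreover have "inv_state n ?s" by (rule inv_state_setr) (use f in simp_all)
  moreover have "preserves (bound_regs f) d (bound_arrs f) s' ?s" by (rule preserves_setr) blast
  then have "preserves (bound_regs f) d (bound_arrs f) s ?s" using f preserves_trans by blast
  moreover have "reg ?s (temp d) = of_bool (sat (Neg f) s)" using f by simp
  ultimately show ?thesis unfolding evaluates_def bound_regs.simps bound_arrs.simps by blast
qed

text \<open>\<open>g\<close> is run in the state left by \<open>f\<close>. By \<open>wf_fm\<close>,
  \<open>f\<close> has clobbered nothing that \<open>g\<close> reads, so \<open>g\<close> has the
  same truth value there as in the initial state.\<close>

lemma evaluates_Conj: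
  assumes k: "25 \<le> k" and wf: "wf_fm (Conj f g)" and f: "evaluates k n f d s t s1"
    and g: "\<And>s. inv_state n s \<Longrightarrow> \<exists>t s'. evaluates k n g d s t s'"
  shows "\<exists>t s'. evaluates k n (Conj f g) d s t s'"
proof -
  note f = f[unfolded evaluates_def]
  have fits: "fits ((n + 2) ^ k) s1 (Reg (temp d))" using f k by (intro inv_state_fits) simp_all
  have pf: "preserves (bound_regs (Conj f g)) d (bound_arrs (Conj f g)) s s1"
    by (rule preserves_mono[of "bound_regs f" d "bound_arrs f"]) (use f in auto)
  show ?thesis
  proof (cases "sat f s")
    case True
    obtain u s2 where u: "evaluates k n g d s1 u s2" using g f by blast
    note u' = u[unfolded evaluates_def]
    have "exec ((n + 2) ^ k) (If (Reg (temp d)) (compile g d) Skip) s1 (1 + cost (Reg (temp d)) + u) s2"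
      by (rule exec.IfTrue[OF fits]) (use f True u' in simp_all)
    then have "exec ((n + 2) ^ k) (compile (Conj f g) d) s (1 + t + (1 + cost (Reg (temp d)) + u)) s2"
      unfolding compile.simps using f exec.Seq by blast
    moreover have "1 + t + (1 + cost (Reg (temp d)) + u) \<le> time (Conj f g) n"
      using f u' by (simp add: cost_def)
    moreover have "sat g s1 = sat g s"
      by (rule preserves_sat) (use f wf in auto)
    then have "reg s2 (temp d) = of_bool (sat (Conj f g) s)" using u' True by simp
    moreover have "preserves (bound_regs (Conj f g)) d (bound_arrs (Conj f g)) s1 s2"
      by (rule preserves_mono[of "bound_regs g" d "bound_arrs g"]) (use u' in auto)
    then have "preserves (bound_regs (Conj f g)) d (bound_arrs (Conj f g)) s s2"
      using pf preserves_trans by blast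
    ultimately show ?thesis using u' unfolding evaluates_def by blast
  next
    case False
    have "exec ((n + 2) ^ k) (If (Reg (temp d)) (compile g d) Skip) s1 (1 + cost (Reg (temp d)) + 1) s1"
      by (rule exec.IfFalse[OF fits]) (use f False exec.Skip in simp_all)
    then have "exec ((n + 2) ^ k) (compile (Conj f g) d) s (1 + t + (1 + cost (Reg (temp d)) + 1)) s1"
      unfolding compile.simps using f exec.Seq by blast
    moreover have "1 + t + (1 + cost (Reg (temp d)) + 1) \<le> time (Conj f g) n"
      using f by (simp add: cost_def)
    moreover have "reg s1 (temp d) = of_bool (sat (Conj f g) s)" using f False by simp
    ultimately show ?thesis using f pf unfolding evaluates_def by blast
  qed
qed

text \<open>The loop keeps in \<open>temp d\<close> whether a witness below the counter has been
  found. Earlier rounds may have clobbered bound locations, but on the free locations of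
  \<open>f\<close> round \<open>i\<close> starts from a state that agrees with
  \<open>setr s x i\<close>.\<close>

lemma evaluates_Ex:
  assumes k: "25 \<le> k" and wf: "wf_fm (Ex x a b f)" and s: "inv_state n s"
    and f: "\<And>s. inv_state n s \<Longrightarrow> \<exists>t s'. evaluates k n f (Suc d) s t s'"
  shows "\<exists>t s'. evaluates k n (Ex x a b f) d s t s'"
proof -
  let ?W = "(n + 2) ^ k" and ?X = "insert x (bound_regs f)" and ?Y = "bound_arrs f"
  define P where "P i s' \<longleftrightarrow> preserves ?X d ?Y s s' \<and>
    reg s' (temp d) = of_bool (\<exists>j<i. sat f (setr s x j))" for i :: nat and s'
  have tx: "temp j \<noteq> x" for j using wf clean_neq_temp by fastforce
  have tf: "temp j \<notin> bound_regs f" for j using wf bound_regs_clean clean_neq_temp by fastforce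
  let ?p = "Seq (compile f (Suc d)) (If (Reg (temp (Suc d))) (Assign (temp d) (Lit 1)) Skip)"
  let ?s0 = "setr s (temp d) 0"
  have 1: "exec ?W (Assign (temp d) (Lit 0)) s (1 + cost (Lit 0)) ?s0"
    using exec_assign[OF s, of "Lit 0" k "temp d"] k by simp
  have s0: "inv_state n ?s0" by (rule inv_state_setr) (use s in simp_all)
  have "\<exists>t s'. exec ?W (for_loop x a b ?p) ?s0 t s' \<and> t \<le> (a * n + b) * ((time f n + 7) + 13) + 11
    \<and> inv_state n s' \<and> P (a * n + b) s'"
  proof (rule exec_for_loop[OF _ _ _ k s0])
    have "preserves ?X d ?Y s (setr ?s0 x 0)"
      by (rule preserves_trans[of _ _ _ _ ?s0]) (rule preserves_setr, blast)+
    then show "P 0 (setr ?s0 x 0)" using tx by (simp add: P_def)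
  next
    fix i s1
    assume i: "i < a * n + b" and s1: "inv_state n s1" "reg s1 x = i" "P i s1"
    obtain t s2 where ev: "evaluates k n f (Suc d) s1 t s2" using f s1 by blast
    note ev = ev[unfolded evaluates_def]
    have "sat f s1 = sat f (setr s x i)"
    proof (rule sat_cong; rule ballI)
      show "reg s1 y = reg (setr s x i) y" if "y \<in> free_regs f" for y
      proof (cases "y = x")
        case False
        have "y \<notin> ?X" "clean y" using False that wf free_regs_clean by auto
        moreover have "preserves ?X d ?Y s s1" using s1(3) unfolding P_def by blast
        ultimately show ?thesis using preserves_reg[of ?X d ?Y s s1 y] False by simp
      qed (use s1 in simp)
      show "arr s1 c = arr (setr s x i) c" if "c \<in> free_arrs f" for c
        using s1(3) that wf unfolding P_def preserves_def by auto
    qed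
    then have r1: "reg s2 (temp (Suc d)) = of_bool (sat f (setr s x i))" using ev by simp
    have r2: "reg s2 (temp d) = reg s1 (temp d)" using ev tf unfolding preserves_def by simp
    have r3: "reg s2 x = i" using ev wf s1(2) preserves_reg by auto
    have p2: "preserves ?X d ?Y s s2"
    proof (rule preserves_trans)
      show "preserves ?X d ?Y s s1" using s1 unfolding P_def by blast
      show "preserves ?X d ?Y s1 s2"
        by (rule preserves_mono[of "bound_regs f" "Suc d" ?Y]) (use ev in auto)
    qed
    have fits: "fits ?W s2 (Reg (temp (Suc d)))" using ev k by (intro inv_state_fits) simp_all
    have "\<exists>u s3. exec ?W (If (Reg (temp (Suc d))) (Assign (temp d) (Lit 1)) Skip) s2 u s3 \<and> u \<le> 5
      \<and> inv_state n s3 \<and> reg s3 x = i \<and> P (Suc i) (setr s3 x (Suc i))"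
    proof (cases "sat f (setr s x i)")
      case True
      let ?s3 = "setr s2 (temp d) 1"
      have "exec ?W (Assign (temp d) (Lit 1)) s2 (1 + cost (Lit 1)) ?s3"
        using exec_assign[of n s2 "Lit 1" k "temp d"] k ev by simp
      then have "exec ?W (If (Reg (temp (Suc d))) (Assign (temp d) (Lit 1)) Skip) s2
          (1 + cost (Reg (temp (Suc d))) + (1 + cost (Lit 1))) ?s3"
        by (intro exec.IfTrue[OF fits]) (use r1 True in simp_all)
      moreover have "1 + cost (Reg (temp (Suc d))) + (1 + cost (Lit 1)) \<le> 5" by (simp add: cost_def)
      moreover have "inv_state n ?s3" by (rule inv_state_setr) (use ev in simp_all)
      moreover have "reg ?s3 x = i" using r3 tx[of d] by simp
      moreover have "preserves ?X d ?Y s (setr ?s3 x (Suc i))"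
        by (rule preserves_trans[OF p2], rule preserves_trans[of _ _ _ _ ?s3]) (rule preserves_setr, blast)+
      then have "P (Suc i) (setr ?s3 x (Suc i))"
        using True tx[of d] by (auto simp: P_def less_Suc_eq)
      ultimately show ?thesis by blast
    next
      case False
      have "exec ?W (If (Reg (temp (Suc d))) (Assign (temp d) (Lit 1)) Skip) s2
          (1 + cost (Reg (temp (Suc d))) + 1) s2"
        by (rule exec.IfFalse[OF fits]) (use r1 False exec.Skip in simp_all)
      moreover have "1 + cost (Reg (temp (Suc d))) + 1 \<le> 5" by (simp add: cost_def)
      moreover have "preserves ?X d ?Y s (setr s2 x (Suc i))"
        by (rule preserves_trans[OF p2]) (rule preserves_setr, blast)
      then have "P (Suc i) (setr s2 x (Suc i))"
        using False tx[of d] r2 s1(3) by (auto simp: P_def less_Suc_eq)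
      ultimately show ?thesis using ev r3 by blast
    qed
    then obtain u s3 where u: "exec ?W (If (Reg (temp (Suc d))) (Assign (temp d) (Lit 1)) Skip) s2 u s3"
      "u \<le> 5" "inv_state n s3" "reg s3 x = i" "P (Suc i) (setr s3 x (Suc i))" by blast
    have "exec ?W ?p s1 (1 + t + u) s3" using ev u exec.Seq by blast
    moreover have "1 + t + u \<le> time f n + 7" using ev u by simp
    ultimately show "\<exists>t s'. exec ?W ?p s1 t s' \<and> t \<le> time f n + 7 \<and> inv_state n s' \<and> reg s' x = i
        \<and> P (Suc i) (setr s' x (Suc i))" using u by blast
  qed (use wf in simp_all)
  then obtain t s' where t: "exec ?W (for_loop x a b ?p) ?s0 t s'"
    "t \<le> (a * n + b) * ((time f n + 7) + 13) + 11" "inv_state n s'" "P (a * n + b) s'" by blast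
  have "exec ?W (compile (Ex x a b f) d) s (1 + (1 + cost (Lit 0)) + t) s'"
    unfolding compile.simps by (rule exec.Seq[OF 1 t(1)])
  moreover have "1 + (1 + cost (Lit 0)) + t \<le> time (Ex x a b f) n"
    using t(2) by (simp add: cost_def add.commute)
  ultimately show ?thesis using t(3,4) inv_state_n[OF s] unfolding evaluates_def P_def
    bound_regs.simps bound_arrs.simps sat.simps by blast
qed


section \<open>Matrix loops for the transitive closure\<close>

lemma entry_inj: "b < N \<Longrightarrow> d < N \<Longrightarrow> a * N + b = c * N + d \<longleftrightarrow> a = c \<and> b = d" for a b c d N :: nat
  by (metis add.commute div_mult_self3 div_less mod_less mod_mult_self3 plus_nat.add_0 not_less_zero)

lemma entry_less: "a < N \<Longrightarrow> b < N \<Longrightarrow> a * N + b < N * N" for a b N :: nat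
proof -
  assume "a < N" "b < N"
  then have "a * N + b < Suc a * N" by simp
  also have "\<dots> \<le> N * N" using \<open>a < N\<close> by (intro mult_le_mono1) simp
  finally show ?thesis .
qed

lemma val_entry: "inv_state n s \<Longrightarrow> val s (entry i j) = val s i * (2 * n) + val s j"
  by (simp add: entry_def inv_state_n)

definition holds_matrix :: "nat \<Rightarrow> (nat \<Rightarrow> nat \<Rightarrow> nat) \<Rightarrow> state \<Rightarrow> bool" where
  "holds_matrix N h s \<longleftrightarrow> (\<forall>a<N. \<forall>b<N. arr s ''R'' (a * N + b) = h a b)"

text \<open>The contents during an in-place update from \<open>q\<close> to \<open>r\<close> in
  row-major order, just before entry \<open>(i, j)\<close> is processed.\<close>

definition partial :: "nat \<Rightarrow> nat \<Rightarrow> (nat \<Rightarrow> nat \<Rightarrow> nat) \<Rightarrow> (nat \<Rightarrow> nat \<Rightarrow> nat) \<Rightarrow> nat \<Rightarrow> nat \<Rightarrow> nat" where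
  "partial i j r q a b = (if a < i \<or> a = i \<and> b < j then r a b else q a b)"

lemma exec_double_loop:
  assumes k: "25 \<le> k" and s: "inv_state n s" and x: "x \<noteq> ''n''" "y \<noteq> ''n''" "x \<noteq> y"
    and X: "x \<in> X" "y \<in> X" and q: "holds_matrix (2 * n) q s"
    and body: "\<And>i j s'. i < 2 * n \<Longrightarrow> j < 2 * n \<Longrightarrow> inv_state n s' \<Longrightarrow> reg s' x = i \<Longrightarrow> reg s' y = j \<Longrightarrow>
      preserves X d {''R''} s s' \<Longrightarrow> holds_matrix (2 * n) (partial i j r q) s' \<Longrightarrow>
      \<exists>t s''. exec ((n + 2) ^ k) p s' t s'' \<and> t \<le> T \<and> inv_state n s'' \<and> reg s'' x = i \<and> reg s'' y = j \<and>
        preserves X d {''R''} s s'' \<and> holds_matrix (2 * n) (partial i (Suc j) r q) s''"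
  shows "\<exists>t s'. exec ((n + 2) ^ k) (for_loop x 2 0 (for_loop y 2 0 p)) s t s' \<and>
    t \<le> 2 * n * (2 * n * (T + 13) + 24) + 11 \<and> inv_state n s' \<and>
    preserves X d {''R''} s s' \<and> holds_matrix (2 * n) r s'"
proof -
  let ?N = "2 * n" and ?W = "(n + 2) ^ k"
  define P where "P i s' \<longleftrightarrow> preserves X d {''R''} s s' \<and> holds_matrix ?N (partial i 0 r q) s'" for i s'
  define Q where "Q i j s' \<longleftrightarrow> preserves X d {''R''} s s' \<and> holds_matrix ?N (partial i j r q) s' \<and> reg s' x = i"
    for i j s'
  have pres: "preserves X d {''R''} s (setr s' z v)" if "preserves X d {''R''} s s'" "z \<in> {x, y}" for s' z v
    by (rule preserves_trans[OF that(1)], rule preserves_setr) (use X that in auto)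
  have hm: "holds_matrix N h (setr s' z v) = holds_matrix N h s'" for N h s' z v
    by (simp add: holds_matrix_def)
  have "\<exists>t s'. exec ?W (for_loop x 2 0 (for_loop y 2 0 p)) s t s' \<and>
      t \<le> (2 * n + 0) * ((?N * (T + 13) + 11) + 13) + 11 \<and> inv_state n s' \<and> P (2 * n + 0) s'"
  proof (rule exec_for_loop[OF _ _ x(1) k s])
    have "partial 0 0 r q = q" by (simp add: partial_def fun_eq_iff)
    then show "P 0 (setr s x 0)" unfolding P_def hm using pres[OF preserves_refl] q by simp
  next
    fix i s1
    assume i: "i < 2 * n + 0" and s1: "inv_state n s1" "reg s1 x = i" "P i s1"
    have "\<exists>t s'. exec ?W (for_loop y 2 0 p) s1 t s' \<and> t \<le> (2 * n + 0) * (T + 13) + 11 \<and>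
      inv_state n s' \<and> Q i (2 * n + 0) s'"
    proof (rule exec_for_loop[OF _ _ x(2) k s1(1)])
      show "Q i 0 (setr s1 y 0)" using s1 x(3) pres unfolding P_def Q_def hm by simp
    next
      fix j s2
      assume j: "j < 2 * n + 0" and s2: "inv_state n s2" "reg s2 y = j" "Q i j s2"
      obtain t s3 where "exec ?W p s2 t s3" "t \<le> T" "inv_state n s3" "reg s3 x = i" "reg s3 y = j"
        "preserves X d {''R''} s s3" "holds_matrix ?N (partial i (Suc j) r q) s3"
        using body[of i j s2] i j s2 unfolding Q_def by auto
      then show "\<exists>t s'. exec ?W p s2 t s' \<and> t \<le> T \<and> inv_state n s' \<and> reg s' y = j \<and>
          Q i (Suc j) (setr s' y (Suc j))"
        using pres x(3) unfolding Q_def hm by (intro exI[of _ t] exI[of _ s3]) simp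
    qed simp_all
    then obtain t s' where t: "exec ?W (for_loop y 2 0 p) s1 t s'" "t \<le> ?N * (T + 13) + 11"
      "inv_state n s'" "Q i ?N s'" by auto
    \<comment> \<open>Row \<open>i\<close> being complete is the same as row \<open>i + 1\<close>
      not having been started.\<close>
    have "holds_matrix ?N (partial i ?N r q) s' = holds_matrix ?N (partial (Suc i) 0 r q) s'"
      unfolding holds_matrix_def partial_def by (intro all_cong1 imp_cong refl) (auto simp: less_Suc_eq)
    then show "\<exists>t s'. exec ?W (for_loop y 2 0 p) s1 t s' \<and> t \<le> ?N * (T + 13) + 11 \<and>
        inv_state n s' \<and> reg s' x = i \<and> P (Suc i) (setr s' x (Suc i))"
      using t pres unfolding Q_def P_def hm by (intro exI[of _ t] exI[of _ s']) simp
  qed simp_all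
  then obtain t s' where t: "exec ?W (for_loop x 2 0 (for_loop y 2 0 p)) s t s'"
    "t \<le> 2 * n * ((?N * (T + 13) + 11) + 13) + 11" "inv_state n s'" "P ?N s'" by auto
  have "holds_matrix ?N r s'" using t(4) unfolding P_def holds_matrix_def partial_def by simp
  then show ?thesis using t unfolding P_def by (intro exI[of _ t] exI[of _ s']) (simp add: add.assoc)
qed

lemma exec_store_entry:
  assumes "25 \<le> k" "inv_state n s" "reg s x < 2 * n" "reg s y < 2 * n" "val s e \<le> 1"
    "degree_bound e \<le> k"
  shows "exec ((n + 2) ^ k) (Store ''R'' (entry (Reg x) (Reg y)) e) s (8 + cost e)
      (seta s ''R'' ((arr s ''R'')(reg s x * (2 * n) + reg s y := val s e)))"
    and "inv_state n (seta s ''R'' ((arr s ''R'')(reg s x * (2 * n) + reg s y := val s e)))"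
proof -
  have v: "val s (entry (Reg x) (Reg y)) = reg s x * (2 * n) + reg s y" using val_entry assms(2) by simp
  have d: "degree_bound (entry (Reg x) (Reg y)) \<le> k" using assms(1) by (simp add: entry_def)
  have l: "val s (entry (Reg x) (Reg y)) < 2 * n * (2 * n)" unfolding v by (rule entry_less[OF assms(3,4)])
  have c: "1 + cost (entry (Reg x) (Reg y)) + cost e = 8 + cost e" by (simp add: cost_def entry_def)
  show "exec ((n + 2) ^ k) (Store ''R'' (entry (Reg x) (Reg y)) e) s (8 + cost e)
      (seta s ''R'' ((arr s ''R'')(reg s x * (2 * n) + reg s y := val s e)))"
    and "inv_state n (seta s ''R'' ((arr s ''R'')(reg s x * (2 * n) + reg s y := val s e)))"
    using exec_store_R[OF assms(2) d assms(6) l assms(5)] unfolding v c by simp_all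
qed

lemma holds_matrix_update:
  assumes "holds_matrix N (partial i j r q) s" "i < N" "j < N" "v = r i j"
  shows "holds_matrix N (partial i (Suc j) r q) (seta s ''R'' ((arr s ''R'')(i * N + j := v)))"
  unfolding holds_matrix_def
proof (intro allI impI)
  fix a b
  assume ab: "a < N" "b < N"
  show "arr (seta s ''R'' ((arr s ''R'')(i * N + j := v))) ''R'' (a * N + b) =
    partial i (Suc j) r q a b"
  proof (cases "a = i \<and> b = j")
    case False
    then have "partial i (Suc j) r q a b = partial i j r q a b" by (auto simp: partial_def)
    moreover have "a * N + b \<noteq> i * N + j" using False entry_inj[OF ab(2) assms(3)] by simp
    ultimately show ?thesis using ab assms(1) by (simp add: holds_matrix_def)
  qed (simp add: partial_def assms)
qed

lemma holds_matrix_skip: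
  assumes "holds_matrix N (partial i j r q) s" "r i j = q i j"
  shows "holds_matrix N (partial i (Suc j) r q) s"
proof -
  have "partial i (Suc j) r q = partial i j r q"
    using assms(2) by (auto simp: partial_def fun_eq_iff less_Suc_eq)
  then show ?thesis using assms(1) by simp
qed

text \<open>Filling \<open>R\<close> while \<open>f\<close> is evaluated is harmless, since
  \<open>f\<close> neither reads nor writes \<open>R\<close>. The old contents serve as the matrix
  that is replaced.\<close>

lemma exec_fill:
  assumes k: "25 \<le> k" and wf: "wf_fm (Tc x y f g)" and s: "inv_state n s"
    and f: "\<And>s. inv_state n s \<Longrightarrow> \<exists>t s'. evaluates k n f d s t s'"
  shows "\<exists>t s'. exec ((n + 2) ^ k) (for_loop x 2 0 (for_loop y 2 0
      (Seq (compile f d) (Store ''R'' (entry (Reg x) (Reg y)) (Reg (temp d)))))) s t s' \<and>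
    t \<le> 2 * n * (2 * n * (time f n + 10 + 13) + 24) + 11 \<and> inv_state n s' \<and>
    preserves ({x, y} \<union> bound_regs f) d {''R''} s s' \<and>
    holds_matrix (2 * n) (\<lambda>i j. of_bool (sat f (setr (setr s x i) y j))) s'"
proof (rule exec_double_loop[OF k s])
  let ?X = "{x, y} \<union> bound_regs f"
    and ?r = "\<lambda>i j. of_bool (sat f (setr (setr s x i) y j)) :: nat"
    and ?q = "\<lambda>i j. arr s ''R'' (i * (2 * n) + j)"
  show "holds_matrix (2 * n) ?q s" by (simp add: holds_matrix_def)
  fix i j s1
  assume ij: "i < 2 * n" "j < 2 * n" and s1: "inv_state n s1" "reg s1 x = i" "reg s1 y = j"
    "preserves ?X d {''R''} s s1" "holds_matrix (2 * n) (partial i j ?r ?q) s1"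
  obtain t s2 where ev: "evaluates k n f d s1 t s2" using f s1 by blast
  note ev = ev[unfolded evaluates_def]
  have xy: "reg s2 x = i" "reg s2 y = j"
    using ev wf s1(2,3) preserves_reg[of "bound_regs f" d "bound_arrs f" s1 s2] by auto
  have R: "arr s2 ''R'' = arr s1 ''R''" using ev wf by (simp add: preserves_def)
  have "sat f s1 = sat f (setr (setr s x i) y j)"
  proof (rule sat_cong; rule ballI)
    show "reg s1 z = reg (setr (setr s x i) y j) z" if "z \<in> free_regs f" for z
    proof (cases "z = x \<or> z = y")
      case False
      have "z \<notin> ?X" "clean z" using False that wf free_regs_clean by auto
      then show ?thesis using preserves_reg[OF s1(4)] False by simp
    qed (use s1 in auto)
    show "arr s1 c = arr (setr (setr s x i) y j) c" if "c \<in> free_arrs f" for c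
    proof -
      have "c \<noteq> ''R''" using that wf by auto
      then show ?thesis using s1(4) unfolding preserves_def by simp
    qed
  qed
  then have v: "val s2 (Reg (temp d)) = ?r i j" using ev by simp
  let ?s3 = "seta s2 ''R'' ((arr s2 ''R'')(reg s2 x * (2 * n) + reg s2 y := val s2 (Reg (temp d))))"
  have st: "exec ((n + 2) ^ k) (Store ''R'' (entry (Reg x) (Reg y)) (Reg (temp d))) s2
      (8 + cost (Reg (temp d))) ?s3" "inv_state n ?s3"
  proof -
    have "inv_state n s2" "reg s2 x < 2 * n" "reg s2 y < 2 * n" "val s2 (Reg (temp d)) \<le> 1"
      using ev xy ij v by simp_all
    moreover have "degree_bound (Reg (temp d)) \<le> k" using k by simp
    ultimately show "exec ((n + 2) ^ k) (Store ''R'' (entry (Reg x) (Reg y)) (Reg (temp d))) s2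
      (8 + cost (Reg (temp d))) ?s3" "inv_state n ?s3"
      using exec_store_entry[OF k] by blast+
  qed
  have "exec ((n + 2) ^ k) (Seq (compile f d) (Store ''R'' (entry (Reg x) (Reg y)) (Reg (temp d)))) s1
      (1 + t + (8 + cost (Reg (temp d)))) ?s3"
    using ev st exec.Seq by blast
  moreover have "1 + t + (8 + cost (Reg (temp d))) \<le> time f n + 10" using ev by (simp add: cost_def)
  moreover have "preserves ?X d {''R''} s ?s3"
  proof (rule preserves_trans[OF s1(4)], rule preserves_trans)
    show "preserves ?X d {''R''} s1 s2"
      by (rule preserves_mono[of "bound_regs f" d "bound_arrs f"]) (use ev wf in auto)
  qed (simp add: preserves_seta)
  moreover have "holds_matrix (2 * n) (partial i j ?r ?q) s2"
    using s1(5) R by (simp add: holds_matrix_def)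
  then have "holds_matrix (2 * n) (partial i (Suc j) ?r ?q) ?s3"
    unfolding xy by (rule holds_matrix_update) (use ij v in simp_all)
  ultimately show "\<exists>t s'. exec ((n + 2) ^ k)
      (Seq (compile f d) (Store ''R'' (entry (Reg x) (Reg y)) (Reg (temp d)))) s1 t s' \<and>
      t \<le> time f n + 10 \<and> inv_state n s' \<and> reg s' x = i \<and> reg s' y = j \<and>
      preserves ?X d {''R''} s s' \<and> holds_matrix (2 * n) (partial i (Suc j) ?r ?q) s'"
    using st(2) xy by (intro exI[of _ "1 + t + (8 + cost (Reg (temp d)))"] exI[of _ ?s3]) simp
qed (use wf in auto)

lemma exec_warshall_round:
  assumes k: "25 \<le> k" and s: "inv_state n s" and x: "distinct [x, y, ''k'', ''n'']"
    and m: "reg s ''k'' = m" "m < 2 * n" and w: "holds_matrix (2 * n) (\<lambda>i j. of_bool (warshall r m i j)) s"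
    and c: "clean x" "clean y"
  shows "\<exists>t s'. exec ((n + 2) ^ k) (for_loop x 2 0 (for_loop y 2 0
      (If (Mul (Load ''R'' (entry (Reg x) (Reg ''k''))) (Load ''R'' (entry (Reg ''k'') (Reg y))))
          (Store ''R'' (entry (Reg x) (Reg y)) (Lit 1)) Skip))) s t s' \<and>
    t \<le> 2 * n * (2 * n * (28 + 13) + 24) + 11 \<and> inv_state n s' \<and>
    preserves {x, y} d {''R''} s s' \<and>
    holds_matrix (2 * n) (\<lambda>i j. of_bool (warshall r (Suc m) i j)) s'"
proof (rule exec_double_loop[OF k s _ _ _ _ _ w])
  let ?e = "Mul (Load ''R'' (entry (Reg x) (Reg ''k''))) (Load ''R'' (entry (Reg ''k'') (Reg y)))"
  let ?p = "If ?e (Store ''R'' (entry (Reg x) (Reg y)) (Lit 1)) Skip"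
  let ?q = "\<lambda>i j. of_bool (warshall r m i j) :: nat"
    and ?r = "\<lambda>i j. of_bool (warshall r (Suc m) i j) :: nat"
  fix i j s1
  assume ij: "i < 2 * n" "j < 2 * n" and s1: "inv_state n s1" "reg s1 x = i" "reg s1 y = j"
    "preserves {x, y} d {''R''} s s1" "holds_matrix (2 * n) (partial i j ?r ?q) s1"
  have "clean ''k''" by (simp add: clean_def)
  then have km: "reg s1 ''k'' = m" using preserves_reg[OF s1(4), of "''k''"] x m by auto
  have fits: "fits ((n + 2) ^ k) s1 ?e" using s1(1) k by (intro inv_state_fits) (simp_all add: entry_def)
  text \<open>Row and column \<open>m\<close> do not change during the round.\<close>
  have row: "partial i j ?r ?q a m = ?q a m" "partial i j ?r ?q m a = ?q m a" for a
    by (auto simp: partial_def)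
  have "val s1 ?e = ?q i m * ?q m j"
    using s1(5) ij m(2) km s1(2,3) row unfolding holds_matrix_def by (simp add: val_entry[OF s1(1)])
  then have e: "val s1 ?e \<noteq> 0 \<longleftrightarrow> warshall r m i m \<and> warshall r m m j" by auto
  have ce: "cost ?e = 17" by (simp add: cost_def entry_def)
  show "\<exists>t s'. exec ((n + 2) ^ k) ?p s1 t s' \<and> t \<le> 28 \<and> inv_state n s' \<and> reg s' x = i \<and> reg s' y = j \<and>
      preserves {x, y} d {''R''} s s' \<and> holds_matrix (2 * n) (partial i (Suc j) ?r ?q) s'"
  proof (cases "val s1 ?e \<noteq> 0")
    case True
    let ?s2 = "seta s1 ''R'' ((arr s1 ''R'')(reg s1 x * (2 * n) + reg s1 y := val s1 (Lit 1)))"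
    have st: "exec ((n + 2) ^ k) (Store ''R'' (entry (Reg x) (Reg y)) (Lit 1)) s1
        (8 + cost (Lit 1)) ?s2" "inv_state n ?s2"
    proof -
      have "reg s1 x < 2 * n" "reg s1 y < 2 * n" "val s1 (Lit 1) \<le> 1" using s1 ij by simp_all
      moreover have "degree_bound (Lit 1) \<le> k" using k by simp
      ultimately show "exec ((n + 2) ^ k) (Store ''R'' (entry (Reg x) (Reg y)) (Lit 1)) s1
          (8 + cost (Lit 1)) ?s2" "inv_state n ?s2"
        using exec_store_entry[OF k s1(1)] by blast+
    qed
    have "exec ((n + 2) ^ k) ?p s1 (1 + cost ?e + (8 + cost (Lit 1))) ?s2"
      by (rule exec.IfTrue[OF fits True st(1)])
    moreover have "1 + cost ?e + (8 + cost (Lit 1)) \<le> 28" unfolding ce by (simp add: cost_def)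
    moreover have "preserves {x, y} d {''R''} s ?s2"
      by (rule preserves_trans[OF s1(4)]) (simp add: preserves_seta)
    moreover have "holds_matrix (2 * n) (partial i (Suc j) ?r ?q) ?s2"
      unfolding s1(2,3) by (rule holds_matrix_update[OF s1(5) ij]) (use True e in simp)
    ultimately show ?thesis using st(2) s1(2,3)
      by (intro exI[of _ "1 + cost ?e + (8 + cost (Lit 1))"] exI[of _ ?s2]) simp
  next
    case False
    then have "exec ((n + 2) ^ k) ?p s1 (1 + cost ?e + 1) s1"
      by (intro exec.IfFalse[OF fits]) (use exec.Skip in simp_all)
    moreover have "holds_matrix (2 * n) (partial i (Suc j) ?r ?q) s1"
      by (rule holds_matrix_skip[OF s1(5)]) (use False e in simp)
    ultimately show ?thesis using s1 ce by (intro exI[of _ "1 + cost ?e + 1"] exI[of _ s1]) simp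
  qed
qed (use x in auto)


lemma exec_warshall:
  assumes k: "25 \<le> k" and s: "inv_state n s" and x: "distinct [x, y, ''k'', ''n'']"
    and w: "holds_matrix (2 * n) (\<lambda>i j. of_bool (r i j)) s" and c: "clean x" "clean y"
  shows "\<exists>t s'. exec ((n + 2) ^ k) (for_loop ''k'' 2 0 (for_loop x 2 0 (for_loop y 2 0
      (If (Mul (Load ''R'' (entry (Reg x) (Reg ''k''))) (Load ''R'' (entry (Reg ''k'') (Reg y))))
          (Store ''R'' (entry (Reg x) (Reg y)) (Lit 1)) Skip)))) s t s' \<and>
    t \<le> 2 * n * (2 * n * (2 * n * (28 + 13) + 24) + 11 + 13) + 11 \<and> inv_state n s' \<and>
    preserves {x, y, ''k''} d {''R''} s s' \<and>
    holds_matrix (2 * n) (\<lambda>i j. of_bool (warshall r (2 * n) i j)) s'"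
proof -
  let ?p = "for_loop x 2 0 (for_loop y 2 0
      (If (Mul (Load ''R'' (entry (Reg x) (Reg ''k''))) (Load ''R'' (entry (Reg ''k'') (Reg y))))
          (Store ''R'' (entry (Reg x) (Reg y)) (Lit 1)) Skip))"
  let ?T = "2 * n * (2 * n * (28 + 13) + 24) + 11"
  define P where "P m s' \<longleftrightarrow> preserves {x, y, ''k''} d {''R''} s s' \<and>
    holds_matrix (2 * n) (\<lambda>i j. of_bool (warshall r m i j)) s'" for m s'
  have hm: "holds_matrix N h (setr s' z v) = holds_matrix N h s'" for N h s' z v
    by (simp add: holds_matrix_def)
  have pres: "preserves {x, y, ''k''} d {''R''} s (setr s' ''k'' v)"
    if "preserves {x, y, ''k''} d {''R''} s s'" for s' v
    by (rule preserves_trans[OF that], rule preserves_setr) simp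
  have "\<exists>t s'. exec ((n + 2) ^ k) (for_loop ''k'' 2 0 ?p) s t s' \<and>
      t \<le> (2 * n + 0) * (?T + 13) + 11 \<and> inv_state n s' \<and> P (2 * n + 0) s'"
  proof (rule exec_for_loop[OF _ _ _ k s])
    show "P 0 (setr s ''k'' 0)" unfolding P_def hm using pres[OF preserves_refl] w by simp
  next
    fix m s1
    assume m: "m < 2 * n + 0" and s1: "inv_state n s1" "reg s1 ''k'' = m" "P m s1"
    have m': "m < 2 * n" using m by simp
    have w1: "holds_matrix (2 * n) (\<lambda>i j. of_bool (warshall r m i j)) s1"
      using s1(3) unfolding P_def by blast
    obtain t s2 where t: "exec ((n + 2) ^ k) ?p s1 t s2" "t \<le> ?T" "inv_state n s2"
      "preserves {x, y} d {''R''} s1 s2"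
      "holds_matrix (2 * n) (\<lambda>i j. of_bool (warshall r (Suc m) i j)) s2"
      using exec_warshall_round[OF k s1(1) x s1(2) m' w1 c] by blast
    have "clean ''k''" by (simp add: clean_def)
    then have "reg s2 ''k'' = m" using preserves_reg[OF t(4), of "''k''"] x s1(2) by auto
    moreover have "preserves {x, y, ''k''} d {''R''} s s2"
    proof (rule preserves_trans)
      show "preserves {x, y, ''k''} d {''R''} s s1" using s1(3) unfolding P_def by blast
      show "preserves {x, y, ''k''} d {''R''} s1 s2"
        by (rule preserves_mono[OF t(4)]) auto
    qed
    ultimately show "\<exists>t s'. exec ((n + 2) ^ k) ?p s1 t s' \<and> t \<le> ?T \<and> inv_state n s' \<and>
        reg s' ''k'' = m \<and> P (Suc m) (setr s' ''k'' (Suc m))"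
      using t pres unfolding P_def hm by blast
  qed simp_all
  then show ?thesis unfolding P_def by simp
qed

lemma matrix_eq:
  assumes "inv_state n s" "holds_matrix (2 * n) (\<lambda>i j. of_bool (r i j)) s"
  shows "arr s ''R'' = matrix (2 * n) r"
proof
  fix j
  show "arr s ''R'' j = matrix (2 * n) r j"
  proof (cases "j < (2 * n) * (2 * n)")
    case True
    then have n: "0 < 2 * n" by (cases n) simp_all
    have "j div (2 * n) < 2 * n" using True by (simp add: less_mult_imp_div_less)
    moreover have "j mod (2 * n) < 2 * n" using n by simp
    ultimately have "arr s ''R'' (j div (2 * n) * (2 * n) + j mod (2 * n)) =
        of_bool (r (j div (2 * n)) (j mod (2 * n)))"
      using assms(2) unfolding holds_matrix_def by blast
    then show ?thesis using True unfolding matrix_def div_mult_mod_eq by simp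
  next
    case False
    then show ?thesis using assms(1) by (simp add: matrix_def inv_state_def)
  qed
qed

lemma evaluates_Tc:
  assumes k: "25 \<le> k" and wf: "wf_fm (Tc x y f g)" and s: "inv_state n s"
    and f: "\<And>s. inv_state n s \<Longrightarrow> \<exists>t s'. evaluates k n f d s t s'"
    and g: "\<And>s. inv_state n s \<Longrightarrow> \<exists>t s'. evaluates k n g d s t s'"
  shows "\<exists>t s'. evaluates k n (Tc x y f g) d s t s'"
proof -
  let ?X = "bound_regs (Tc x y f g)" and ?r = "\<lambda>i j. sat f (setr (setr s x i) y j)"
  let ?r' = "\<lambda>i j. i < 2 * n \<and> j < 2 * n \<and> ?r i j"
  have c: "clean x" "clean y" "distinct [x, y, ''k'', ''n'']" using wf by simp_all
  obtain t1 s1 where 1: "exec ((n + 2) ^ k) (for_loop x 2 0 (for_loop y 2 0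
      (Seq (compile f d) (Store ''R'' (entry (Reg x) (Reg y)) (Reg (temp d)))))) s t1 s1"
    "t1 \<le> 2 * n * (2 * n * (time f n + 10 + 13) + 24) + 11" "inv_state n s1"
    "preserves ({x, y} \<union> bound_regs f) d {''R''} s s1"
    "holds_matrix (2 * n) (\<lambda>i j. of_bool (?r i j)) s1"
    using exec_fill[OF k wf s f] by blast
  \<comment> \<open>Adding the bounds does not affect the stored block, but it gives the relation
    the form required by \<open>warshall_eq_closure\<close>.\<close>
  have m1: "holds_matrix (2 * n) (\<lambda>i j. of_bool (?r' i j)) s1"
    using 1(5) by (simp add: holds_matrix_def)
  obtain t2 s2 where 2: "exec ((n + 2) ^ k) (for_loop ''k'' 2 0 (for_loop x 2 0 (for_loop y 2 0
      (If (Mul (Load ''R'' (entry (Reg x) (Reg ''k''))) (Load ''R'' (entry (Reg ''k'') (Reg y))))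
          (Store ''R'' (entry (Reg x) (Reg y)) (Lit 1)) Skip)))) s1 t2 s2"
    "t2 \<le> 2 * n * (2 * n * (2 * n * (28 + 13) + 24) + 11 + 13) + 11" "inv_state n s2"
    "preserves {x, y, ''k''} d {''R''} s1 s2"
    "holds_matrix (2 * n) (\<lambda>i j. of_bool (warshall ?r' (2 * n) i j)) s2"
    using exec_warshall[OF k 1(3) c(3) m1 c(1,2)] by blast
  obtain t3 s3 where ev: "evaluates k n g d s2 t3 s3" using g 2(3) by blast
  note ev = ev[unfolded evaluates_def]
  have "preserves ({x, y, ''k''} \<union> bound_regs f) d {''R''} s s1"
    by (rule preserves_mono[OF 1(4)]) auto
  moreover have "preserves ({x, y, ''k''} \<union> bound_regs f) d {''R''} s1 s2"
    by (rule preserves_mono[OF 2(4)]) auto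
  ultimately have p: "preserves ({x, y, ''k''} \<union> bound_regs f) d {''R''} s s2"
    by (rule preserves_trans)
  have R: "arr s2 ''R'' = matrix (2 * n) (closure_below (2 * n) ?r)"
    using matrix_eq[OF 2(3,5)] unfolding warshall_eq_closure[of "2 * n" ?r] .
  let ?s = "seta s ''R'' (matrix (2 * n) (closure_below (2 * n) ?r))"
  \<comment> \<open>\<open>?s\<close> is the state in which the semantics evaluates
    \<open>g\<close>. It differs from \<open>s2\<close> in registers only, and \<open>g\<close>
    reads none of those.\<close>
  have "preserves ({x, y, ''k''} \<union> bound_regs f) d {} ?s s2"
    using p R unfolding preserves_def by auto
  then have "sat g s2 = sat g ?s"
    by (rule preserves_sat) (use wf in auto)
  then have "reg s3 (temp d) = of_bool (sat (Tc x y f g) s)"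
    using ev inv_state_n[OF s] by simp
  moreover have "preserves ?X d {''R''} s s3"
  proof (rule preserves_trans)
    show "preserves ?X d {''R''} s s2" by (rule preserves_mono[OF p]) auto
    show "preserves ?X d {''R''} s2 s3"
      by (rule preserves_mono[of "bound_regs g" d "bound_arrs g"]) (use ev wf in auto)
  qed
  moreover have "exec ((n + 2) ^ k) (compile (Tc x y f g) d) s (1 + t1 + (1 + t2 + t3)) s3"
    unfolding compile.simps using exec.Seq[OF 1(1) exec.Seq[OF 2(1)]] ev by blast
  moreover have "1 + t1 + (1 + t2 + t3) \<le> time (Tc x y f g) n"
    using 1(2) 2(2) ev by (simp add: algebra_simps)
  ultimately show ?thesis using ev unfolding evaluates_def bound_arrs.simps by blast
qed

lemma compile_correct:
  assumes "wf_fm f" "word_exponent f \<le> k" "25 \<le> k" "inv_state n s"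
  shows "\<exists>t s'. evaluates k n f d s t s'"
  using assms
proof (induction f arbitrary: d s)
  case (At e)
  then show ?case using evaluates_At by blast
next
  case (Neg f)
  then obtain t s' where "evaluates k n f d s t s'" by fastforce
  then show ?case by (rule evaluates_Neg[OF Neg.prems(3)])
next
  case (Conj f g)
  have wf: "wf_fm f" "wf_fm g" "word_exponent f \<le> k" "word_exponent g \<le> k" using Conj.prems by simp_all
  obtain t s' where "evaluates k n f d s t s'" using Conj.IH(1)[OF wf(1,3) Conj.prems(3,4)] by blast
  then show ?case
    by (rule evaluates_Conj[OF Conj.prems(3,1)]) (rule Conj.IH(2)[OF wf(2,4) Conj.prems(3)])
next
  case (Ex x a b f)
  have "wf_fm f" "word_exponent f \<le> k" using Ex.prems by simp_all
  then show ?case by (intro evaluates_Ex[OF Ex.prems(3,1,4)] Ex.IH Ex.prems(3))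
next
  case (Tc x y f g)
  have "wf_fm f" "wf_fm g" "word_exponent f \<le> k" "word_exponent g \<le> k" using Tc.prems by simp_all
  then show ?case by (intro evaluates_Tc[OF Tc.prems(3,1,4)] Tc.IH Tc.prems(3))
qed

section \<open>Polynomial running time\<close>

lemma poly_bound_mono: "a \<le> K * (n + 1) ^ d \<Longrightarrow> d \<le> e \<Longrightarrow> a \<le> K * (n + 1) ^ e" for n K a :: nat
  by (meson le_add2 mult_le_mono2 order_trans power_increasing)

text \<open>With base n + 1 instead of n, all powers are at least 1, so that additive constants can
  be absorbed for every n, including 0.\<close>

lemma time_polynomial: "\<exists>K. \<forall>n. time f n \<le> K * (n + 1) ^ depth f"
proof (induction f)
  case (At e)
  then show ?case by auto
next
  case (Neg f)
  then obtain K where K: "time f n \<le> K * (n + 1) ^ depth f" for n by blast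
  have "time (Neg f) n \<le> (K + 5) * (n + 1) ^ depth (Neg f)" for n
    using K[of n] by (simp add: add_mult_distrib add_mono)
  then show ?case by blast
next
  case (Conj f g)
  then obtain K L where K: "time f n \<le> K * (n + 1) ^ depth f" "time g n \<le> L * (n + 1) ^ depth g" for n
    by metis
  have "time (Conj f g) n \<le> (K + L + 5) * (n + 1) ^ depth (Conj f g)" for n
  proof -
    have "time f n \<le> K * (n + 1) ^ depth (Conj f g)" "time g n \<le> L * (n + 1) ^ depth (Conj f g)"
      by (rule poly_bound_mono[OF K(1)] poly_bound_mono[OF K(2)]; simp)+
    moreover have "1 \<le> (n + 1) ^ depth (Conj f g)" by (rule one_le_power) simp
    ultimately show ?thesis unfolding time.simps add_mult_distrib by linarith
  qed
  then show ?case by blast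
next
  case (Ex x a b f)
  then obtain K where K: "time f n \<le> K * (n + 1) ^ depth f" for n by blast
  have "time (Ex x a b f) n \<le> ((a + b) * (K + 20) + 15) * (n + 1) ^ depth (Ex x a b f)" for n
  proof -
    have 1: "1 \<le> (n + 1) ^ depth f" by simp
    have "time f n + 20 \<le> (K + 20) * (n + 1) ^ depth f"
      using K[of n] 1 unfolding add_mult_distrib by linarith
    moreover have "a * n + b \<le> (a + b) * (n + 1)" by (simp add: algebra_simps)
    ultimately have "(a * n + b) * (time f n + 20) \<le> ((a + b) * (n + 1)) * ((K + 20) * (n + 1) ^ depth f)"
      by (rule mult_le_mono[rotated])
    also have "\<dots> = (a + b) * (K + 20) * (n + 1) ^ depth (Ex x a b f)" by (simp add: algebra_simps)
    finally have "(a * n + b) * (time f n + 20) \<le> (a + b) * (K + 20) * (n + 1) ^ depth (Ex x a b f)" .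
    moreover have "1 \<le> (n + 1) ^ depth (Ex x a b f)" by (rule one_le_power) simp
    ultimately show ?thesis unfolding time.simps add_mult_distrib by linarith
  qed
  then show ?case by blast
next
  case (Tc x y f g)
  then obtain K L where K: "time f n \<le> K * (n + 1) ^ depth f" "time g n \<le> L * (n + 1) ^ depth g" for n
    by metis
  let ?d = "depth (Tc x y f g)"
  have "time (Tc x y f g) n \<le> (4 * K + L + 1000) * (n + 1) ^ ?d" for n
  proof -
    let ?P = "(n + 1) ^ ?d"
    have one: "1 \<le> ?P" by (rule one_le_power) simp
    have "n * n * time f n \<le> (n + 1) * (n + 1) * (K * (n + 1) ^ depth f)"
      by (intro mult_le_mono K) simp_all
    also have "\<dots> = K * (n + 1) ^ (Suc (Suc (depth f)))" by (simp add: algebra_simps)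
    finally have a: "n * n * time f n \<le> K * ?P" by (rule poly_bound_mono) simp
    have b: "time g n \<le> L * ?P" by (rule poly_bound_mono[OF K(2)]) simp
    have "n * n * n \<le> 1 * (n + 1) ^ 3" by (simp add: power3_eq_cube algebra_simps)
    then have c: "n * n * n \<le> 1 * ?P" by (rule poly_bound_mono) simp
    have "n * n \<le> 1 * (n + 1) ^ 3" by (simp add: power3_eq_cube algebra_simps)
    then have d: "n * n \<le> 1 * ?P" by (rule poly_bound_mono) simp
    have "n \<le> 1 * (n + 1) ^ 3" by (simp add: power3_eq_cube algebra_simps)
    then have e: "n \<le> 1 * ?P" by (rule poly_bound_mono) simp
    have "time (Tc x y f g) n = 4 * (n * n * time f n) + 400 * (n * n * n) + 240 * (n * n) + 120 * n
        + time g n + 30"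
      by (simp add: algebra_simps)
    also have "\<dots> \<le> (4 * K + L + 1000) * ?P"
      using a b c d e one unfolding add_mult_distrib by linarith
    finally show ?thesis .
  qed
  then show ?case by blast
qed

subsection \<open>Dominating sets\<close>

text \<open>The five vertices in \<open>no_P5\<close> need not be declared distinct: with symmetry
  and irreflexivity this follows from the prescribed edges and non-edges.\<close>

locale adj_graph =
  fixes n :: nat and A :: "nat \<Rightarrow> nat \<Rightarrow> bool"
  assumes A_sym: "A u v \<Longrightarrow> A v u"
    and A_irrefl: "\<not> A u u"
    and A_bound: "A u v \<Longrightarrow> u < n"
    and no_P5: "A a b \<Longrightarrow> A b c \<Longrightarrow> A c d \<Longrightarrow> A d e \<Longrightarrow>
      \<not> A a c \<Longrightarrow> \<not> A a d \<Longrightarrow> \<not> A a e \<Longrightarrow> \<not> A b d \<Longrightarrow> \<not> A b e \<Longrightarrow> \<not> A c e \<Longrightarrow> False"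
begin

text \<open>Triples stand for sets of one to three vertices, hence the possible equalities: either a
  clique, or a path with middle vertex \<open>q\<close>.\<close>

definition structured :: "nat \<Rightarrow> nat \<Rightarrow> nat \<Rightarrow> bool" where
  "structured p q r \<longleftrightarrow> (p = q \<or> A p q) \<and> (q = r \<or> A q r) \<and> (p = r \<or> A p r) \<or>
     A p q \<and> A q r \<and> p \<noteq> r"

definition dom :: "nat \<Rightarrow> nat \<Rightarrow> nat \<Rightarrow> nat \<Rightarrow> bool" where
  "dom p q r u \<longleftrightarrow> u = p \<or> u = q \<or> u = r \<or> A u p \<or> A u q \<or> A u r"

definition no_K4 :: bool where
  "no_K4 \<longleftrightarrow> (\<forall>a b c d. A a b \<longrightarrow> A a c \<longrightarrow> A a d \<longrightarrow> A b c \<longrightarrow> A b d \<longrightarrow> A c d \<longrightarrow> False)"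

lemma A_commute: "A u v \<longleftrightarrow> A v u"
  using A_sym by blast

section \<open>Exchanges that enlarge a dominated set\<close>

text \<open>A vertex \<open>v\<close> lost by the exchange is adjacent to \<open>q\<close>, and then
  \<open>u\<close>, \<open>w\<close>, \<open>p\<close>, \<open>q\<close>, \<open>v\<close> induce
  P5. In this and the following lemmas \<open>u\<close> is the vertex to be gained and
  \<open>w\<close> is its neighbour in the dominated set.\<close>

lemma extend_edge:
  assumes "A p q" "A u w" "\<not> A u p" "\<not> A u q" "A w p" "\<not> A w q"
    and v: "v = p \<or> v = q \<or> A v p \<or> A v q"
  shows "dom p w u v"
proof (rule ccontr)
  assume v': "\<not> dom p w u v"
  then have "A v q" using v assms(1) A_sym by (auto simp: dom_def)
  then show False using no_P5[of u w p q v] assms v' A_commute unfolding dom_def by metis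
qed

lemma extend_triangle_1:
  assumes "A p q" "A p r" "A u w" "\<not> A u p" "\<not> A u q" "\<not> A u r" "A w p" "\<not> A w q" "\<not> A w r"
    and v: "dom p q r v"
  shows "dom p w u v"
proof (rule ccontr)
  assume v': "\<not> dom p w u v"
  then consider "A v q" | "A v r" using v assms(1,2) A_sym by (auto simp: dom_def)
  then show False
    using no_P5[of u w p q v] no_P5[of u w p r v] assms v' A_commute unfolding dom_def by metis
qed

text \<open>Suppose that the two exchanges lose \<open>t\<close> and \<open>s\<close>. Then
  \<open>t\<close> sees \<open>r\<close> but not \<open>p\<close>, \<open>q\<close>,
  \<open>w\<close>, and successive P5s force the edges \<open>tu\<close>, \<open>sq\<close>,
  \<open>st\<close> and the non-edge \<open>sr\<close>, until \<open>u\<close>, \<open>t\<close>,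
  \<open>s\<close>, \<open>q\<close>, \<open>p\<close> induce P5. The lemmas with two alternatives
  below follow the same pattern.\<close>

lemma extend_triangle_2:
  assumes e: "A p q" "A p r" "A q r" "A u w" "\<not> A u p" "\<not> A u q" "\<not> A u r" "A w p" "A w q" "\<not> A w r"
  shows "(\<forall>v. dom p q r v \<longrightarrow> dom p q w v) \<or> (\<forall>v. dom p q r v \<longrightarrow> dom p w u v)"
proof (rule ccontr)
  assume "\<not> ?thesis"
  then obtain t s where t: "dom p q r t" "\<not> dom p q w t" and s: "dom p q r s" "\<not> dom p w u s"
    by blast
  have tr: "A t r" using t e A_sym by (auto simp: dom_def)
  have t': "\<not> A t p" "\<not> A t q" "\<not> A t w" using t(2) by (auto simp: dom_def)
  have s': "\<not> A s p" "\<not> A s w" "\<not> A s u" using s(2) by (auto simp: dom_def)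
  have tu: "A t u" using no_P5[of u w p r t] e tr t' A_commute by metis
  have sr: "\<not> A s r" using no_P5[of u w p r s] e s' A_commute by metis
  have "s \<noteq> q" "s \<noteq> r" using s(2) e A_sym by (auto simp: dom_def)
  then have sq: "A s q" using s sr by (auto simp: dom_def)
  have st: "A s t" using no_P5[of s q r t u] e s' t' sr sq tu tr A_commute by metis
  show False using no_P5[of u t s q p] e s' t' sq st tu A_commute by metis
qed

text \<open>A lost vertex \<open>v\<close> is adjacent to an end of the path, and then
  \<open>u\<close>, \<open>w\<close>, \<open>q\<close>, that end and \<open>v\<close> induce
  P5.\<close>

lemma extend_path_middle:
  assumes e: "A p q" "A q r" "\<not> A p r" "A u w" "\<not> A u p" "\<not> A u q" "\<not> A u r"
    and w: "A w q" "\<not> A w p" "\<not> A w r" and v: "dom p q r v"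
  shows "dom u w q v"
proof (rule ccontr)
  assume v': "\<not> dom u w q v"
  then consider "A v p" | "A v r" using v e A_sym by (auto simp: dom_def)
  then show False
    using no_P5[of u w q p v] no_P5[of u w q r v] e w v' A_commute unfolding dom_def by metis
qed

lemma extend_path_ends:
  assumes e: "A p q" "A q r" "\<not> A p r" "A u w" "\<not> A u p" "\<not> A u q" "\<not> A u r"
    and w: "\<not> A w q" "A w p" "A w r"
  shows "(\<forall>v. dom p q r v \<longrightarrow> dom p w r v) \<or> (\<forall>v. dom p q r v \<longrightarrow> dom u w p v)"
proof (rule ccontr)
  assume "\<not> ?thesis"
  then obtain t s where t: "dom p q r t" "\<not> dom p w r t" and s: "dom p q r s" "\<not> dom u w p s"
    by blast
  have t': "\<not> A t p" "\<not> A t w" "\<not> A t r" using t(2) by (auto simp: dom_def)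
  have s': "\<not> A s p" "\<not> A s w" "\<not> A s u" using s(2) by (auto simp: dom_def)
  have tq: "A t q" using t e w A_sym by (auto simp: dom_def)
  have tu: "A t u" using no_P5[of t q p w u] e w tq t' A_commute by metis
  have sq: "\<not> A s q" using no_P5[of s q p w u] e w s' A_commute by metis
  have "s \<noteq> q" "s \<noteq> r" using s(2) e w A_sym by (auto simp: dom_def)
  then have sr: "A s r" using s sq by (auto simp: dom_def)
  have st: "A s t" using no_P5[of s r q t u] e s' t' sr sq tu tq A_commute by metis
  show False using no_P5[of p w u t s] e w s' t' st tu A_commute by metis
qed

lemma extend_path_edge:
  assumes e: "A p q" "A q r" "\<not> A p r" "A u w" "\<not> A u p" "\<not> A u q" "\<not> A u r"
    and w: "A w q" "A w p" "\<not> A w r"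
  shows "(\<forall>v. dom p q r v \<longrightarrow> dom p q w v) \<or> (\<forall>v. dom p q r v \<longrightarrow> dom u w q v)"
proof (rule ccontr)
  assume "\<not> ?thesis"
  then obtain t s where t: "dom p q r t" "\<not> dom p q w t" and s: "dom p q r s" "\<not> dom u w q s"
    by blast
  have t': "\<not> A t p" "\<not> A t q" "\<not> A t w" using t(2) by (auto simp: dom_def)
  have s': "\<not> A s q" "\<not> A s w" "\<not> A s u" using s(2) by (auto simp: dom_def)
  have tr: "A t r" using t e w A_sym by (auto simp: dom_def)
  have tu: "A t u" using no_P5[of u w q r t] e w tr t' A_commute by metis
  have sr: "\<not> A s r" using no_P5[of u w q r s] e w s' A_commute by metis
  have sp: "A s p" using s e A_sym sr by (auto simp: dom_def)
  have st: "A s t" using no_P5[of s p q r t] e w s' t' sr sp tr A_commute by metis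
  show False using no_P5[of u t s p q] e w s' t' st tu sp A_commute by metis
qed

text \<open>The vertices \<open>t\<close>, \<open>s\<close>, \<open>x\<close> lost by the three
  exchanges are attached to \<open>r\<close>, \<open>p\<close>, \<open>q\<close> respectively and to
  no other vertex of the path. Excluding P5 then forces all edges among \<open>u\<close>,
  \<open>t\<close>, \<open>s\<close>, \<open>x\<close>, which is a K4.\<close>

lemma extend_path_all:
  assumes K: no_K4
    and e: "A p q" "A q r" "\<not> A p r" "A u w" "\<not> A u p" "\<not> A u q" "\<not> A u r"
    and w: "A w q" "A w p" "A w r"
  shows "(\<forall>v. dom p q r v \<longrightarrow> dom p q w v) \<or> (\<forall>v. dom p q r v \<longrightarrow> dom q r w v) \<or>
    (\<forall>v. dom p q r v \<longrightarrow> dom p w r v)"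
proof (rule ccontr)
  assume "\<not> ?thesis"
  then obtain t s x where t: "dom p q r t" "\<not> dom p q w t" and s: "dom p q r s" "\<not> dom q r w s"
    and x: "dom p q r x" "\<not> dom p w r x"
    by blast
  have t': "\<not> A t p" "\<not> A t q" "\<not> A t w" using t(2) by (auto simp: dom_def)
  have s': "\<not> A s q" "\<not> A s r" "\<not> A s w" using s(2) by (auto simp: dom_def)
  have x': "\<not> A x p" "\<not> A x w" "\<not> A x r" using x(2) by (auto simp: dom_def)
  have tr: "A t r" using t e w A_sym by (auto simp: dom_def)
  have sp: "A s p" using s e w A_sym by (auto simp: dom_def)
  have xq: "A x q" using x e w A_sym by (auto simp: dom_def)
  have st: "A s t" using no_P5[of s p q r t] e s' t' sp tr A_commute by metis
  \<comment> \<open>Without the edge \<open>ut\<close> there would be the edge \<open>us\<close>,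
    which in turn forces \<open>ut\<close>. So \<open>ut\<close> is present, and with it
    \<open>us\<close> follows unconditionally.\<close>
  have us: "A u s" if "\<not> A u t" using no_P5[of t s p w u] that e w s' t' sp st A_commute by metis
  have ut: "A u t" using no_P5[of t s u w q] us e w s' t' st A_commute by metis
  have us: "A u s" using no_P5[of s t u w q] ut e w s' t' st A_commute by metis
  have xst: "A x s" "A x t" if "\<not> A x u"
    using no_P5[of x q w u s] no_P5[of x q w u t] that us ut e w s' t' x' xq A_commute by metis+
  have xu: "A x u"
    using no_P5[of p q x t u] xst e w s' t' x' xq ut A_commute by metis
  have "A x s" using no_P5[of s u x q r] us xu e w s' x' xq A_commute by metis
  moreover have "A x t" using no_P5[of t u x q p] ut xu e w t' x' xq A_commute by metis
  ultimately show False using K xu us ut st A_commute unfolding no_K4_def by metis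
qed

lemma dom_perm: "dom p q r = dom q p r" "dom p q r = dom p r q"
  unfolding dom_def by auto

lemma structured_bound: "structured p q r \<Longrightarrow> p < n \<Longrightarrow> q < n \<and> r < n"
  unfolding structured_def using A_bound A_sym by blast

text \<open>The exchanges are combined by the shape of the triple and the attachment of
  \<open>w\<close>. Two attachments need no exchange: \<open>w\<close> joined to a whole triangle
  gives K4, and \<open>w\<close> joined to just one end of an induced path gives P5 together with
  \<open>u\<close>.\<close>

lemma extend_domination:
  assumes K: no_K4 and D: "structured p q r" and u: "\<not> dom p q r u" and w: "dom p q r w" "A u w"
  shows "\<exists>p' q' r'. structured p' q' r' \<and> dom p' q' r' u \<and> (\<forall>v. dom p q r v \<longrightarrow> dom p' q' r' v)"
proof -
  have u': "\<not> A u p" "\<not> A u q" "\<not> A u r" using u by (auto simp: dom_def)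
  then have w': "w \<noteq> p" "w \<noteq> q" "w \<noteq> r" using w by auto
  then have wD: "A w p \<or> A w q \<or> A w r" using w by (auto simp: dom_def)
  have wu: "w \<noteq> u" "A w u" using w A_irrefl A_sym by auto
  have path: "structured a w u" "structured u w a" if "A w a" "a \<in> {p, q, r}" for a
    using that w(2) u' A_sym u unfolding structured_def dom_def by blast+
  have du: "dom a b c u" if "w = a \<or> w = b \<or> w = c" for a b c using that w by (auto simp: dom_def)
  \<comment> \<open>Coincidences removed, the triple is a vertex, an edge, a triangle or an induced
    path.\<close>
  consider (one) "p = q" "q = r" | (two) a b where "A a b" "{a, b} = {p, q, r}"
    | (three) "A p q" "A q r" "A p r" | (path) "A p q" "A q r" "\<not> A p r" "p \<noteq> r"
    using D unfolding structured_def by (metis insert_absorb2 insert_commute A_sym)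
  then show ?thesis
  proof cases
    case one
    then have "structured p w w" "\<forall>v. dom p q r v \<longrightarrow> dom p w w v"
      using wD A_sym by (auto simp: structured_def dom_def)
    then show ?thesis using du by blast
  next
    case two
    have dv: "dom p q r v \<longleftrightarrow> v = a \<or> v = b \<or> A v a \<or> A v b" for v
    proof -
      have "dom p q r v \<longleftrightarrow> (\<exists>d\<in>{p, q, r}. v = d \<or> A v d)" by (auto simp: dom_def)
      then show ?thesis unfolding two(2)[symmetric] by auto
    qed
    have ab: "a \<in> {p, q, r}" "b \<in> {p, q, r}" using two(2) by auto
    have nu: "\<not> A u a" "\<not> A u b" using u' ab by auto
    have "A w a \<or> A w b" using dv[of w] w ab w' by auto
    then consider "A w a" "A w b" | "A w a" "\<not> A w b" | "\<not> A w a" "A w b" by blast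
    then show ?thesis
    proof cases
      case 1
      then have "structured a b w" using two A_sym by (auto simp: structured_def)
      moreover have "\<forall>v. dom p q r v \<longrightarrow> dom a b w v" unfolding dv by (auto simp: dom_def)
      ultimately show ?thesis using du by blast
    next
      case 2
      then have "\<forall>v. dom p q r v \<longrightarrow> dom a w u v" using extend_edge[OF two(1) w(2) nu] dv by blast
      then show ?thesis using path(1)[OF 2(1) ab(1)] du by blast
    next
      case 3
      then have "\<forall>v. dom p q r v \<longrightarrow> dom b w u v"
        using extend_edge[OF A_sym[OF two(1)] w(2) nu(2,1)] dv by blast
      then show ?thesis using path(1)[OF 3(2) ab(2)] du by blast
    qed
  next
    case three
    have s: "A q p" "A r q" "A r p" using three A_sym by auto
    have perm: "dom q p r = dom p q r" "dom r p q = dom p q r" "dom q r p = dom p q r" "dom p r q = dom p q r"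
      using dom_perm by metis+
    have *: ?thesis if "\<exists>a b c. structured a b c \<and> (w = a \<or> w = b \<or> w = c) \<and> (\<forall>v. dom p q r v \<longrightarrow> dom a b c v)"
      using that du by blast
    have tri: "structured a b w" if "A a b" "A w a" "A w b" for a b
      using that A_sym by (auto simp: structured_def)
    have no: "\<not> (A w p \<and> A w q \<and> A w r)" using K three unfolding no_K4_def by blast
    consider (1) "A w p" "\<not> A w q" "\<not> A w r" | (2) "\<not> A w p" "A w q" "\<not> A w r"
      | (3) "\<not> A w p" "\<not> A w q" "A w r" | (4) "A w p" "A w q" "\<not> A w r"
      | (5) "A w p" "\<not> A w q" "A w r" | (6) "\<not> A w p" "A w q" "A w r"
      using no wD by blast
    then show ?thesis
    proof cases
      case 1
      show ?thesis using extend_triangle_1[OF three(1,3) w(2) u' 1] path(1)[of p] 1 * by blast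
    next
      case 2
      show ?thesis using extend_triangle_1[OF s(1) three(2) w(2) u'(2,1,3) 2(2,1,3)] path(1)[of q] 2 *
        unfolding perm by blast
    next
      case 3
      show ?thesis using extend_triangle_1[OF s(3,2) w(2) u'(3,1,2) 3(3,1,2)] path(1)[of r] 3 *
        unfolding perm by blast
    next
      case 4
      show ?thesis using extend_triangle_2[OF three(1,3,2) w(2) u' 4] path(1)[of p] tri[of p q] three 4 *
        by blast
    next
      case 5
      show ?thesis using extend_triangle_2[OF three(3,1) s(2) w(2) u'(1,3,2) 5(1,3,2)]
        path(1)[of p] tri[of p r] three 5 * unfolding perm by blast
    next
      case 6
      show ?thesis using extend_triangle_2[OF three(2) s(1) s(3) w(2) u'(2,3,1) 6(2,3,1)]
        path(1)[of q] tri[of q r] three 6 * unfolding perm by blast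
    qed
  next
    case path: path
    have s: "A q p" "A r q" "\<not> A r p" using path A_sym by auto
    have perm: "dom r q p = dom p q r" using dom_perm by metis
    have *: ?thesis if "\<exists>a b c. structured a b c \<and> (w = a \<or> w = b \<or> w = c) \<and> (\<forall>v. dom p q r v \<longrightarrow> dom a b c v)"
      using that du by blast
    have tri: "structured a b w" if "A a b" "A w a" "A w b" for a b
      using that A_sym by (auto simp: structured_def)
    note P3 = \<open>\<And>a. A w a \<Longrightarrow> a \<in> {p, q, r} \<Longrightarrow> structured u w a\<close>
    consider (1) "A w p" "\<not> A w q" "\<not> A w r" | (2) "\<not> A w p" "A w q" "\<not> A w r"
      | (3) "\<not> A w p" "\<not> A w q" "A w r" | (4) "A w p" "A w q" "\<not> A w r"
      | (5) "A w p" "\<not> A w q" "A w r" | (6) "\<not> A w p" "A w q" "A w r"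
      | (7) "A w p" "A w q" "A w r"
      using wD by blast
    then show ?thesis
    proof cases
      case 1
      then show ?thesis using no_P5[of u w p q r] w path u' by blast
    next
      case 2
      show ?thesis using extend_path_middle[OF path(1-3) w(2) u' 2(2,1,3)] P3[of q] 2 * by blast
    next
      case 3
      then show ?thesis using no_P5[of u w r q p] w s u' by blast
    next
      case 4
      show ?thesis using extend_path_edge[OF path(1-3) w(2) u' 4(2,1,3)] P3[of q] tri[of p q] path 4 *
        by blast
    next
      case 5
      have "structured p w r" using 5 path(4) A_sym by (auto simp: structured_def)
      then show ?thesis using extend_path_ends[OF path(1-3) w(2) u' 5(2,1,3)] P3[of p] 5 * by blast
    next
      case 6
      show ?thesis using extend_path_edge[OF s(2,1,3) w(2) u'(3,2,1) 6(2,3,1)] P3[of q] tri[of r q] s 6 *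
        unfolding perm by blast
    next
      case 7
      have "structured p w r" using 7 path(4) A_sym by (auto simp: structured_def)
      then show ?thesis using extend_path_all[OF K path(1-3) w(2) u' 7(2,1,3)] tri[of p q] tri[of q r] path 7 *
        by blast
    qed
  qed
qed

text \<open>Among the finitely many closed neighbourhoods of structured triples that contain
  \<open>v\<close>, a maximal one is closed under adjacency by \<open>extend_domination\<close>. The
  triple \<open>(v, v, v)\<close> shows that there are any.\<close>

lemma dominating_triple:
  assumes K: no_K4 and v: "v < n"
  shows "\<exists>p<n. \<exists>q<n. \<exists>r<n. structured p q r \<and> dom p q r v \<and>
    (\<forall>u w. dom p q r u \<longrightarrow> A u w \<longrightarrow> dom p q r w)"
proof -
  define \<S> where "\<S> = (\<lambda>(p, q, r). {u. dom p q r u}) `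
    {(p, q, r). p < n \<and> q < n \<and> r < n \<and> structured p q r \<and> dom p q r v}"
  have "finite {(p, q, r). p < n \<and> q < n \<and> r < n \<and> structured p q r \<and> dom p q r v}"
    by (rule finite_subset[of _ "{..<n} \<times> {..<n} \<times> {..<n}"]) auto
  then have fin: "finite \<S>" unfolding \<S>_def by (rule finite_imageI)
  have in_S: "{u. dom p q r u} \<in> \<S>"
    if "p < n" "q < n" "r < n" "structured p q r" "dom p q r v" for p q r
    unfolding \<S>_def by (rule image_eqI[of _ _ "(p, q, r)"]) (use that in simp_all)
  have "structured v v v" "dom v v v v" by (simp_all add: structured_def dom_def)
  then have "\<S> \<noteq> {}" using in_S[OF v v v] by blast
  then obtain M where M: "M \<in> \<S>" and max: "\<And>B. B \<in> \<S> \<Longrightarrow> M \<subseteq> B \<Longrightarrow> M = B"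
    using finite_has_maximal[OF fin] by metis
  obtain p q r where D: "M = {u. dom p q r u}" "p < n" "q < n" "r < n" "structured p q r" "dom p q r v"
    using M unfolding \<S>_def by auto
  have "dom p q r w" if w: "dom p q r u" "A u w" for u w
  proof (rule ccontr)
    assume nw: "\<not> dom p q r w"
    obtain p' q' r' where D': "structured p' q' r'" "dom p' q' r' w" "\<And>v. dom p q r v \<Longrightarrow> dom p' q' r' v"
      using extend_domination[OF K D(5) nw w(1) A_sym[OF w(2)]] by blast
    have "w < n" using A_bound A_sym w by blast
    \<comment> \<open>A triple starting outside the graph has no edges, so it would consist of
      \<open>p'\<close> alone and dominate only \<open>p'\<close>, yet it dominates
      \<open>w < n\<close>.\<close>
    have "p' < n"
    proof (rule ccontr)
      assume "\<not> p' < n"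
      then have no: "\<not> A p' x" for x using A_bound by blast
      then have "p' = q'" "p' = r'" using D'(1) unfolding structured_def by blast+
      then have "w = p'" using D'(2) no A_sym unfolding dom_def by blast
      then show False using \<open>w < n\<close> \<open>\<not> p' < n\<close> by simp
    qed
    then have "{u. dom p' q' r' u} \<in> \<S>" using D'(1,3) D(6) structured_bound in_S by blast
    moreover have "M \<subseteq> {u. dom p' q' r' u}" using D D' by blast
    ultimately have "M = {u. dom p' q' r' u}" by (rule max)
    then show False using D(1) D'(2) nw by blast
  qed
  then show ?thesis using D by blast
qed

end

subsection \<open>From a guess to 2-SAT\<close>

text \<open>Literal \<open>2 v + b\<close> assigns the bit \<open>b\<close> to the variable \<open>v\<close>.\<close>

definition flip :: "nat \<Rightarrow> nat" where
  "flip l = 2 * (l div 2) + (1 - l mod 2)"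

lemma flip_div: "flip l div 2 = l div 2"
  by (simp add: flip_def)

lemma flip_mod: "flip l mod 2 = 1 - l mod 2"
  by (cases "even l") (auto simp: flip_def odd_iff_mod_2_eq_one)

lemma flip_flip [simp]: "flip (flip l) = l"
proof -
  have "flip (flip l) = 2 * (l div 2) + (1 - (1 - l mod 2))"
    using flip_def[of "flip l"] unfolding flip_div flip_mod .
  also have "1 - (1 - l mod 2) = l mod 2" by (cases "even l") (auto simp: odd_iff_mod_2_eq_one)
  finally show ?thesis by simp
qed

lemma flip_less [simp]: "flip l < 2 * n \<longleftrightarrow> l < 2 * n"
  unfolding flip_def by presburger

section \<open>2-SAT by transitive closure\<close>

text \<open>This is contraposition. \<open>K l m\<close> says that \<open>l\<close> and
  \<open>m\<close> exclude each other, so the relation relates \<open>l\<close> to the literals that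
  it implies in one step.\<close>

lemma closure_below_flip:
  assumes sym: "\<And>l m. K l m \<Longrightarrow> K m l"
    and "closure_below (2 * n) (\<lambda>l m. K l (flip m)) l m"
  shows "closure_below (2 * n) (\<lambda>l m. K l (flip m)) (flip m) (flip l)"
  using assms(2) unfolding closure_below_def
proof induction
  case (base m)
  then have "(flip m, flip l) \<in> {(i, j). i < 2 * n \<and> j < 2 * n \<and> K i (flip j)}" using sym by auto
  then show ?case by (rule r_into_trancl)
next
  case (step m k)
  then have "(flip k, flip m) \<in> {(i, j). i < 2 * n \<and> j < 2 * n \<and> K i (flip j)}" using sym by auto
  then show ?case using step.IH by (rule trancl_into_trancl2)
qed

text \<open>\<open>S\<close> is the set of true literals, and the clauses are given by their
  forbidden pairs. A pair \<open>K l l\<close> is a unit clause against \<open>l\<close>.\<close>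

definition two_sat :: "nat \<Rightarrow> (nat \<Rightarrow> nat \<Rightarrow> bool) \<Rightarrow> nat set \<Rightarrow> bool" where
  "two_sat n K S \<longleftrightarrow> (\<forall>l<2 * n. l \<in> S \<longleftrightarrow> flip l \<notin> S) \<and>
     (\<forall>l<2 * n. \<forall>m<2 * n. l \<in> S \<longrightarrow> m \<in> S \<longrightarrow> \<not> K l m)"

lemma two_sat_closed:
  assumes "two_sat n K S" "closure_below (2 * n) (\<lambda>l m. K l (flip m)) l m" "l \<in> S"
  shows "m \<in> S"
  using assms(2) unfolding closure_below_def
proof induction
  case (base m)
  then show ?case using assms(1,3) unfolding two_sat_def by (metis (no_types, lifting) case_prodD flip_less mem_Collect_eq)
next
  case (step m k)
  then show ?case using assms(1) unfolding two_sat_def by (metis (no_types, lifting) case_prodD flip_less mem_Collect_eq)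
qed

text \<open>For the converse, take a maximal set of literals that is closed under implication and
  contains no complementary pair. If it left a variable undecided, one of the two literals,
  \<open>a\<close>, would not imply its complement, and \<open>a\<close> could be added with all its
  consequences.\<close>

lemma two_sat_iff:
  assumes sym: "\<And>l m. K l m \<Longrightarrow> K m l"
  shows "(\<exists>S. two_sat n K S) \<longleftrightarrow>
    (\<forall>l<2 * n. \<not> (closure_below (2 * n) (\<lambda>l m. K l (flip m)) l (flip l) \<and>
      closure_below (2 * n) (\<lambda>l m. K l (flip m)) (flip l) l))"
    (is "?L \<longleftrightarrow> ?R")
proof
  assume ?L
  then obtain S where S: "two_sat n K S" by blast
  show ?R
  proof (intro allI impI notI)
    fix l
    assume l: "l < 2 * n"
    assume c: "closure_below (2 * n) (\<lambda>l m. K l (flip m)) l (flip l) \<and>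
      closure_below (2 * n) (\<lambda>l m. K l (flip m)) (flip l) l"
    have "l \<in> S \<longleftrightarrow> flip l \<notin> S" using S l unfolding two_sat_def by blast
    then show False using two_sat_closed[OF S] c by blast
  qed
next
  assume R: ?R
  let ?C = "closure_below (2 * n) (\<lambda>l m. K l (flip m))"
  define \<S> where "\<S> = {S. S \<subseteq> {..<2 * n} \<and> (\<forall>l m. l \<in> S \<longrightarrow> ?C l m \<longrightarrow> m \<in> S) \<and> (\<forall>l\<in>S. flip l \<notin> S)}"
  have "finite \<S>" by (rule finite_subset[of _ "Pow {..<2 * n}"]) (auto simp: \<S>_def)
  moreover have "{} \<in> \<S>" by (simp add: \<S>_def)
  ultimately obtain S where S: "S \<in> \<S>" and max: "\<And>T. T \<in> \<S> \<Longrightarrow> S \<subseteq> T \<Longrightarrow> S = T"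
    using finite_has_maximal[of \<S>] by (metis empty_iff)
  have closed: "m \<in> S" if "l \<in> S" "?C l m" for l m using S that by (auto simp: \<S>_def)
  have cons: "flip l \<notin> S" if "l \<in> S" for l using S that by (auto simp: \<S>_def)
  have trans: "?C l k" if "?C l m" "?C m k" for l m k
    using that unfolding closure_below_def by (rule trancl_trans)
  have bound: "m < 2 * n" if "?C l m" for l m
    using that unfolding closure_below_def by (induction rule: trancl_induct) auto
  have skew: "?C (flip m) (flip l)" if "?C l m" for l m
    using closure_below_flip[of K n l m] sym that by blast
  have total: "l \<in> S \<or> flip l \<in> S" if l: "l < 2 * n" for l
  proof (rule ccontr)
    assume "\<not> ?thesis"
    then have un: "l \<notin> S" "flip l \<notin> S" by auto
    obtain a where a: "a < 2 * n" "\<not> ?C a (flip a)" "a \<notin> S" "flip a \<notin> S"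
      using R l un that by (metis flip_flip flip_less)
    let ?T = "S \<union> insert a {m. ?C a m}"
    \<comment> \<open>If \<open>a\<close> implied both \<open>m\<close> and \<open>flip m\<close>,
      contraposition of the latter would lead from \<open>m\<close> to \<open>flip a\<close>, hence
      from \<open>a\<close> to \<open>flip a\<close>.\<close>
    have no: "\<not> (?C a m \<and> ?C a (flip m))" for m
      using skew[of a "flip m"] trans a(2) by (metis flip_flip)
    have 1: "flip m \<notin> S" if "?C a m" for m
      using skew[OF that] closed a(4) by blast
    have "?T \<in> \<S>"
      unfolding \<S>_def
    proof (intro CollectI conjI allI impI ballI)
      show "?T \<subseteq> {..<2 * n}" using S a(1) bound by (auto simp: \<S>_def)
      show "m \<in> ?T" if "k \<in> ?T" "?C k m" for k m using that closed trans by blast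
      fix m
      assume m: "m \<in> ?T"
      have "flip a \<noteq> a" unfolding flip_def by presburger
      show "flip m \<notin> ?T"
      proof
        assume f: "flip m \<in> ?T"
        consider "m \<in> S" | "m = a" | "?C a m" using m by blast
        then show False
        proof cases
          case 1
          then show False using f cons a(4) \<open>\<And>m. ?C a m \<Longrightarrow> flip m \<notin> S\<close> by (metis UnE flip_flip insertE mem_Collect_eq)
        next
          case 2
          then show False using f a(2,4) \<open>flip a \<noteq> a\<close> by blast
        next
          case 3
          have "flip m \<noteq> a" using 3 a(2) by (metis flip_flip)
          then show False using f 3 no 1 by blast
        qed
      qed
    qed
    then have "S = ?T" by (rule max) blast
    then show False using a(3) by blast
  qed
  have "two_sat n K S"
    unfolding two_sat_def
  proof (intro conjI allI impI)
    fix l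
    assume "l < 2 * n"
    then show "l \<in> S \<longleftrightarrow> flip l \<notin> S" using total cons by blast
  next
    fix l m
    assume lm: "l < 2 * n" "m < 2 * n" "l \<in> S" "m \<in> S"
    show "\<not> K l m"
    proof
      assume "K l m"
      then have "?C l (flip m)" using lm unfolding closure_below_def by (intro r_into_trancl) simp
      then show False using closed lm cons by blast
    qed
  qed
  then show ?L by blast
qed

section \<open>Colourings without a 4-cycle in colours 2 and 3\<close>

definition four_cycle :: "(nat \<Rightarrow> nat \<Rightarrow> bool) \<Rightarrow> nat \<Rightarrow> nat \<Rightarrow> nat \<Rightarrow> nat \<Rightarrow> bool" where
  "four_cycle A w x y z \<longleftrightarrow> A w x \<and> A x y \<and> A y z \<and> A z w \<and> w \<noteq> y \<and> x \<noteq> z"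

definition good_on :: "(nat \<Rightarrow> nat \<Rightarrow> bool) \<Rightarrow> (nat \<Rightarrow> nat \<Rightarrow> bool) \<Rightarrow> nat set \<Rightarrow> (nat \<Rightarrow> nat) \<Rightarrow> bool" where
  "good_on A L X c \<longleftrightarrow> (\<forall>u\<in>X. c u \<in> {1, 2, 3} \<and> L u (c u)) \<and>
     (\<forall>u\<in>X. \<forall>v\<in>X. A u v \<longrightarrow> c u \<noteq> c v) \<and>
     (\<forall>w\<in>X. \<forall>x\<in>X. \<forall>y\<in>X. \<forall>z\<in>X. four_cycle A w x y z \<longrightarrow> 1 \<in> c ` {w, x, y, z})"

text \<open>No edge crosses the boundary of \<open>X\<close>, so each edge and each 4-cycle lies
  inside \<open>X\<close> or inside \<open>Y - X\<close>. Since this works for arbitrary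
  \<open>Y\<close>, the induction in \<open>good_on_glue\<close> need not keep track of
  closedness.\<close>

lemma good_on_union:
  assumes A: "\<And>u v. A u v \<Longrightarrow> A v u"
    and X: "good_on A L X c" "\<And>u v. u \<in> X \<Longrightarrow> A u v \<Longrightarrow> v \<in> X"
    and Y: "good_on A L Y d"
  shows "good_on A L (X \<union> Y) (\<lambda>u. if u \<in> X then c u else d u)"
proof -
  have side: "u \<in> X \<longleftrightarrow> v \<in> X" if "A u v" for u v using X(2) A that by blast
  let ?c = "\<lambda>u. if u \<in> X then c u else d u"
  have "1 \<in> ?c ` {w, x, y, z}"
    if "w \<in> X \<union> Y" "x \<in> X \<union> Y" "y \<in> X \<union> Y" "z \<in> X \<union> Y" "four_cycle A w x y z" for w x y z
  proof -
    have s: "w \<in> X \<longleftrightarrow> x \<in> X" "x \<in> X \<longleftrightarrow> y \<in> X" "y \<in> X \<longleftrightarrow> z \<in> X"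
      using that(5) side unfolding four_cycle_def by blast+
    show ?thesis
    proof (cases "w \<in> X")
      case True
      then have "1 \<in> c ` {w, x, y, z}" using s that(5) X(1) unfolding good_on_def by blast
      then show ?thesis using True s by auto
    next
      case False
      then have "1 \<in> d ` {w, x, y, z}" using s that Y unfolding good_on_def by blast
      then show ?thesis using False s by auto
    qed
  qed
  moreover have "?c u \<noteq> ?c v" if "u \<in> X \<union> Y" "v \<in> X \<union> Y" "A u v" for u v
    using that side[OF that(3)] X(1) Y unfolding good_on_def by auto
  moreover have "?c u \<in> {1, 2, 3} \<and> L u (?c u)" if "u \<in> X \<union> Y" for u
    using that X(1) Y unfolding good_on_def by auto
  ultimately show ?thesis unfolding good_on_def by blast
qed

lemma good_on_glue:
  assumes A: "\<And>u v. A u v \<Longrightarrow> A v u"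
    and loc: "\<And>v. v < n \<Longrightarrow> \<exists>X c. v \<in> X \<and> (\<forall>u w. u \<in> X \<longrightarrow> A u w \<longrightarrow> w \<in> X) \<and> good_on A L X c"
  shows "\<exists>c. good_on A L {..<n} c"
proof -
  have "\<exists>X c. {..<k} \<subseteq> X \<and> good_on A L X c" if "k \<le> n" for k
    using that
  proof (induction k)
    case 0
    then show ?case by (auto simp: good_on_def)
  next
    case (Suc k)
    then obtain Y d where Y: "{..<k} \<subseteq> Y" "good_on A L Y d" by auto
    obtain X c where X: "k \<in> X" "\<And>u w. u \<in> X \<Longrightarrow> A u w \<Longrightarrow> w \<in> X" "good_on A L X c"
      using loc[of k] Suc.prems by auto
    have "good_on A L (X \<union> Y) (\<lambda>u. if u \<in> X then c u else d u)"
      by (rule good_on_union[OF A X(3,2) Y(2)])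
    moreover have "{..<Suc k} \<subseteq> X \<union> Y" using X(1) Y(1) by (auto simp: less_Suc_eq)
    ultimately show ?case by blast
  qed
  from this[of n] obtain X c where X: "{..<n} \<subseteq> X" "good_on A L X c" by auto
  then have "good_on A L {..<n} c" unfolding good_on_def by (meson subsetD)
  then show ?thesis by blast
qed

text \<open>
  \<open>D\<close> holds the guessed vertices with their colours. For \<open>e = 0\<close> this is all; otherwise \<open>g\<close> is
  guessed to be the only vertex of colour \<open>e\<close> without a neighbour of colour 1 in \<open>D\<close>.
\<close>

locale guess = adj_graph +
  fixes L :: "nat \<Rightarrow> nat \<Rightarrow> bool" and D :: "(nat \<times> nat) set" and g e :: nat
begin

text \<open>The colour \<open>a\<close> is excluded at \<open>u\<close> by the guess. If
  \<open>D\<close> assigns two colours to one vertex, every colour is excluded there, so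
  inconsistent guesses fail by themselves.\<close>

definition touched :: "nat \<Rightarrow> nat \<Rightarrow> bool" where
  "touched u a \<longleftrightarrow> (\<exists>(d, k)\<in>D. A u d \<and> k = a \<or> u = d \<and> k \<noteq> a)"

definition near :: "nat \<Rightarrow> bool" where
  "near u \<longleftrightarrow> (\<exists>(d, k)\<in>D. u = d \<or> A u d)"

definition not_one :: "nat \<Rightarrow> bool" where
  "not_one u \<longleftrightarrow> touched u 1 \<or> u = g \<and> e \<noteq> 0"

text \<open>The last disjunct enforces the guess of \<open>e\<close>: colour \<open>e\<close> occurs
  only at vertices known not to have colour 1. As colours are positive, it excludes none of them for
  \<open>e = 0\<close>.\<close>

definition bad :: "nat \<Rightarrow> nat \<Rightarrow> bool" where
  "bad u a \<longleftrightarrow> \<not> L u a \<or> touched u a \<or> a = 1 \<and> not_one u \<or> a = e \<and> \<not> not_one u"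

text \<open>The last disjunct is the shortened 4-cycle condition: when the remaining vertices are
  known not to have colour 1, one of \<open>u\<close> and \<open>v\<close> must have it.\<close>

definition clash :: "nat \<Rightarrow> nat \<Rightarrow> nat \<Rightarrow> nat \<Rightarrow> bool" where
  "clash u a v b \<longleftrightarrow> near u \<and> near v \<and> (bad u a \<or> bad v b \<or> A u v \<and> a = b \<or>
     a \<noteq> 1 \<and> b \<noteq> 1 \<and> (\<exists>w x y z. four_cycle A w x y z \<and>
       (\<forall>t\<in>{w, x, y, z}. t = u \<or> t = v \<or> not_one t)))"

text \<open>For \<open>e = 0\<close> the guess \<open>D\<close> alone has to turn the 4-cycle
  condition into 2-clauses. This relies on 4-cycles that contain an edge of \<open>D\<close> between
  colours 2 and 3.\<close>

definition admissible :: bool where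
  "admissible \<longleftrightarrow> e = 2 \<or> e = 3 \<or> e = 0 \<and> (\<forall>(d, k)\<in>D. \<forall>(d', k')\<in>D. k = 2 \<longrightarrow> k' = 3 \<longrightarrow> A d d')"

text \<open>The bit \<open>s\<close> selects one of two remaining colours: from {2, 3} if colour 1
  is touched, else from {1, 3} if colour 2 is, else from {1, 2}. A \<open>near\<close> vertex has
  some touched colour, which in the last case is 3.\<close>

definition colour :: "nat \<Rightarrow> nat \<Rightarrow> nat" where
  "colour u s = (if s = 0 then (if touched u 1 then 2 else 1)
     else (if touched u 1 \<or> touched u 2 then 3 else 2))"

definition closed :: bool where
  "closed \<longleftrightarrow> (\<forall>u v. near u \<longrightarrow> A u v \<longrightarrow> near v)"

definition literal_clash :: "nat \<Rightarrow> nat \<Rightarrow> bool" where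
  "literal_clash l m \<longleftrightarrow> clash (l div 2) (colour (l div 2) (l mod 2)) (m div 2) (colour (m div 2) (m mod 2))"

lemma touched_neighbour: "(d, k) \<in> D \<Longrightarrow> A u d \<Longrightarrow> touched u k"
  unfolding touched_def by blast

lemma touched_self: "(d, k) \<in> D \<Longrightarrow> k \<noteq> a \<Longrightarrow> touched d a"
  unfolding touched_def by blast

lemma clash_sym: "clash u a v b \<Longrightarrow> clash v b u a"
  unfolding clash_def using A_sym by blast

lemma near_less: "(\<And>d k. (d, k) \<in> D \<Longrightarrow> d < n) \<Longrightarrow> near u \<Longrightarrow> u < n"
  unfolding near_def using A_bound by blast

text \<open>
  In a 2/3-coloured 4-cycle, unless two opposite vertices cannot have colour 1 and the other two
  clash, some two adjacent ones have neighbours \<open>d\<close>, \<open>d'\<close> in \<open>D\<close> of colours 2 and 3, and then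
  clash because of the 4-cycle through \<open>d\<close> and \<open>d'\<close>.
\<close>

lemma two_sat_imp_good_on:
  assumes adm: admissible and cl: closed and D: "\<And>d k. (d, k) \<in> D \<Longrightarrow> d < n \<and> k \<in> {1, 2, 3}"
    and h: "\<And>u v. u < n \<Longrightarrow> v < n \<Longrightarrow> \<not> clash u (colour u (h u)) v (colour v (h v))"
  shows "good_on A L {u. near u} (\<lambda>u. colour u (h u))"
proof -
  let ?c = "\<lambda>u. colour u (h u)"
  have lt: "u < n" if "near u" for u using near_less D that by blast
  have no: "\<not> clash u (?c u) v (?c v)" if "near u" "near v" for u v using h lt that by blast
  have ok: "\<not> bad u (?c u)" if "near u" for u using no[OF that that] that unfolding clash_def by blast
  have proper: "?c u \<noteq> ?c v" if "near u" "near v" "A u v" for u v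
    using no[OF that(1,2)] that unfolding clash_def by blast
  have range: "?c u \<in> {1, 2, 3}" for u by (simp add: colour_def)
  have pairs: False if "near u" "near v" "?c u \<noteq> 1" "?c v \<noteq> 1" "four_cycle A w x y z"
    "\<forall>t\<in>{w, x, y, z}. t = u \<or> t = v \<or> not_one t" for u v w x y z
    using no[OF that(1,2)] that unfolding clash_def by blast
  \<comment> \<open>\<open>5 - a\<close> exchanges the colours 2 and 3. The vertex of
    \<open>D\<close> responsible for \<open>near u\<close> has neither colour 1 nor the colour of
    \<open>u\<close>.\<close>
  have key: "\<exists>d. (d, 5 - ?c u) \<in> D \<and> A u d" if u: "near u" "\<not> not_one u" "?c u \<noteq> 1" for u
  proof -
    obtain d k where d: "(d, k) \<in> D" "u = d \<or> A u d" using u(1) unfolding near_def by blast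
    have "\<not> touched u 1" "\<not> touched u (?c u)" using u ok[OF u(1)] unfolding not_one_def bad_def by blast+
    then have ud: "u \<noteq> d" using touched_self[OF d(1)] u(3) by metis
    then have "k \<noteq> 1" "k \<noteq> ?c u"
      using touched_neighbour[OF d(1)] d(2) \<open>\<not> touched u 1\<close> \<open>\<not> touched u (?c u)\<close> by metis+
    moreover have "k \<in> {1, 2, 3}" using D d(1) by blast
    ultimately have "k = 5 - ?c u" using range[of u] u(3) by (elim insertE) simp_all
    then show ?thesis using d ud by blast
  qed
  have adj: False if uv: "near u" "near v" "A u v" "\<not> not_one u" "\<not> not_one v" "?c u = 3" "?c v = 2" for u v
  proof -
    \<comment> \<open>Otherwise the one of \<open>u\<close> and \<open>v\<close> with colour
      \<open>e\<close> would be \<open>bad\<close>, being not known to avoid colour 1.\<close>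
    have "e \<noteq> 3" "e \<noteq> 2" using ok[OF uv(1)] ok[OF uv(2)] uv(4-7) unfolding bad_def by metis+
    then have e0: "e = 0" using adm unfolding admissible_def by blast
    obtain d where d: "(d, 2) \<in> D" "A u d" using key[OF uv(1,4)] uv(6) by auto
    obtain d' where d': "(d', 3) \<in> D" "A v d'" using key[OF uv(2,5)] uv(7) by auto
    have dd: "A d d'" using adm e0 d(1) d'(1) unfolding admissible_def by fastforce
    have nd: "not_one d" "not_one d'"
      using touched_self[OF d(1), of 1] touched_self[OF d'(1), of 1] unfolding not_one_def by simp_all
    then have "u \<noteq> d'" "v \<noteq> d" using uv(4,5) by metis+
    then have "four_cycle A u v d' d" using uv d d' dd A_sym unfolding four_cycle_def by blast
    moreover have "?c u \<noteq> 1" "?c v \<noteq> 1" using uv(6,7) by simp_all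
    moreover have "\<forall>t\<in>{u, v, d', d}. t = u \<or> t = v \<or> not_one t" using nd by simp
    ultimately show False using pairs[OF uv(1,2)] by blast
  qed
  have "1 \<in> ?c ` {w, x, y, z}"
    if nr: "near w" "near x" "near y" "near z" and cyc: "four_cycle A w x y z" for w x y z
  proof (rule ccontr)
    assume "1 \<notin> ?c ` {w, x, y, z}"
    then have n1: "?c w \<noteq> 1" "?c x \<noteq> 1" "?c y \<noteq> 1" "?c z \<noteq> 1" by auto
    have E: "A w x" "A x y" "A y z" "A z w" using cyc unfolding four_cycle_def by blast+
    have ne: "?c w \<noteq> ?c x" "?c x \<noteq> ?c y" "?c y \<noteq> ?c z" "?c z \<noteq> ?c w"
      using proper nr E by blast+
    have eq: "?c y = ?c w" "?c z = ?c x" "?c w \<in> {2, 3}" "?c x = 5 - ?c w"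
    proof -
      have "?c w = 2 \<or> ?c w = 3" "?c x = 2 \<or> ?c x = 3" "?c y = 2 \<or> ?c y = 3" "?c z = 2 \<or> ?c z = 3"
        using range[of w] range[of x] range[of y] range[of z] n1 by blast+
      then show "?c y = ?c w" "?c z = ?c x" "?c w \<in> {2, 3}" "?c x = 5 - ?c w" using ne by auto
    qed
    have "\<not> (not_one w \<and> not_one y)" using pairs[OF nr(2,4) n1(2,4) cyc] by blast
    moreover have "\<not> (not_one x \<and> not_one z)" using pairs[OF nr(1,3) n1(1,3) cyc] by blast
    ultimately obtain a b where ab: "a \<in> {w, y}" "b \<in> {x, z}" "\<not> not_one a" "\<not> not_one b" by blast
    have "near a" "near b" "A a b" "A b a" using ab(1,2) E nr A_sym by blast+
    moreover have "?c a = ?c w" "?c b = ?c x" using ab(1,2) eq by blast+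
    then have "?c a = 3 \<and> ?c b = 2 \<or> ?c b = 3 \<and> ?c a = 2" using eq(3,4) by auto
    ultimately show False using adj[of a b] adj[of b a] ab by blast
  qed
  moreover have "?c u \<in> {1, 2, 3} \<and> L u (?c u)" if "near u" for u
    using range ok[OF that] unfolding bad_def by blast
  ultimately show ?thesis using proper unfolding good_on_def by blast
qed

text \<open>If the guess agrees with \<open>c\<close>, every \<open>not_one\<close> vertex really
  has a colour other than 1. A clash of colours of \<open>c\<close> by a 4-cycle would therefore
  make all four vertices avoid colour 1.\<close>

lemma good_on_imp_two_sat:
  assumes c: "good_on A L {..<n} c" and D: "\<And>d k. (d, k) \<in> D \<Longrightarrow> d < n \<and> k = c d"
    and g: "e \<noteq> 0 \<Longrightarrow> c g \<noteq> 1" and e: "e \<noteq> 0 \<Longrightarrow> \<forall>u. near u \<longrightarrow> c u = e \<longrightarrow> not_one u"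
  shows "\<exists>h. \<forall>u v. h u < 2 \<and> \<not> clash u (colour u (h u)) v (colour v (h v))"
proof -
  have lt: "u < n" if "near u" for u using near_less D that by blast
  have lt2: "v < n" if "A u v" for u v using A_bound[OF A_sym[OF that]] .
  have proper: "c u \<noteq> c v" if "A u v" for u v
    using c that A_bound[OF that] lt2[OF that] unfolding good_on_def by blast
  have range: "c u \<in> {1, 2, 3}" if "u < n" for u using c that unfolding good_on_def by blast
  have unt: "\<not> touched u (c u)" for u
    using D proper unfolding touched_def by fastforce
  have n1: "c u \<noteq> 1" if "not_one u" for u using that unt[of u] g unfolding not_one_def by metis
  have ok: "\<not> bad u (c u)" if u: "near u" for u
  proof -
    have "L u (c u)" using c lt[OF u] unfolding good_on_def by blast
    moreover have "c u \<noteq> 0" using range[OF lt[OF u]] by auto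
    ultimately show ?thesis using unt n1 e u unfolding bad_def by metis
  qed
  have ncl: "\<not> clash u (c u) v (c v)" for u v
  proof
    assume cl: "clash u (c u) v (c v)"
    then have "near u" "near v" unfolding clash_def by blast+
    then obtain w x y z where w: "c u \<noteq> 1" "c v \<noteq> 1" "four_cycle A w x y z"
      "\<forall>t\<in>{w, x, y, z}. t = u \<or> t = v \<or> not_one t"
      using cl ok proper unfolding clash_def by blast
    then have "\<forall>t\<in>{w, x, y, z}. c t \<noteq> 1" using n1 by metis
    moreover have "w < n" "x < n" "y < n" "z < n" using w(3) A_bound unfolding four_cycle_def by blast+
    then have "1 \<in> c ` {w, x, y, z}" using c w(3) unfolding good_on_def by blast
    ultimately show False by force
  qed
  \<comment> \<open>Clashes involve only \<open>near\<close> vertices, and there the bit can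
    reproduce \<open>c\<close>.\<close>
  define h where "h u = (if colour u 0 = c u then 0 else 1 :: nat)" for u
  have hc: "colour u (h u) = c u" if u: "near u" for u
  proof -
    obtain d k where d: "(d, k) \<in> D" "u = d \<or> A u d" using u unfolding near_def by blast
    have "touched u 1 \<or> touched u 2 \<or> touched u 3"
    proof (cases "u = d")
      case True
      have "touched u a" if "a \<noteq> k" for a using d(1) True that unfolding touched_def by force
      from this[of 1] this[of 2] show ?thesis by (cases "k = 1") auto
    next
      case False
      then have "touched u k" using d unfolding touched_def by force
      moreover have "k \<in> {1, 2, 3}" using D[OF d(1)] range by blast
      ultimately show ?thesis by auto
    qed
    then show ?thesis using range[OF lt[OF u]] unt[of u] unfolding h_def colour_def by auto
  qed
  have "\<not> clash u (colour u (h u)) v (colour v (h v))" for u v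
    using ncl[of u v] hc unfolding clash_def by auto
  moreover have "h u < 2" for u by (simp add: h_def)
  ultimately show ?thesis by blast
qed

lemma literal_two_sat:
  "(\<exists>S. two_sat n literal_clash S) \<longleftrightarrow>
   (\<exists>h. (\<forall>u<n. h u < 2) \<and> (\<forall>u<n. \<forall>v<n. \<not> clash u (colour u (h u)) v (colour v (h v))))"
proof
  assume "\<exists>S. two_sat n literal_clash S"
  then obtain S where S: "two_sat n literal_clash S" by blast
  define h where "h u = (if 2 * u \<in> S then 0 else 1 :: nat)" for u
  have in_S: "2 * u + h u \<in> S" if "u < n" for u
  proof -
    have "2 * u < 2 * n" using that by simp
    then have "2 * u \<in> S \<longleftrightarrow> flip (2 * u) \<notin> S" using S unfolding two_sat_def by blast
    moreover have "flip (2 * u) = 2 * u + 1" by (simp add: flip_def)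
    ultimately show ?thesis by (simp add: h_def)
  qed
  have "\<not> clash u (colour u (h u)) v (colour v (h v))" if uv: "u < n" "v < n" for u v
  proof -
    have h2: "h w < 2" for w by (simp add: h_def)
    have "2 * u + h u < 2 * n" "2 * v + h v < 2 * n" using uv h2[of u] h2[of v] by linarith+
    then have "\<not> literal_clash (2 * u + h u) (2 * v + h v)"
      using S in_S uv unfolding two_sat_def by blast
    then show ?thesis using h2[of u] h2[of v] unfolding literal_clash_def by simp
  qed
  then show "\<exists>h. (\<forall>u<n. h u < 2) \<and> (\<forall>u<n. \<forall>v<n. \<not> clash u (colour u (h u)) v (colour v (h v)))"
    by (intro exI[of _ h]) (simp add: h_def)
next
  assume "\<exists>h. (\<forall>u<n. h u < 2) \<and> (\<forall>u<n. \<forall>v<n. \<not> clash u (colour u (h u)) v (colour v (h v)))"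
  then obtain h where h: "\<forall>u<n. h u < (2::nat)" "\<forall>u<n. \<forall>v<n. \<not> clash u (colour u (h u)) v (colour v (h v))"
    by blast
  define S where "S = {l. l mod 2 = h (l div 2)}"
  have "l \<in> S \<longleftrightarrow> flip l \<notin> S" if "l < 2 * n" for l
  proof -
    note flip_div flip_mod
    moreover have "l div 2 < n" using that by linarith
    then have "h (l div 2) < 2" using h(1) by blast
    moreover have "x = y \<longleftrightarrow> 1 - x \<noteq> y" if "x < 2" "y < 2" for x y :: nat
      using that by (auto simp: less_2_cases_iff)
    moreover have "l mod 2 < 2" by simp
    ultimately show ?thesis unfolding S_def mem_Collect_eq by metis
  qed
  moreover have "\<not> literal_clash l m" if "l < 2 * n" "m < 2 * n" "l \<in> S" "m \<in> S" for l m
  proof -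
    have "l div 2 < n" "m div 2 < n" using that(1,2) by linarith+
    moreover have "l mod 2 = h (l div 2)" "m mod 2 = h (m div 2)" using that(3,4) unfolding S_def by blast+
    ultimately show ?thesis using h(2) unfolding literal_clash_def by metis
  qed
  ultimately have "two_sat n literal_clash S" unfolding two_sat_def by blast
  then show "\<exists>S. two_sat n literal_clash S" by blast
qed

lemma literal_clash_sym: "literal_clash l m \<Longrightarrow> literal_clash m l"
  unfolding literal_clash_def by (rule clash_sym)

end

section \<open>Every colouring is found by some guess\<close>

context adj_graph
begin

definition guessed :: "nat \<Rightarrow> nat \<Rightarrow> nat \<Rightarrow> nat \<Rightarrow> nat \<Rightarrow> nat \<Rightarrow> (nat \<times> nat) set" where
  "guessed p q r a b c = {(p, a), (q, b), (r, c)}"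

lemma near_guessed: "guess.near A (guessed p q r a b c) u \<longleftrightarrow> dom p q r u"
proof -
  interpret guess n A "\<lambda>_ _. True" "guessed p q r a b c" 0 0 by unfold_locales
  show ?thesis unfolding near_def unfolding guessed_def dom_def by auto
qed

lemma good_on_no_K4:
  assumes "good_on A L {..<n} c"
  shows no_K4
  unfolding no_K4_def
proof (intro allI impI)
  fix w x y z
  assume A: "A w x" "A w y" "A w z" "A x y" "A x z" "A y z"
  then have "w < n" "x < n" "y < n" "z < n" using A_bound A_sym by blast+
  then have "c w \<noteq> c x" "c w \<noteq> c y" "c w \<noteq> c z" "c x \<noteq> c y" "c x \<noteq> c z" "c y \<noteq> c z"
    "c w \<in> {1, 2, 3}" "c x \<in> {1, 2, 3}" "c y \<in> {1, 2, 3}" "c z \<in> {1, 2, 3}"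
    using A assms unfolding good_on_def by blast+
  then show False by auto
qed

text \<open>
  If \<open>D\<close> is a path whose ends \<open>a\<close>, \<open>b\<close> have colours 2 and 3, then the vertices of colour 2 and of
  colour 3 that have no neighbour of colour 1 in \<open>D\<close> are completely joined, or \<open>P\<^sub>5\<close> appears. As
  2/3-coloured 4-cycles do not exist, there is at most one vertex of one of the two kinds.
\<close>

lemma special_vertex:
  assumes c: "good_on A L {..<n} c" and ab: "A a q" "A q b" "\<not> A a b" "c a = 2" "c q = 1" "c b = 3"
    and D: "D = {(a, 2), (q, 1), (b, 3)}"
  shows "\<exists>g<n. \<exists>e\<in>{2, 3}. c g \<noteq> 1 \<and> (\<forall>u. guess.near A D u \<longrightarrow> c u = e \<longrightarrow> guess.not_one A D g e u)"
proof -
  interpret guess n A L D g e for g e by unfold_locales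
  have lt: "a < n" "b < n" using ab A_bound A_sym by blast+
  have proper: "c u \<noteq> c v" if "A u v" for u v
    using c that A_bound A_sym unfolding good_on_def by blast
  define X where "X = {u. near u \<and> c u = 2 \<and> \<not> touched u 1}"
  define Y where "Y = {u. near u \<and> c u = 3 \<and> \<not> touched u 1}"
  have X: "A x b" "\<not> A x q" "\<not> A x a" if "x \<in> X" for x
  proof -
    have x: "near x" "c x = 2" "\<not> touched x 1" using that unfolding X_def by blast+
    have "(a, 2) \<in> D" "(q, 1) \<in> D" using D by blast+
    then have "x \<noteq> a" "\<not> A x q" using x(3) touched_self[of a 2 1] touched_neighbour[of q 1 x] by auto
    moreover have "x \<noteq> q" "x \<noteq> b" using x(2) ab by auto
    moreover have "\<not> A x a" using proper[of x a] x(2) ab by auto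
    moreover have "x = a \<or> A x a \<or> x = q \<or> A x q \<or> x = b \<or> A x b"
      using x(1) unfolding near_def unfolding D by blast
    ultimately show "A x b" "\<not> A x q" "\<not> A x a" by blast+
  qed
  have Y: "A y a" "\<not> A y q" "\<not> A y b" if "y \<in> Y" for y
  proof -
    have y: "near y" "c y = 3" "\<not> touched y 1" using that unfolding Y_def by blast+
    have "(b, 3) \<in> D" "(q, 1) \<in> D" using D by blast+
    then have "y \<noteq> b" "\<not> A y q" using y(3) touched_self[of b 3 1] touched_neighbour[of q 1 y] by auto
    moreover have "y \<noteq> q" "y \<noteq> a" using y(2) ab by auto
    moreover have "\<not> A y b" using proper[of y b] y(2) ab by auto
    moreover have "y = a \<or> A y a \<or> y = q \<or> A y q \<or> y = b \<or> A y b"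
      using y(1) unfolding near_def unfolding D by blast
    ultimately show "A y a" "\<not> A y q" "\<not> A y b" by blast+
  qed
  have join: "A x y" if "x \<in> X" "y \<in> Y" for x y
    using no_P5[of y a q b x] X[OF that(1)] Y[OF that(2)] ab A_commute by metis
  have "(\<exists>x. X \<subseteq> {x}) \<or> (\<exists>y. Y \<subseteq> {y})"
  proof (rule ccontr)
    assume *: "\<not> ?thesis"
    then obtain x y where xy: "x \<in> X" "y \<in> Y" by blast
    from * obtain x' y' where xy': "x' \<in> X" "x' \<noteq> x" "y' \<in> Y" "y' \<noteq> y" by blast
    have "four_cycle A x y x' y'"
      using join xy xy' A_sym unfolding four_cycle_def by metis
    moreover have "x < n" "y < n" "x' < n" "y' < n" using X Y xy xy' A_bound by blast+
    ultimately have "1 \<in> c ` {x, y, x', y'}" using c unfolding good_on_def by blast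
    then show False using xy xy' by (auto simp: X_def Y_def)
  qed
  then consider (X) x where "X \<subseteq> {x}" | (Y) y where "Y \<subseteq> {y}" by blast
  then show ?thesis
  proof cases
    case X': X
    \<comment> \<open>\<open>g\<close> must have a colour other than 1 even if \<open>X\<close> is
      empty; then the vertex \<open>a\<close> of colour 2 serves.\<close>
    define g where "g = (if X = {} then a else x)"
    have "g = a \<or> g \<in> X" using X' unfolding g_def by auto
    then have g: "g < n" "c g \<noteq> 1" using lt ab(4) X(1) A_bound unfolding X_def by auto
    have "\<And>u. u \<in> X \<Longrightarrow> u = g" using X' unfolding g_def by auto
    then have "\<forall>u. near u \<longrightarrow> c u = 2 \<longrightarrow> not_one g 2 u" unfolding not_one_def X_def by auto
    then show ?thesis using g by blast
  next
    case Y': Y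
    define g where "g = (if Y = {} then b else y)"
    have "g = b \<or> g \<in> Y" using Y' unfolding g_def by auto
    then have g: "g < n" "c g \<noteq> 1" using lt ab(6) Y(1) A_bound unfolding Y_def by auto
    have "\<And>u. u \<in> Y \<Longrightarrow> u = g" using Y' unfolding g_def by auto
    then have "\<forall>u. near u \<longrightarrow> c u = 3 \<longrightarrow> not_one g 3 u" unfolding not_one_def Y_def by auto
    then show ?thesis using g by blast
  qed
qed

text \<open>The dominating triple is coloured as in \<open>c\<close>. If \<open>e = 0\<close> is not
  admissible, \<open>D\<close> contains non-adjacent vertices of colours 2 and 3. So
  \<open>D\<close> is no clique but a path with these as its ends, and its middle vertex, adjacent
  to both, has colour 1. This is the situation of \<open>special_vertex\<close>.\<close>

lemma guess_exists:
  assumes c: "good_on A L {..<n} c" and v: "v < n"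
  shows "\<exists>p<n. \<exists>q<n. \<exists>r<n. \<exists>g<n. \<exists>e<4. let D = guessed p q r (c p) (c q) (c r) in
    guess.near A D v \<and> guess.closed A D \<and> guess.admissible A D e \<and>
    (e \<noteq> 0 \<longrightarrow> c g \<noteq> 1 \<and> (\<forall>u. guess.near A D u \<longrightarrow> c u = e \<longrightarrow> guess.not_one A D g e u))"
proof -
  obtain p q r where D: "p < n" "q < n" "r < n" "structured p q r" "dom p q r v"
    "\<And>u w. dom p q r u \<Longrightarrow> A u w \<Longrightarrow> dom p q r w"
    using dominating_triple[OF good_on_no_K4[OF c] v] by blast
  let ?D = "guessed p q r (c p) (c q) (c r)"
  interpret guess n A L ?D g e for g e by unfold_locales
  have near: "near u \<longleftrightarrow> dom p q r u" for u by (rule near_guessed)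
  have cl: closed unfolding closed_def near using D(6) by blast
  have proper: "c u \<noteq> c v" if "A u v" for u v
    using c that A_bound A_sym unfolding good_on_def by blast
  have "\<exists>g<n. \<exists>e<4. admissible e \<and>
    (e \<noteq> 0 \<longrightarrow> c g \<noteq> 1 \<and> (\<forall>u. near u \<longrightarrow> c u = e \<longrightarrow> not_one g e u))"
  proof (cases "admissible 0")
    case True
    moreover have "0 < (4::nat)" by simp
    ultimately show ?thesis using v by blast
  next
    case False
    then obtain a b where ab: "(a, 2) \<in> ?D" "(b, 3) \<in> ?D" "\<not> A a b" unfolding admissible_def by blast
    then have ab': "a \<in> {p, q, r}" "b \<in> {p, q, r}" "c a = 2" "c b = 3"
      unfolding guessed_def by auto
    then have "a \<noteq> b" by auto
    then have path: "A p q" "A q r" "p \<noteq> r"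
      using D(4) ab' ab(3) A_sym unfolding structured_def by blast+
    then have "a = p \<and> b = r \<or> a = r \<and> b = p" using ab' ab(3) \<open>a \<noteq> b\<close> A_sym by blast
    then have aq: "A a q" "A q b" using path A_sym by blast+
    have "c q \<noteq> 2" "c q \<noteq> 3" using proper[OF aq(1)] proper[OF aq(2)] ab' by auto
    moreover have "c q \<in> {1, 2, 3}" using c D(2) unfolding good_on_def by blast
    ultimately have "c q = 1" by blast
    then have "?D = {(a, 2), (q, 1), (b, 3)}"
      using ab'(3,4) \<open>a = p \<and> b = r \<or> a = r \<and> b = p\<close> unfolding guessed_def by auto
    then obtain g e where g: "g < n" "e \<in> {2, 3}" "c g \<noteq> 1"
      "\<forall>u. near u \<longrightarrow> c u = e \<longrightarrow> not_one g e u"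
      using special_vertex[OF c aq ab(3) ab'(3) \<open>c q = 1\<close> ab'(4)] by blast
    then have "admissible e" "e < 4" unfolding admissible_def by auto
    then show ?thesis using g by blast
  qed
  then show ?thesis using D(1-3,5) cl near unfolding Let_def by blast
qed

definition guess_works :: "(nat \<Rightarrow> nat \<Rightarrow> bool) \<Rightarrow> (nat \<times> nat) set \<Rightarrow> nat \<Rightarrow> nat \<Rightarrow> nat \<Rightarrow> bool" where
  "guess_works L D g e v \<longleftrightarrow> guess.near A D v \<and> guess.closed A D \<and> guess.admissible A D e \<and>
    (\<forall>l<2 * n. \<not> (closure_below (2 * n) (\<lambda>l m. guess.literal_clash A L D g e l (flip m)) l (flip l) \<and>
      closure_below (2 * n) (\<lambda>l m. guess.literal_clash A L D g e l (flip m)) (flip l) l))"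

text \<open>The right-hand side has the quantifier structure of \<open>algorithm\<close>. Colours
  range below 4 with 0 excluded separately, and \<open>e = 1\<close> is ruled out by
  \<open>admissible\<close>. The outer quantifier over \<open>v\<close> corresponds to the
  gluing.\<close>

lemma good_on_iff:
  "(\<exists>c. good_on A L {..<n} c) \<longleftrightarrow>
   (\<forall>v<n. \<exists>p<n. \<exists>q<n. \<exists>r<n. \<exists>a<4. \<exists>b<4. \<exists>c<4. \<exists>g<n. \<exists>e<4.
     a \<noteq> 0 \<and> b \<noteq> 0 \<and> c \<noteq> 0 \<and> guess_works L (guessed p q r a b c) g e v)"
proof
  assume "\<exists>c. good_on A L {..<n} c"
  then obtain c where c: "good_on A L {..<n} c" by blast
  have "\<exists>p<n. \<exists>q<n. \<exists>r<n. \<exists>g<n. \<exists>e<4. guess_works L (guessed p q r (c p) (c q) (c r)) g e v"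
    if v: "v < n" for v
  proof -
    obtain p q r g e where D: "p < n" "q < n" "r < n" "g < n" "e < 4"
      "guess.near A (guessed p q r (c p) (c q) (c r)) v" "guess.closed A (guessed p q r (c p) (c q) (c r))"
      "guess.admissible A (guessed p q r (c p) (c q) (c r)) e"
      "e \<noteq> 0 \<Longrightarrow> c g \<noteq> 1" "e \<noteq> 0 \<Longrightarrow> \<forall>u. guess.near A (guessed p q r (c p) (c q) (c r)) u \<longrightarrow> c u = e \<longrightarrow>
        guess.not_one A (guessed p q r (c p) (c q) (c r)) g e u"
      using guess_exists[OF c v] unfolding Let_def by blast
    interpret guess n A L "guessed p q r (c p) (c q) (c r)" g e by unfold_locales
    have "d < n \<and> k = c d" if "(d, k) \<in> guessed p q r (c p) (c q) (c r)" for d k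
      using that D(1-3) unfolding guessed_def by auto
    then have "\<exists>h. \<forall>u v. h u < 2 \<and> \<not> clash u (colour u (h u)) v (colour v (h v))"
      using good_on_imp_two_sat[OF c _ D(9,10)] by blast
    then have "\<exists>S. two_sat n literal_clash S" unfolding literal_two_sat by blast
    then show ?thesis using D(1-8) two_sat_iff[of literal_clash n, OF literal_clash_sym]
      unfolding guess_works_def by blast
  qed
  note works = this
  have c4: "c u < 4" "c u \<noteq> 0" if "u < n" for u
    using c that unfolding good_on_def by force+
  show "\<forall>v<n. \<exists>p<n. \<exists>q<n. \<exists>r<n. \<exists>a<4. \<exists>b<4. \<exists>c<4. \<exists>g<n. \<exists>e<4.
     a \<noteq> 0 \<and> b \<noteq> 0 \<and> c \<noteq> 0 \<and> guess_works L (guessed p q r a b c) g e v"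
  proof (intro allI impI)
    fix v
    assume "v < n"
    from works[OF this] obtain p q r g e where "p < n" "q < n" "r < n" "g < n" "e < 4"
      "guess_works L (guessed p q r (c p) (c q) (c r)) g e v" by blast
    moreover note c4[OF this(1)] c4[OF this(2)] c4[OF this(3)]
    ultimately show "\<exists>p<n. \<exists>q<n. \<exists>r<n. \<exists>a<4. \<exists>b<4. \<exists>c<4. \<exists>g<n. \<exists>e<4.
      a \<noteq> 0 \<and> b \<noteq> 0 \<and> c \<noteq> 0 \<and> guess_works L (guessed p q r a b c) g e v"
      by blast
  qed
next
  assume *: "\<forall>v<n. \<exists>p<n. \<exists>q<n. \<exists>r<n. \<exists>a<4. \<exists>b<4. \<exists>c<4. \<exists>g<n. \<exists>e<4.
     a \<noteq> 0 \<and> b \<noteq> 0 \<and> c \<noteq> 0 \<and> guess_works L (guessed p q r a b c) g e v"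
  show "\<exists>c. good_on A L {..<n} c"
  proof (rule good_on_glue[OF A_sym])
    fix v
    assume "v < n"
    then obtain p q r a b c g e where D: "p < n" "q < n" "r < n" "a < 4" "b < 4" "c < 4"
      "a \<noteq> 0" "b \<noteq> 0" "c \<noteq> 0" "guess_works L (guessed p q r a b c) g e v"
      using * by blast
    interpret guess n A L "guessed p q r a b c" g e by unfold_locales
    note w = D(10)[unfolded guess_works_def]
    have "\<exists>S. two_sat n literal_clash S" using w two_sat_iff[of literal_clash n, OF literal_clash_sym] by blast
    then obtain h where h: "\<And>u v. u < n \<Longrightarrow> v < n \<Longrightarrow> \<not> clash u (colour u (h u)) v (colour v (h v))"
      unfolding literal_two_sat by blast
    have Dk: "d < n \<and> k \<in> {1, 2, 3}" if "(d, k) \<in> guessed p q r a b c" for d k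
      using that D(1-9) unfolding guessed_def by auto
    have "good_on A L {u. near u} (\<lambda>u. colour u (h u))"
      by (rule two_sat_imp_good_on[OF _ _ Dk h]) (use w in blast)+
    then show "\<exists>X c. v \<in> X \<and> (\<forall>u w. u \<in> X \<longrightarrow> A u w \<longrightarrow> w \<in> X) \<and> good_on A L X c"
      using w unfolding closed_def by (intro exI[of _ "{u. near u}"]) blast
  qed
qed

end

subsection \<open>Graphs\<close>

definition adjacent :: "'a graph \<Rightarrow> 'a \<Rightarrow> 'a \<Rightarrow> bool" where
  "adjacent G u v \<longleftrightarrow> {u, v} \<in> edges G"

lemma path_graph_edge: "{i, j} \<in> edges (path_graph 5) \<longleftrightarrow> j = Suc i \<and> j < 5 \<or> i = Suc j \<and> i < 5"
  by (auto simp: path_graph_def doubleton_eq_iff)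

lemma P5_free_no_induced_path:
  assumes G: "simple_graph G" "P5_free G"
    and p: "adjacent G a b" "adjacent G b c" "adjacent G c d" "adjacent G d e"
    and np: "\<not> adjacent G a c" "\<not> adjacent G a d" "\<not> adjacent G a e" "\<not> adjacent G b d"
      "\<not> adjacent G b e" "\<not> adjacent G c e"
  shows False
proof -
  have sym: "adjacent G u v \<longleftrightarrow> adjacent G v u" for u v by (simp add: adjacent_def insert_commute)
  have irr: "\<not> adjacent G u u" for u using G(1) by (auto simp: adjacent_def simple_graph_def)
  have "a \<noteq> b" "b \<noteq> c" "c \<noteq> d" "d \<noteq> e" using p irr by blast+
  moreover have "a \<noteq> c" "a \<noteq> d" "a \<noteq> e" "b \<noteq> d" "b \<noteq> e" "c \<noteq> e" using p np sym by metis+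
  ultimately have dist: "distinct [a, b, c, d, e]" by simp
  let ?X = "{a, b, c, d, e}"
  define f :: "'a \<Rightarrow> nat" where
    "f x = (if x = a then 0 else if x = b then 1 else if x = c then 2 else if x = d then 3 else 4)" for x
  have f: "f a = 0" "f b = 1" "f c = 2" "f d = 3" "f e = 4" using dist by (auto simp: f_def)
  have "?X \<subseteq> verts G" using p G(1) by (auto simp: adjacent_def simple_graph_def)
  moreover have "isomorphic (induced_subgraph G ?X) (path_graph 5)"
    unfolding isomorphic_def
  proof (intro exI[of _ f] conjI ballI)
    have "f ` ?X = {..<5}" using f by (auto simp: lessThan_nat_numeral lessThan_Suc)
    moreover have "inj_on f ?X" unfolding inj_on_def using f by auto
    ultimately show "bij_betw f (verts (induced_subgraph G ?X)) (verts (path_graph 5))"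
      by (simp add: bij_betw_def induced_subgraph_def path_graph_def)
    fix u v
    assume uv: "u \<in> verts (induced_subgraph G ?X)" "v \<in> verts (induced_subgraph G ?X)"
    then have uv': "u \<in> ?X" "v \<in> ?X" by (simp_all add: induced_subgraph_def)
    then have "{u, v} \<in> edges (induced_subgraph G ?X) \<longleftrightarrow> adjacent G u v"
      by (simp add: induced_subgraph_def adjacent_def)
    also have "\<dots> \<longleftrightarrow> f v = Suc (f u) \<and> f v < 5 \<or> f u = Suc (f v) \<and> f u < 5"
      using uv' p np irr sym f by (elim insertE) auto
    finally show "{u, v} \<in> edges (induced_subgraph G ?X) \<longleftrightarrow> {f u, f v} \<in> edges (path_graph 5)"
      unfolding path_graph_edge .
  qed
  ultimately show False using G(2) unfolding P5_free_def by blast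
qed

lemma instance_adj_graph:
  assumes "(G, L) \<in> P5_free_instances"
  shows "adj_graph (card (verts G)) (adjacent G)"
proof
  have G: "simple_graph G" "P5_free G" "verts G = {..<card (verts G)}"
    using assms by (auto simp: P5_free_instances_def)
  show "adjacent G u v \<Longrightarrow> adjacent G v u" for u v by (simp add: adjacent_def insert_commute)
  show "\<not> adjacent G u u" for u using G(1) by (auto simp: adjacent_def simple_graph_def)
  show "u < card (verts G)" if "adjacent G u v" for u v
  proof -
    have "u \<in> verts G" using that G(1) by (auto simp: adjacent_def simple_graph_def)
    then show ?thesis using G(3) by blast
  qed
  show False if "adjacent G a b" "adjacent G b c" "adjacent G c d" "adjacent G d e"
    "\<not> adjacent G a c" "\<not> adjacent G a d" "\<not> adjacent G a e" "\<not> adjacent G b d"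
    "\<not> adjacent G b e" "\<not> adjacent G c e" for a b c d e
    by (rule P5_free_no_induced_path[OF G(1,2) that])
qed

text \<open>A 2/3-coloured cycle of length at least 5 starts with a path on 5 vertices, which has a chord.\<close>

lemma cycle_imp_four_cycle:
  assumes "adj_graph n (adjacent G)"
    and c: "\<And>u v. adjacent G u v \<Longrightarrow> c u \<noteq> c v"
    and X: "\<And>u. u \<in> X \<Longrightarrow> c u \<in> {2, 3 :: nat}"
    and cyc: "cycle (induced_subgraph G X) xs"
  shows "\<exists>w\<in>X. \<exists>x\<in>X. \<exists>y\<in>X. \<exists>z\<in>X. four_cycle (adjacent G) w x y z"
proof -
  interpret adj_graph n "adjacent G" by fact
  have xs: "3 \<le> length xs" "distinct xs" "set xs \<subseteq> X"
    and adj: "\<And>i. i < length xs \<Longrightarrow> adjacent G (xs ! i) (xs ! (Suc i mod length xs))"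
    using cyc by (auto simp: cycle_def induced_subgraph_def adjacent_def)
  have inX: "xs ! i \<in> X" if "i < length xs" for i using xs(3) that nth_mem by blast
  have two: "c (xs ! i) = 2 \<or> c (xs ! i) = 3" if "i < length xs" for i using X[OF inX[OF that]] by blast
  have alt: "c (xs ! (Suc i mod length xs)) = 5 - c (xs ! i)" if "i < length xs" for i
  proof -
    have "Suc i mod length xs < length xs" using xs(1) by (intro mod_less_divisor) linarith
    from two[OF this] two[OF that] c[OF adj[OF that]] show ?thesis by auto
  qed
  have S: "adjacent G (xs ! i) (xs ! j)" "c (xs ! j) = 5 - c (xs ! i)" if "j = Suc i" "j < length xs" for i j
    using adj[of i] alt[of i] that by simp_all
  have last: "adjacent G (xs ! i) (xs ! 0)" "c (xs ! 0) = 5 - c (xs ! i)" if "length xs = Suc i" for i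
    using adj[of i] alt[of i] that by simp_all
  have neq: "xs ! i \<noteq> xs ! j" if "i < j" "j < length xs" for i j
    using nth_eq_iff_index_eq[OF xs(2)] that by simp
  have four: ?thesis if "four_cycle (adjacent G) (xs ! i) (xs ! j) (xs ! k) (xs ! l)"
    "i < length xs" "j < length xs" "k < length xs" "l < length xs" for i j k l
    using that inX by blast
  consider "length xs = 3" | "length xs = 4" | "5 \<le> length xs" using xs(1) by linarith
  then show ?thesis
  proof cases
    case 1
    \<comment> \<open>Around a triangle the colours 2 and 3 would be exchanged three times and yet
      return to the initial colour.\<close>
    have "c (xs ! 1) = 5 - c (xs ! 0)" "c (xs ! 2) = 5 - c (xs ! 1)" "c (xs ! 0) = 5 - c (xs ! 2)"
      by (rule S(2) last(2); use 1 in simp)+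
    moreover have "c (xs ! 0) = 2 \<or> c (xs ! 0) = 3" by (rule two) (use 1 in simp)
    ultimately show ?thesis by auto
  next
    case 2
    have "adjacent G (xs ! 0) (xs ! 1)" "adjacent G (xs ! 1) (xs ! 2)" "adjacent G (xs ! 2) (xs ! 3)"
      by (rule S(1); use 2 in simp)+
    moreover have "adjacent G (xs ! 3) (xs ! 0)" by (rule last(1)) (use 2 in simp)
    ultimately have "four_cycle (adjacent G) (xs ! 0) (xs ! 1) (xs ! 2) (xs ! 3)"
      using neq[of 0 2] neq[of 1 3] 2 unfolding four_cycle_def by simp
    then show ?thesis by (rule four) (use 2 in simp_all)
  next
    case 3
    have E: "adjacent G (xs ! 0) (xs ! 1)" "adjacent G (xs ! 1) (xs ! 2)" "adjacent G (xs ! 2) (xs ! 3)"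
      "adjacent G (xs ! 3) (xs ! 4)"
      by (rule S(1); use 3 in simp)+
    have col: "c (xs ! 1) = 5 - c (xs ! 0)" "c (xs ! 2) = 5 - c (xs ! 1)" "c (xs ! 3) = 5 - c (xs ! 2)"
      "c (xs ! 4) = 5 - c (xs ! 3)"
      by (rule S(2); use 3 in simp)+
    have "c (xs ! 0) = 2 \<or> c (xs ! 0) = 3" by (rule two) (use 3 in linarith)
    then have "c (xs ! 0) = c (xs ! 2)" "c (xs ! 0) = c (xs ! 4)" "c (xs ! 1) = c (xs ! 3)"
      "c (xs ! 2) = c (xs ! 4)"
      using col by auto
    \<comment> \<open>Vertices at distance 2 or 4 on the path have equal colours. So the chord joins
      vertices at distance 3 and closes a 4-cycle.\<close>
    then have "\<not> adjacent G (xs ! 0) (xs ! 2)" "\<not> adjacent G (xs ! 0) (xs ! 4)"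
      "\<not> adjacent G (xs ! 1) (xs ! 3)" "\<not> adjacent G (xs ! 2) (xs ! 4)"
      using c by metis+
    then have "adjacent G (xs ! 0) (xs ! 3) \<or> adjacent G (xs ! 1) (xs ! 4)" using no_P5[OF E] by blast
    then show ?thesis
    proof
      assume "adjacent G (xs ! 0) (xs ! 3)"
      then have "four_cycle (adjacent G) (xs ! 0) (xs ! 1) (xs ! 2) (xs ! 3)"
        using E neq[of 0 2] neq[of 1 3] 3 A_sym unfolding four_cycle_def by simp
      then show ?thesis by (rule four) (use 3 in linarith)+
    next
      assume "adjacent G (xs ! 1) (xs ! 4)"
      then have "four_cycle (adjacent G) (xs ! 1) (xs ! 2) (xs ! 3) (xs ! 4)"
        using E neq[of 1 3] neq[of 2 4] 3 A_sym unfolding four_cycle_def by simp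
      then show ?thesis by (rule four) (use 3 in linarith)+
    qed
  qed
qed

lemma four_cycle_imp_cycle:
  assumes "simple_graph G" "four_cycle (adjacent G) w x y z" "{w, x, y, z} \<subseteq> X"
  shows "cycle (induced_subgraph G X) [w, x, y, z]"
proof -
  have irr: "\<not> adjacent G u u" for u using assms(1) by (auto simp: adjacent_def simple_graph_def)
  have E: "adjacent G w x" "adjacent G x y" "adjacent G y z" "adjacent G z w" "w \<noteq> y" "x \<noteq> z"
    using assms(2) unfolding four_cycle_def by blast+
  then have "distinct [w, x, y, z]" using irr by auto
  moreover have "{[w, x, y, z] ! i, [w, x, y, z] ! (Suc i mod 4)} \<in> edges (induced_subgraph G X)"
    if "i < 4" for i
  proof -
    have e: "{w, x} \<in> edges (induced_subgraph G X)" "{x, y} \<in> edges (induced_subgraph G X)"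
      "{y, z} \<in> edges (induced_subgraph G X)" "{z, w} \<in> edges (induced_subgraph G X)"
      using E assms(3) by (simp_all add: induced_subgraph_def adjacent_def)
    consider "i = 0" | "i = 1" | "i = 2" | "i = 3" using \<open>i < 4\<close> by linarith
    then show ?thesis using e by cases simp_all
  qed
  ultimately show ?thesis using assms(3) unfolding cycle_def by (simp add: induced_subgraph_def)
qed

lemma colourable_iff_good_on:
  assumes inst: "(G, L) \<in> P5_free_instances"
  shows "list_semi_acyclic_3_colourable (G, L) \<longleftrightarrow>
    (\<exists>c. good_on (adjacent G) (\<lambda>u a. a \<in> L u) {..<card (verts G)} c)"
proof -
  have G: "simple_graph G" "verts G = {..<card (verts G)}"
    using inst by (auto simp: P5_free_instances_def)
  interpret adj_graph "card (verts G)" "adjacent G" by (rule instance_adj_graph[OF inst])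
  have "semi_acyclic_3_colouring G c \<and> (\<forall>v\<in>verts G. c v \<in> L v) \<longleftrightarrow>
    good_on (adjacent G) (\<lambda>u a. a \<in> L u) (verts G) c" for c
  proof
    assume c: "semi_acyclic_3_colouring G c \<and> (\<forall>v\<in>verts G. c v \<in> L v)"
    then have col: "three_colouring G c" "forest (induced_subgraph G {v \<in> verts G. c v \<in> {2, 3}})"
      by (simp_all add: semi_acyclic_3_colouring_def)
    have "1 \<in> c ` {w, x, y, z}" if "four_cycle (adjacent G) w x y z"
      "w \<in> verts G" "x \<in> verts G" "y \<in> verts G" "z \<in> verts G" for w x y z
    proof (rule ccontr)
      assume no: "1 \<notin> c ` {w, x, y, z}"
      have "c u \<in> {2, 3}" if "u \<in> {w, x, y, z}" "u \<in> verts G" for u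
      proof -
        have "c u \<noteq> 1" using no that(1) by (metis imageI)
        moreover have "c u \<in> {1, 2, 3}" using col(1) that(2) unfolding three_colouring_def by blast
        ultimately show ?thesis by blast
      qed
      then have "{w, x, y, z} \<subseteq> {v \<in> verts G. c v \<in> {2, 3}}" using that(2-5) by blast
      then show False using four_cycle_imp_cycle[OF G(1) that(1)] col(2) unfolding forest_def by blast
    qed
    then show "good_on (adjacent G) (\<lambda>u a. a \<in> L u) (verts G) c"
      using c col(1) unfolding good_on_def three_colouring_def adjacent_def by blast
  next
    assume c: "good_on (adjacent G) (\<lambda>u a. a \<in> L u) (verts G) c"
    have V: "u \<in> verts G" if "adjacent G u v" for u v using A_bound[OF that] G(2) by blast
    have proper: "c u \<noteq> c v" if "adjacent G u v" for u v
      using c V[OF that] V[OF A_sym[OF that]] that unfolding good_on_def by blast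
    have "three_colouring G c" using c proper unfolding three_colouring_def good_on_def adjacent_def by blast
    moreover have "forest (induced_subgraph G {v \<in> verts G. c v \<in> {2, 3}})" (is "forest (induced_subgraph G ?X)")
      unfolding forest_def
    proof
      assume "\<exists>xs. cycle (induced_subgraph G ?X) xs"
      then obtain xs where "cycle (induced_subgraph G ?X) xs" by blast
      then have "\<exists>w\<in>?X. \<exists>x\<in>?X. \<exists>y\<in>?X. \<exists>z\<in>?X. four_cycle (adjacent G) w x y z"
        by (intro cycle_imp_four_cycle[where c = c and X = ?X, OF adj_graph_axioms proper]) blast+
      then obtain w x y z where cyc: "four_cycle (adjacent G) w x y z" "w \<in> ?X" "x \<in> ?X" "y \<in> ?X" "z \<in> ?X"
        by blast
      then have "1 \<in> c ` {w, x, y, z}" using c unfolding good_on_def by blast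
      then show False using cyc(2-5) by auto
    qed
    ultimately show "semi_acyclic_3_colouring G c \<and> (\<forall>v\<in>verts G. c v \<in> L v)"
      using c unfolding semi_acyclic_3_colouring_def good_on_def by blast
  qed
  then show ?thesis unfolding list_semi_acyclic_3_colourable_def G(2)[symmetric] by simp
qed

subsection \<open>The algorithm as a formula\<close>

lemma formula_solvable:
  assumes wf: "wf_fm f" and d: "depth f \<le> d"
    and enc: "\<And>x. x \<in> I \<Longrightarrow> inv_state (sz x) (enc x)"
    and Q: "\<And>x. x \<in> I \<Longrightarrow> Q x \<longleftrightarrow> sat f (enc x)"
  shows "solvable_in_time I sz enc Q (\<lambda>n. real n ^ d)"
proof -
  define k where "k = max 25 (word_exponent f)"
  obtain K where K: "\<And>n. time f n \<le> K * (n + 1) ^ depth f" using time_polynomial by blast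
  define T where "T n = (K + 10) * (n + 1) ^ d" for n :: nat
  define p where "p = Seq (compile f 0) (Assign ''out'' (Reg (temp 0)))"
  have "(\<lambda>n. real (T n)) \<in> O(\<lambda>n. real n ^ d)"
  proof (rule bigoI[where c = "real (K + 10) * 2 ^ d"])
    show "\<forall>\<^sub>F n in sequentially. norm (real (T n)) \<le> real (K + 10) * 2 ^ d * norm (real n ^ d)"
      using eventually_ge_at_top[of 1]
    proof eventually_elim
      case (elim n)
      \<comment> \<open>For n at least 1, n + 1 is at most 2 n; this is the origin of the factor
        2^d.\<close>
      have "real (n + 1) ^ d \<le> (2 * real n) ^ d" by (rule power_mono) (use elim in simp_all)
      then have "real (K + 10) * real (n + 1) ^ d \<le> real (K + 10) * (2 * real n) ^ d"
        by (rule mult_left_mono) simp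
      then show ?case by (simp add: T_def power_mult_distrib mult.assoc)
    qed
  qed
  moreover have "\<exists>t s. exec ((sz x + 2) ^ k) p (enc x) t s \<and> t \<le> T (sz x) \<and>
      reg s ''out'' = (if Q x then 1 else 0)" if x: "x \<in> I" for x
  proof -
    have "word_exponent f \<le> k" "25 \<le> k" by (simp_all add: k_def)
    then obtain t s where "evaluates k (sz x) f 0 (enc x) t s"
      using compile_correct[OF wf _ _ enc[OF x]] by blast
    note ev = this[unfolded evaluates_def]
    have "exec ((sz x + 2) ^ k) (Assign ''out'' (Reg (temp 0))) s (1 + cost (Reg (temp 0)))
        (setr s ''out'' (val s (Reg (temp 0))))"
      by (rule exec_assign[of "sz x"]) (use ev in \<open>simp_all add: k_def\<close>)
    then have "exec ((sz x + 2) ^ k) p (enc x) (1 + t + (1 + cost (Reg (temp 0))))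
        (setr s ''out'' (val s (Reg (temp 0))))"
      unfolding p_def using ev exec.Seq by blast
    moreover have "1 + t + (1 + cost (Reg (temp 0))) \<le> T (sz x)"
    proof -
      have "t \<le> K * (sz x + 1) ^ depth f" using ev K[of "sz x"] by linarith
      then have "t \<le> K * (sz x + 1) ^ d" using d by (rule poly_bound_mono)
      moreover have "1 \<le> (sz x + 1) ^ d" by (rule one_le_power) simp
      moreover have "cost (Reg (temp 0)) = 1" by (simp add: cost_def)
      ultimately show ?thesis unfolding T_def add_mult_distrib by linarith
    qed
    moreover have "reg (setr s ''out'' (val s (Reg (temp 0)))) ''out'' = (if Q x then 1 else 0)"
      using ev Q[OF x] by simp
    ultimately show ?thesis by blast
  qed
  ultimately show ?thesis unfolding solvable_in_time_def by blast
qed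

text \<open>\<open>edge_fm\<close> agrees with \<open>literal_clash\<close> only for literals below
  2 n, where all array accesses fall into the encoded matrices. The closure depends only on
  these.\<close>

lemma closure_below_cong:
  "(\<And>i j. i < N \<Longrightarrow> j < N \<Longrightarrow> r i j = q i j) \<Longrightarrow> closure_below N r = closure_below N q"
proof -
  assume *: "\<And>i j. i < N \<Longrightarrow> j < N \<Longrightarrow> r i j = q i j"
  have "{(i, j). i < N \<and> j < N \<and> r i j} = {(i, j). i < N \<and> j < N \<and> q i j}" using * by blast
  then show ?thesis by (simp add: closure_below_def fun_eq_iff)
qed

lemma matrix_entry: "a < N \<Longrightarrow> b < N \<Longrightarrow> matrix N r (a * N + b) = of_bool (r a b)"
  using entry_less[of a N b] by (simp add: matrix_def)

text \<open>
  An expression counts as true if it is nonzero, so products are conjunctions and sums are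
  disjunctions.
\<close>

definition not_expr :: "expr \<Rightarrow> expr" where
  "not_expr e = Equal e (Lit 0)"

definition adj_expr :: "expr \<Rightarrow> expr \<Rightarrow> expr" where
  "adj_expr u v = Load ''adj'' (Add (Mul u (Reg ''n'')) v)"

text \<open>Colour \<open>a\<close> is stored in column \<open>a - 1\<close>. The subtraction comes
  last, and truncation does not interfere because \<open>a\<close> is at least 1.\<close>

definition list_expr :: "expr \<Rightarrow> expr \<Rightarrow> expr" where
  "list_expr u a = Load ''lists'' (Sub (Add (Mul (Lit 3) u) a) (Lit 1))"

definition touched_by_expr :: "string \<Rightarrow> string \<Rightarrow> expr \<Rightarrow> expr \<Rightarrow> expr" where
  "touched_by_expr d k u a = Add (Mul (adj_expr u (Reg d)) (Equal (Reg k) a))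
     (Mul (Equal u (Reg d)) (not_expr (Equal (Reg k) a)))"

definition touched_expr :: "expr \<Rightarrow> expr \<Rightarrow> expr" where
  "touched_expr u a = Add (touched_by_expr ''p'' ''a'' u a)
     (Add (touched_by_expr ''q'' ''b'' u a) (touched_by_expr ''r'' ''c'' u a))"

definition near_expr :: "expr \<Rightarrow> expr" where
  "near_expr u = Add (Add (Equal u (Reg ''p'')) (adj_expr u (Reg ''p'')))
     (Add (Add (Equal u (Reg ''q'')) (adj_expr u (Reg ''q'')))
       (Add (Equal u (Reg ''r'')) (adj_expr u (Reg ''r''))))"

definition not_one_expr :: "expr \<Rightarrow> expr" where
  "not_one_expr u = Add (touched_expr u (Lit 1)) (Mul (Equal u (Reg ''g'')) (Reg ''e''))"

definition bad_expr :: "expr \<Rightarrow> expr \<Rightarrow> expr" where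
  "bad_expr u a = Add (Add (not_expr (list_expr u a)) (touched_expr u a))
     (Add (Mul (Equal a (Lit 1)) (not_one_expr u)) (Mul (Equal a (Reg ''e'')) (not_expr (not_one_expr u))))"

text \<open>\<open>colour\<close> in arithmetic form: \<open>1 + s\<close>, raised by one if colour
  1 is touched or if \<open>s = 1\<close> and colour 2 is touched. The comparison with 0 normalises
  the disjunction to 0 or 1.\<close>

definition colour_expr :: "expr \<Rightarrow> expr \<Rightarrow> expr" where
  "colour_expr u s = Add (Add (Lit 1) s)
     (Less (Lit 0) (Add (touched_expr u (Lit 1)) (Mul s (touched_expr u (Lit 2)))))"

definition four_cycle_expr :: "expr \<Rightarrow> expr \<Rightarrow> expr \<Rightarrow> expr \<Rightarrow> expr" where
  "four_cycle_expr w x y z = Mul (Mul (Mul (adj_expr w x) (adj_expr x y)) (Mul (adj_expr y z) (adj_expr z w)))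
     (Mul (not_expr (Equal w y)) (not_expr (Equal x z)))"

definition covered_expr :: "expr \<Rightarrow> expr \<Rightarrow> expr \<Rightarrow> expr" where
  "covered_expr u v t = Add (Add (Equal t u) (Equal t v)) (not_one_expr t)"

definition or_fm :: "fm \<Rightarrow> fm \<Rightarrow> fm" where
  "or_fm f h = Neg (Conj (Neg f) (Neg h))"

definition clash_fm :: "expr \<Rightarrow> expr \<Rightarrow> expr \<Rightarrow> expr \<Rightarrow> fm" where
  "clash_fm u a v b = Conj (At (Mul (near_expr u) (near_expr v)))
     (or_fm (At (Add (Add (bad_expr u a) (bad_expr v b)) (Mul (adj_expr u v) (Equal a b))))
       (Conj (At (Mul (not_expr (Equal a (Lit 1))) (not_expr (Equal b (Lit 1)))))
         (Ex ''w'' 1 0 (Ex ''x'' 1 0 (Ex ''y'' 1 0 (Ex ''z'' 1 0 (At (Mul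
           (four_cycle_expr (Reg ''w'') (Reg ''x'') (Reg ''y'') (Reg ''z''))
           (Mul (Mul (covered_expr u v (Reg ''w'')) (covered_expr u v (Reg ''x'')))
             (Mul (covered_expr u v (Reg ''y'')) (covered_expr u v (Reg ''z''))))))))))))"

definition var_expr :: "string \<Rightarrow> expr" where
  "var_expr l = Div (Reg l) (Lit 2)"

text \<open>The remainder modulo 2, which the machine does not offer as an operation.\<close>

definition bit_expr :: "string \<Rightarrow> expr" where
  "bit_expr l = Sub (Reg l) (Mul (Lit 2) (var_expr l))"

definition flip_bit_expr :: "string \<Rightarrow> expr" where
  "flip_bit_expr l = Sub (Lit 1) (bit_expr l)"

definition flip_expr :: "string \<Rightarrow> expr" where
  "flip_expr l = Add (Mul (Lit 2) (var_expr l)) (flip_bit_expr l)"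

text \<open>The implication from literal \<open>l\<close> to literal \<open>m\<close>:
  \<open>l\<close> clashes with the complement of \<open>m\<close>, whence the flipped bit on the
  side of \<open>m\<close>.\<close>

definition edge_fm :: fm where
  "edge_fm = clash_fm (var_expr ''l'') (colour_expr (var_expr ''l'') (bit_expr ''l''))
     (var_expr ''m'') (colour_expr (var_expr ''m'') (flip_bit_expr ''m''))"

definition consistent_fm :: fm where
  "consistent_fm = Neg (Ex ''l'' 2 0 (At (Mul (Load ''R'' (entry (Reg ''l'') (flip_expr ''l'')))
     (Load ''R'' (entry (flip_expr ''l'') (Reg ''l''))))))"

definition pair_expr :: "string \<Rightarrow> string \<Rightarrow> string \<Rightarrow> string \<Rightarrow> expr" where
  "pair_expr d k d' k' = Add (not_expr (Mul (Equal (Reg k) (Lit 2)) (Equal (Reg k') (Lit 3))))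
     (adj_expr (Reg d) (Reg d'))"

definition admissible_expr :: expr where
  "admissible_expr = Add (Add (Equal (Reg ''e'') (Lit 2)) (Equal (Reg ''e'') (Lit 3)))
     (Mul (Equal (Reg ''e'') (Lit 0))
       (Mul (Mul (Mul (pair_expr ''p'' ''a'' ''p'' ''a'') (pair_expr ''p'' ''a'' ''q'' ''b''))
           (Mul (pair_expr ''p'' ''a'' ''r'' ''c'') (pair_expr ''q'' ''b'' ''p'' ''a'')))
         (Mul (Mul (pair_expr ''q'' ''b'' ''q'' ''b'') (pair_expr ''q'' ''b'' ''r'' ''c''))
           (Mul (Mul (pair_expr ''r'' ''c'' ''p'' ''a'') (pair_expr ''r'' ''c'' ''q'' ''b''))
             (pair_expr ''r'' ''c'' ''r'' ''c'')))))"

definition closed_fm :: fm where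
  "closed_fm = Neg (Ex ''w'' 1 0 (Ex ''x'' 1 0 (At (Mul (Mul (near_expr (Reg ''w''))
     (adj_expr (Reg ''w'') (Reg ''x''))) (not_expr (near_expr (Reg ''x'')))))))"

definition guess_fm :: fm where
  "guess_fm = Conj (At (Mul (Mul (Mul (Reg ''a'') (Reg ''b'')) (Reg ''c''))
       (Mul (near_expr (Reg ''v'')) admissible_expr)))
     (Conj closed_fm (Tc ''l'' ''m'' edge_fm consistent_fm))"

definition algorithm :: fm where
  "algorithm = Neg (Ex ''v'' 1 0 (Neg (Ex ''p'' 1 0 (Ex ''q'' 1 0 (Ex ''r'' 1 0
     (Ex ''a'' 0 4 (Ex ''b'' 0 4 (Ex ''c'' 0 4 (Ex ''g'' 1 0 (Ex ''e'' 0 4 guess_fm))))))))))"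

section \<open>Meaning of the expressions and formulas\<close>

text \<open>It constrains only the input arrays and \<open>n\<close>, so it survives all loops and
  the overwriting of \<open>R\<close>.\<close>

definition env :: "nat \<Rightarrow> (nat \<Rightarrow> nat \<Rightarrow> bool) \<Rightarrow> (nat \<Rightarrow> nat \<Rightarrow> bool) \<Rightarrow> state \<Rightarrow> bool" where
  "env n A L s \<longleftrightarrow> reg s ''n'' = n \<and> (\<forall>u<n. \<forall>v<n. arr s ''adj'' (u * n + v) \<noteq> 0 \<longleftrightarrow> A u v) \<and>
     (\<forall>u<n. \<forall>a\<in>{1, 2, 3}. arr s ''lists'' (3 * u + a - 1) \<noteq> 0 \<longleftrightarrow> L u a)"

definition guess_of :: "state \<Rightarrow> (nat \<times> nat) set" where
  "guess_of s = {(reg s ''p'', reg s ''a''), (reg s ''q'', reg s ''b''), (reg s ''r'', reg s ''c'')}"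

definition in_range :: "nat \<Rightarrow> state \<Rightarrow> bool" where
  "in_range n s \<longleftrightarrow> reg s ''p'' < n \<and> reg s ''q'' < n \<and> reg s ''r'' < n"

lemma env_update [simp]:
  "x \<noteq> ''n'' \<Longrightarrow> env n A L (setr s x i) = env n A L s"
  "a \<noteq> ''adj'' \<Longrightarrow> a \<noteq> ''lists'' \<Longrightarrow> env n A L (seta s a h) = env n A L s"
  by (simp_all add: env_def)

lemma guess_of_setr [simp]:
  "x \<notin> {''p'', ''q'', ''r'', ''a'', ''b'', ''c''} \<Longrightarrow> guess_of (setr s x i) = guess_of s"
  by (auto simp: guess_of_def)

lemma in_range_setr [simp]:
  "x \<notin> {''p'', ''q'', ''r''} \<Longrightarrow> in_range n (setr s x i) = in_range n s"
  by (auto simp: in_range_def)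

lemma val_not_expr [simp]: "val s (not_expr e) \<noteq> 0 \<longleftrightarrow> val s e = 0"
  by (simp add: not_expr_def)

lemma val_adj_expr:
  "env n A L s \<Longrightarrow> val s u < n \<Longrightarrow> val s v < n \<Longrightarrow> val s (adj_expr u v) \<noteq> 0 \<longleftrightarrow> A (val s u) (val s v)"
  by (simp add: env_def adj_expr_def)

lemma val_list_expr:
  "env n A L s \<Longrightarrow> val s u < n \<Longrightarrow> val s a \<in> {1, 2, 3} \<Longrightarrow>
    val s (list_expr u a) \<noteq> 0 \<longleftrightarrow> L (val s u) (val s a)"
  unfolding env_def list_expr_def val.simps by blast

context adj_graph
begin

lemma val_touched_by_expr:
  assumes "env n A L s" "val s u < n" "reg s d < n"
  shows "val s (touched_by_expr d k u a) \<noteq> 0 \<longleftrightarrow>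
    A (val s u) (reg s d) \<and> reg s k = val s a \<or> val s u = reg s d \<and> reg s k \<noteq> val s a"
proof -
  have "val s (adj_expr u (Reg d)) \<noteq> 0 \<longleftrightarrow> A (val s u) (reg s d)"
    using val_adj_expr[OF assms(1,2), of "Reg d"] assms(3) by simp
  then show ?thesis unfolding touched_by_expr_def not_expr_def by auto
qed

lemma val_touched_expr:
  assumes "env n A L s" "in_range n s" "val s u < n"
  shows "val s (touched_expr u a) \<noteq> 0 \<longleftrightarrow> guess.touched A (guess_of s) (val s u) (val s a)"
proof -
  interpret guess n A L "guess_of s" 0 0 by unfold_locales
  have r: "reg s ''p'' < n" "reg s ''q'' < n" "reg s ''r'' < n" using assms(2) by (simp_all add: in_range_def)
  have "val s (touched_expr u a) \<noteq> 0 \<longleftrightarrow> val s (touched_by_expr ''p'' ''a'' u a) \<noteq> 0 \<or>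
    val s (touched_by_expr ''q'' ''b'' u a) \<noteq> 0 \<or> val s (touched_by_expr ''r'' ''c'' u a) \<noteq> 0"
    unfolding touched_expr_def by simp
  also have "\<dots> \<longleftrightarrow> touched (val s u) (val s a)"
    unfolding val_touched_by_expr[OF assms(1,3) r(1)] val_touched_by_expr[OF assms(1,3) r(2)]
      val_touched_by_expr[OF assms(1,3) r(3)]
    unfolding touched_def unfolding guess_of_def by blast
  finally show ?thesis .
qed

lemma val_near_expr:
  assumes "env n A L s" "in_range n s" "val s u < n"
  shows "val s (near_expr u) \<noteq> 0 \<longleftrightarrow> guess.near A (guess_of s) (val s u)"
proof -
  interpret guess n A L "guess_of s" 0 0 by unfold_locales
  have r: "val s (Reg ''p'') < n" "val s (Reg ''q'') < n" "val s (Reg ''r'') < n"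
    using assms(2) by (simp_all add: in_range_def)
  note a = val_adj_expr[OF assms(1,3) r(1)] val_adj_expr[OF assms(1,3) r(2)] val_adj_expr[OF assms(1,3) r(3)]
  have "val s (near_expr u) \<noteq> 0 \<longleftrightarrow>
    val s u = reg s ''p'' \<or> val s (adj_expr u (Reg ''p'')) \<noteq> 0 \<or>
    val s u = reg s ''q'' \<or> val s (adj_expr u (Reg ''q'')) \<noteq> 0 \<or>
    val s u = reg s ''r'' \<or> val s (adj_expr u (Reg ''r'')) \<noteq> 0"
    unfolding near_expr_def by simp
  also have "\<dots> \<longleftrightarrow> near (val s u)"
    unfolding a unfolding near_def unfolding guess_of_def by auto
  finally show ?thesis .
qed

lemma val_not_one_expr:
  assumes "env n A L s" "in_range n s" "val s u < n"
  shows "val s (not_one_expr u) \<noteq> 0 \<longleftrightarrow>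
    guess.not_one A (guess_of s) (reg s ''g'') (reg s ''e'') (val s u)"
proof -
  interpret guess n A L "guess_of s" "reg s ''g''" "reg s ''e''" by unfold_locales
  have "val s (not_one_expr u) \<noteq> 0 \<longleftrightarrow> val s (touched_expr u (Lit 1)) \<noteq> 0 \<or>
    val s u = reg s ''g'' \<and> reg s ''e'' \<noteq> 0"
    unfolding not_one_expr_def by simp
  also have "\<dots> \<longleftrightarrow> not_one (val s u)"
    unfolding val_touched_expr[OF assms] unfolding not_one_def by simp
  finally show ?thesis .
qed

lemma val_bad_expr:
  assumes "env n A L s" "in_range n s" "val s u < n" "val s a \<in> {1, 2, 3}"
  shows "val s (bad_expr u a) \<noteq> 0 \<longleftrightarrow>
    guess.bad A L (guess_of s) (reg s ''g'') (reg s ''e'') (val s u) (val s a)"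
proof -
  interpret guess n A L "guess_of s" "reg s ''g''" "reg s ''e''" by unfold_locales
  have "val s (bad_expr u a) \<noteq> 0 \<longleftrightarrow> \<not> val s (list_expr u a) \<noteq> 0 \<or> val s (touched_expr u a) \<noteq> 0 \<or>
    val s a = 1 \<and> val s (not_one_expr u) \<noteq> 0 \<or> val s a = reg s ''e'' \<and> \<not> val s (not_one_expr u) \<noteq> 0"
    unfolding bad_expr_def not_expr_def by auto
  also have "\<dots> \<longleftrightarrow> bad (val s u) (val s a)"
    unfolding val_touched_expr[OF assms(1-3)] val_not_one_expr[OF assms(1-3)]
      val_list_expr[OF assms(1,3,4)] bad_def by blast
  finally show ?thesis .
qed

lemma val_colour_expr:
  assumes "env n A L s" "in_range n s" "val s u < n" "val s t < 2"
  shows "val s (colour_expr u t) = guess.colour A (guess_of s) (val s u) (val s t)"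
proof -
  interpret guess n A L "guess_of s" 0 0 by unfold_locales
  have "0 < val s (touched_expr u (Lit 1)) \<longleftrightarrow> touched (val s u) 1"
    "0 < val s (touched_expr u (Lit 2)) \<longleftrightarrow> touched (val s u) 2"
    using val_touched_expr[OF assms(1-3)] by simp_all
  then show ?thesis using assms(4) unfolding colour_expr_def colour_def by (auto simp: less_2_cases_iff)
qed

lemma val_four_cycle_expr:
  assumes "env n A L s" "val s w < n" "val s x < n" "val s y < n" "val s z < n"
  shows "val s (four_cycle_expr w x y z) \<noteq> 0 \<longleftrightarrow> four_cycle A (val s w) (val s x) (val s y) (val s z)"
proof -
  note a = val_adj_expr[OF assms(1)]
  have "val s (four_cycle_expr w x y z) \<noteq> 0 \<longleftrightarrow>
    val s (adj_expr w x) \<noteq> 0 \<and> val s (adj_expr x y) \<noteq> 0 \<and> val s (adj_expr y z) \<noteq> 0 \<and>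
    val s (adj_expr z w) \<noteq> 0 \<and> val s w \<noteq> val s y \<and> val s x \<noteq> val s z"
    unfolding four_cycle_expr_def not_expr_def by simp
  then show ?thesis
    unfolding a[OF assms(2,3)] a[OF assms(3,4)] a[OF assms(4,5)] a[OF assms(5,2)] four_cycle_def .
qed

lemma val_covered_expr:
  assumes "env n A L s" "in_range n s" "val s t < n"
  shows "val s (covered_expr u v t) \<noteq> 0 \<longleftrightarrow> val s t = val s u \<or> val s t = val s v \<or>
    guess.not_one A (guess_of s) (reg s ''g'') (reg s ''e'') (val s t)"
proof -
  have "val s (covered_expr u v t) \<noteq> 0 \<longleftrightarrow>
    val s t = val s u \<or> val s t = val s v \<or> val s (not_one_expr t) \<noteq> 0"
    unfolding covered_expr_def by simp
  then show ?thesis unfolding val_not_one_expr[OF assms] .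
qed

lemma sat_or_fm [simp]: "sat (or_fm f h) s \<longleftrightarrow> sat f s \<or> sat h s"
  by (simp add: or_fm_def)

text \<open>The condition \<open>fresh\<close> keeps the loops over the 4-cycle from changing the
  values of \<open>u\<close> and \<open>v\<close>. These loops find every 4-cycle because adjacent
  vertices are less than \<open>n\<close>.\<close>

lemma sat_clash_fm:
  assumes s: "env n A L s" "in_range n s"
    and u: "val s u < n" "val s a \<in> {1, 2, 3}" and v: "val s v < n" "val s b \<in> {1, 2, 3}"
    and fresh: "(expr_regs u \<union> expr_regs v) \<inter> {''w'', ''x'', ''y'', ''z''} = {}"
  shows "sat (clash_fm u a v b) s \<longleftrightarrow>
    guess.clash A L (guess_of s) (reg s ''g'') (reg s ''e'') (val s u) (val s a) (val s v) (val s b)"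
proof -
  interpret guess n A L "guess_of s" "reg s ''g''" "reg s ''e''" by unfold_locales
  let ?s = "\<lambda>w x y z. setr (setr (setr (setr s ''w'' w) ''x'' x) ''y'' y) ''z'' z"
  let ?body = "Mul (four_cycle_expr (Reg ''w'') (Reg ''x'') (Reg ''y'') (Reg ''z''))
           (Mul (Mul (covered_expr u v (Reg ''w'')) (covered_expr u v (Reg ''x'')))
             (Mul (covered_expr u v (Reg ''y'')) (covered_expr u v (Reg ''z''))))"
  have body: "val (?s w x y z) ?body \<noteq> 0 \<longleftrightarrow> four_cycle A w x y z \<and>
      (\<forall>t\<in>{w, x, y, z}. t = val s u \<or> t = val s v \<or> not_one t)"
    if "w < n" "x < n" "y < n" "z < n" for w x y z
  proof -
    let ?t = "?s w x y z"
    have t: "env n A L ?t" "in_range n ?t" "guess_of ?t = guess_of s"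
      "reg ?t ''g'' = reg s ''g''" "reg ?t ''e'' = reg s ''e''"
      using s by simp_all
    have r: "val ?t (Reg ''w'') = w" "val ?t (Reg ''x'') = x" "val ?t (Reg ''y'') = y" "val ?t (Reg ''z'') = z"
      by simp_all
    have uv: "val ?t u = val s u" "val ?t v = val s v"
      by (rule val_cong; use fresh in auto)+
    have "val ?t ?body \<noteq> 0 \<longleftrightarrow> val ?t (four_cycle_expr (Reg ''w'') (Reg ''x'') (Reg ''y'') (Reg ''z'')) \<noteq> 0 \<and>
      val ?t (covered_expr u v (Reg ''w'')) \<noteq> 0 \<and> val ?t (covered_expr u v (Reg ''x'')) \<noteq> 0 \<and>
      val ?t (covered_expr u v (Reg ''y'')) \<noteq> 0 \<and> val ?t (covered_expr u v (Reg ''z'')) \<noteq> 0"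
      by (simp only: val.simps(6) mult_eq_0_iff de_Morgan_disj conj_assoc)
    moreover have "val ?t (four_cycle_expr (Reg ''w'') (Reg ''x'') (Reg ''y'') (Reg ''z'')) \<noteq> 0 \<longleftrightarrow>
        four_cycle A w x y z"
      using val_four_cycle_expr[OF t(1), of "Reg ''w''" "Reg ''x''" "Reg ''y''" "Reg ''z''"] that
      unfolding r by blast
    moreover have "val ?t (covered_expr u v (Reg c)) \<noteq> 0 \<longleftrightarrow>
        i = val s u \<or> i = val s v \<or> not_one i" if "val ?t (Reg c) = i" "i < n" for c i
      using val_covered_expr[OF t(1,2), of "Reg c" u v] that unfolding t(3-5) uv by simp
    note this[OF r(1) \<open>w < n\<close>] this[OF r(2) \<open>x < n\<close>] this[OF r(3) \<open>y < n\<close>] this[OF r(4) \<open>z < n\<close>]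
    ultimately show ?thesis by blast
  qed
  have n: "reg s ''n'' = n" using s(1) by (simp add: env_def)
  have cyc: "sat (Ex ''w'' 1 0 (Ex ''x'' 1 0 (Ex ''y'' 1 0 (Ex ''z'' 1 0 (At ?body))))) s \<longleftrightarrow>
      (\<exists>w x y z. four_cycle A w x y z \<and> (\<forall>t\<in>{w, x, y, z}. t = val s u \<or> t = val s v \<or> not_one t))"
    (is "?l \<longleftrightarrow> ?r")
  proof -
    have "?l \<longleftrightarrow> (\<exists>w<n. \<exists>x<n. \<exists>y<n. \<exists>z<n. val (?s w x y z) ?body \<noteq> 0)"
      unfolding sat.simps using n by simp
    also have "\<dots> \<longleftrightarrow> (\<exists>w<n. \<exists>x<n. \<exists>y<n. \<exists>z<n. four_cycle A w x y z \<and>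
      (\<forall>t\<in>{w, x, y, z}. t = val s u \<or> t = val s v \<or> not_one t))"
      by (intro ex_cong1 conj_cong refl) (rule body)
    also have "\<dots> \<longleftrightarrow> ?r" using A_bound unfolding four_cycle_def by blast
    finally show ?thesis .
  qed
  have 1: "val s (Mul (near_expr u) (near_expr v)) \<noteq> 0 \<longleftrightarrow> near (val s u) \<and> near (val s v)"
    using val_near_expr[OF s u(1)] val_near_expr[OF s v(1)] by simp
  have 2: "val s (Add (Add (bad_expr u a) (bad_expr v b)) (Mul (adj_expr u v) (Equal a b))) \<noteq> 0 \<longleftrightarrow>
      bad (val s u) (val s a) \<or> bad (val s v) (val s b) \<or> A (val s u) (val s v) \<and> val s a = val s b"
    using val_bad_expr[OF s u] val_bad_expr[OF s v] val_adj_expr[OF s(1) u(1) v(1)] by simp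
  have 3: "val s (Mul (not_expr (Equal a (Lit 1))) (not_expr (Equal b (Lit 1)))) \<noteq> 0 \<longleftrightarrow>
      val s a \<noteq> 1 \<and> val s b \<noteq> 1"
    unfolding not_expr_def by simp
  have at: "sat (At x) s \<longleftrightarrow> val s x \<noteq> 0" for x by simp
  show ?thesis
    unfolding clash_fm_def sat.simps(3) sat_or_fm cyc at 1 2 3 unfolding clash_def by blast
qed

lemma val_literal_exprs:
  "val s (var_expr l) = reg s l div 2" "val s (bit_expr l) = reg s l mod 2"
  "val s (flip_bit_expr l) = 1 - reg s l mod 2" "val s (flip_expr l) = flip (reg s l)"
  by (simp_all add: var_expr_def bit_expr_def flip_bit_expr_def flip_expr_def flip_def minus_mult_div_eq_mod)

lemma sat_edge_fm:
  assumes s: "env n A L s" "in_range n s" and l: "reg s ''l'' < 2 * n" "reg s ''m'' < 2 * n"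
  shows "sat edge_fm s \<longleftrightarrow> guess.literal_clash A L (guess_of s) (reg s ''g'') (reg s ''e'')
    (reg s ''l'') (flip (reg s ''m''))"
proof -
  interpret guess n A L "guess_of s" "reg s ''g''" "reg s ''e''" by unfold_locales
  have lt: "val s (var_expr ''l'') < n" "val s (var_expr ''m'') < n"
    using l unfolding val_literal_exprs by linarith+
  have bit: "val s (bit_expr ''l'') < 2" "val s (flip_bit_expr ''m'') < 2"
    unfolding val_literal_exprs by simp_all
  note c = val_colour_expr[OF s lt(1) bit(1)] val_colour_expr[OF s lt(2) bit(2)]
  have "colour u t \<in> {1, 2, 3}" for u t by (simp add: colour_def)
  then have r: "val s (colour_expr (var_expr ''l'') (bit_expr ''l'')) \<in> {1, 2, 3}"
    "val s (colour_expr (var_expr ''m'') (flip_bit_expr ''m'')) \<in> {1, 2, 3}"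
    unfolding c by blast+
  have fresh: "(expr_regs (var_expr ''l'') \<union> expr_regs (var_expr ''m'')) \<inter> {''w'', ''x'', ''y'', ''z''} = {}"
    by (simp add: var_expr_def)
  show ?thesis
    unfolding edge_fm_def sat_clash_fm[OF s lt(1) r(1) lt(2) r(2) fresh] unfolding c val_literal_exprs
    unfolding literal_clash_def flip_div flip_mod by (rule refl)
qed

lemma val_pair_expr:
  assumes "env n A L s" "reg s d < n" "reg s d' < n"
  shows "val s (pair_expr d k d' k') \<noteq> 0 \<longleftrightarrow> (reg s k = 2 \<longrightarrow> reg s k' = 3 \<longrightarrow> A (reg s d) (reg s d'))"
  using val_adj_expr[OF assms(1), of "Reg d" "Reg d'"] assms(2,3) unfolding pair_expr_def not_expr_def by auto

lemma val_admissible_expr: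
  assumes "env n A L s" "in_range n s"
  shows "val s admissible_expr \<noteq> 0 \<longleftrightarrow> guess.admissible A (guess_of s) (reg s ''e'')"
proof -
  interpret guess n A L "guess_of s" 0 "reg s ''e''" by unfold_locales
  have r: "reg s ''p'' < n" "reg s ''q'' < n" "reg s ''r'' < n" using assms(2) by (simp_all add: in_range_def)
  note p = val_pair_expr[OF assms(1)]
  let ?P = "\<lambda>d k d' k'. val s (pair_expr d k d' k') \<noteq> 0"
  have "val s admissible_expr \<noteq> 0 \<longleftrightarrow> reg s ''e'' = 2 \<or> reg s ''e'' = 3 \<or> reg s ''e'' = 0 \<and>
    ?P ''p'' ''a'' ''p'' ''a'' \<and> ?P ''p'' ''a'' ''q'' ''b'' \<and> ?P ''p'' ''a'' ''r'' ''c'' \<and>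
    ?P ''q'' ''b'' ''p'' ''a'' \<and> ?P ''q'' ''b'' ''q'' ''b'' \<and> ?P ''q'' ''b'' ''r'' ''c'' \<and>
    ?P ''r'' ''c'' ''p'' ''a'' \<and> ?P ''r'' ''c'' ''q'' ''b'' \<and> ?P ''r'' ''c'' ''r'' ''c''"
    unfolding admissible_expr_def by simp
  also have "\<dots> \<longleftrightarrow> admissible"
    unfolding p[OF r(1) r(1)] p[OF r(1) r(2)] p[OF r(1) r(3)] p[OF r(2) r(1)] p[OF r(2) r(2)] p[OF r(2) r(3)]
      p[OF r(3) r(1)] p[OF r(3) r(2)] p[OF r(3) r(3)]
    unfolding admissible_def unfolding guess_of_def by simp
  finally show ?thesis .
qed

lemma sat_closed_fm:
  assumes s: "env n A L s" "in_range n s"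
  shows "sat closed_fm s \<longleftrightarrow> guess.closed A (guess_of s)"
proof -
  interpret guess n A L "guess_of s" 0 0 by unfold_locales
  let ?e = "Mul (Mul (near_expr (Reg ''w'')) (adj_expr (Reg ''w'') (Reg ''x''))) (not_expr (near_expr (Reg ''x'')))"
  have e: "val (setr (setr s ''w'' w) ''x'' x) ?e \<noteq> 0 \<longleftrightarrow> near w \<and> A w x \<and> \<not> near x" if "w < n" "x < n" for w x
  proof -
    let ?t = "setr (setr s ''w'' w) ''x'' x"
    have t: "env n A L ?t" "in_range n ?t" "guess_of ?t = guess_of s" using s by simp_all
    have r: "val ?t (Reg ''w'') = w" "val ?t (Reg ''x'') = x" by simp_all
    have lt: "val ?t (Reg ''w'') < n" "val ?t (Reg ''x'') < n" unfolding r by fact+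
    have "val ?t ?e \<noteq> 0 \<longleftrightarrow> val ?t (near_expr (Reg ''w'')) \<noteq> 0 \<and>
      val ?t (adj_expr (Reg ''w'') (Reg ''x'')) \<noteq> 0 \<and> \<not> val ?t (near_expr (Reg ''x'')) \<noteq> 0"
      unfolding not_expr_def by simp
    then show ?thesis
      unfolding val_near_expr[OF t(1,2) lt(1)] val_near_expr[OF t(1,2) lt(2)] val_adj_expr[OF t(1) lt]
      unfolding r t(3) .
  qed
  have n: "reg s ''n'' = n" using s(1) by (simp add: env_def)
  have "sat closed_fm s \<longleftrightarrow> \<not> (\<exists>w<n. \<exists>x<n. val (setr (setr s ''w'' w) ''x'' x) ?e \<noteq> 0)"
    unfolding closed_fm_def sat.simps using n by simp
  also have "\<dots> \<longleftrightarrow> \<not> (\<exists>w<n. \<exists>x<n. near w \<and> A w x \<and> \<not> near x)"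
    by (intro arg_cong[of _ _ Not] ex_cong1 conj_cong refl) (rule e)
  also have "\<dots> \<longleftrightarrow> closed" unfolding closed_def using A_bound A_sym by blast
  finally show ?thesis .
qed

lemma sat_guess_fm:
  assumes s: "env n A L s" "in_range n s" "reg s ''v'' < n"
  shows "sat guess_fm s \<longleftrightarrow> reg s ''a'' \<noteq> 0 \<and> reg s ''b'' \<noteq> 0 \<and> reg s ''c'' \<noteq> 0 \<and>
    guess_works L (guess_of s) (reg s ''g'') (reg s ''e'') (reg s ''v'')"
proof -
  interpret guess n A L "guess_of s" "reg s ''g''" "reg s ''e''" by unfold_locales
  let ?N = "2 * n"
  let ?C = "closure_below ?N (\<lambda>l m. literal_clash l (flip m))"
  have n: "reg s ''n'' = n" using s(1) by (simp add: env_def)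
  have "val s (Reg ''v'') < n" using s(3) by simp
  then have at: "val s (Mul (Mul (Mul (Reg ''a'') (Reg ''b'')) (Reg ''c''))
       (Mul (near_expr (Reg ''v'')) admissible_expr)) \<noteq> 0 \<longleftrightarrow>
     reg s ''a'' \<noteq> 0 \<and> reg s ''b'' \<noteq> 0 \<and> reg s ''c'' \<noteq> 0 \<and> near (reg s ''v'') \<and> admissible"
    using val_near_expr[OF s(1,2), of "Reg ''v''"] val_admissible_expr[OF s(1,2)] by simp
  have "closure_below ?N (\<lambda>i j. sat edge_fm (setr (setr s ''l'' i) ''m'' j)) = ?C"
  proof (rule closure_below_cong)
    fix i j
    assume "i < ?N" "j < ?N"
    then show "sat edge_fm (setr (setr s ''l'' i) ''m'' j) = literal_clash i (flip j)"
      using sat_edge_fm[of L "setr (setr s ''l'' i) ''m'' j"] s by simp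
  qed
  then have tc: "sat (Tc ''l'' ''m'' edge_fm consistent_fm) s \<longleftrightarrow>
      sat consistent_fm (seta s ''R'' (matrix ?N ?C))"
    unfolding sat.simps n by simp
  let ?t = "\<lambda>l. setr (seta s ''R'' (matrix ?N ?C)) ''l'' l"
  let ?e = "Mul (Load ''R'' (entry (Reg ''l'') (flip_expr ''l''))) (Load ''R'' (entry (flip_expr ''l'') (Reg ''l'')))"
  have e: "val (?t l) ?e \<noteq> 0 \<longleftrightarrow> ?C l (flip l) \<and> ?C (flip l) l" if l: "l < ?N" for l
  proof -
    have f: "flip l < ?N" using l by simp
    have "val (?t l) (entry x y) = val (?t l) x * ?N + val (?t l) y" for x y
      by (simp add: entry_def n)
    then have "val (?t l) ?e = matrix ?N ?C (l * ?N + flip l) * matrix ?N ?C (flip l * ?N + l)"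
      by (simp add: val_literal_exprs)
    then show ?thesis unfolding matrix_entry[OF l f] matrix_entry[OF f l] by simp
  qed
  have "sat consistent_fm (seta s ''R'' (matrix ?N ?C)) \<longleftrightarrow> \<not> (\<exists>l<?N. val (?t l) ?e \<noteq> 0)"
    unfolding consistent_fm_def sat.simps using n by simp
  also have "\<dots> \<longleftrightarrow> \<not> (\<exists>l<?N. ?C l (flip l) \<and> ?C (flip l) l)"
    by (intro arg_cong[of _ _ Not] ex_cong1 conj_cong refl) (rule e)
  finally have cons: "sat consistent_fm (seta s ''R'' (matrix ?N ?C)) \<longleftrightarrow>
      (\<forall>l<?N. \<not> (?C l (flip l) \<and> ?C (flip l) l))" by blast
  have at_iff: "sat (At x) s \<longleftrightarrow> val s x \<noteq> 0" for x by simp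
  show ?thesis
    unfolding guess_fm_def sat.simps(3) at_iff at sat_closed_fm[OF s(1,2)] tc cons guess_works_def
    by blast
qed

lemma sat_algorithm:
  assumes s: "env n A L s"
  shows "sat algorithm s \<longleftrightarrow> (\<exists>c. good_on A L {..<n} c)"
proof -
  have n: "reg s ''n'' = n" using s by (simp add: env_def)
  have g: "sat guess_fm (setr (setr (setr (setr (setr (setr (setr (setr (setr s ''v'' v) ''p'' p) ''q'' q)
      ''r'' r) ''a'' a) ''b'' b) ''c'' c) ''g'' g) ''e'' e) \<longleftrightarrow>
    a \<noteq> 0 \<and> b \<noteq> 0 \<and> c \<noteq> 0 \<and> guess_works L (guessed p q r a b c) g e v"
    if "v < n" "p < n" "q < n" "r < n" for v p q r a b c g e
    by (subst sat_guess_fm[where L = L])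
      (use that s in \<open>simp_all add: in_range_def guess_of_def guessed_def\<close>)
  have "sat algorithm s \<longleftrightarrow> (\<forall>v<n. \<exists>p<n. \<exists>q<n. \<exists>r<n. \<exists>a<4. \<exists>b<4. \<exists>c<4. \<exists>g<n. \<exists>e<4.
    sat guess_fm (setr (setr (setr (setr (setr (setr (setr (setr (setr s ''v'' v) ''p'' p) ''q'' q)
      ''r'' r) ''a'' a) ''b'' b) ''c'' c) ''g'' g) ''e'' e))"
    unfolding algorithm_def sat.simps using n by simp
  also have "\<dots> \<longleftrightarrow> (\<forall>v<n. \<exists>p<n. \<exists>q<n. \<exists>r<n. \<exists>a<4. \<exists>b<4. \<exists>c<4. \<exists>g<n. \<exists>e<4.
     a \<noteq> 0 \<and> b \<noteq> 0 \<and> c \<noteq> 0 \<and> guess_works L (guessed p q r a b c) g e v)"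
    by (intro all_cong1 imp_cong ex_cong1 conj_cong refl) (rule g)
  finally show ?thesis unfolding good_on_iff .
qed

end

section \<open>Well-formedness and depth of the algorithm\<close>

lemma expr_regs_exprs [simp]:
  "expr_regs (not_expr x) = expr_regs x"
  "expr_regs (adj_expr u v) = {''n''} \<union> expr_regs u \<union> expr_regs v"
  "expr_regs (list_expr u a) = expr_regs u \<union> expr_regs a"
  "expr_regs (touched_expr u a) = {''n'', ''p'', ''q'', ''r'', ''a'', ''b'', ''c''} \<union> expr_regs u \<union> expr_regs a"
  "expr_regs (near_expr u) = {''n'', ''p'', ''q'', ''r''} \<union> expr_regs u"
  "expr_regs (not_one_expr u) = {''n'', ''p'', ''q'', ''r'', ''a'', ''b'', ''c'', ''g'', ''e''} \<union> expr_regs u"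
  "expr_regs (bad_expr u a) = {''n'', ''p'', ''q'', ''r'', ''a'', ''b'', ''c'', ''g'', ''e''} \<union> expr_regs u \<union> expr_regs a"
  "expr_regs (colour_expr u t) = {''n'', ''p'', ''q'', ''r'', ''a'', ''b'', ''c''} \<union> expr_regs u \<union> expr_regs t"
  "expr_regs (four_cycle_expr w x y z) = {''n''} \<union> expr_regs w \<union> expr_regs x \<union> expr_regs y \<union> expr_regs z"
  "expr_regs (covered_expr u v t) = {''n'', ''p'', ''q'', ''r'', ''a'', ''b'', ''c'', ''g'', ''e''} \<union>
     expr_regs u \<union> expr_regs v \<union> expr_regs t"
  "expr_regs (var_expr l) = {l}" "expr_regs (bit_expr l) = {l}" "expr_regs (flip_bit_expr l) = {l}"
  "expr_regs (flip_expr l) = {l}" "expr_regs (entry x y) = {''n''} \<union> expr_regs x \<union> expr_regs y"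
  "expr_regs admissible_expr = {''n'', ''p'', ''q'', ''r'', ''a'', ''b'', ''c'', ''e''}"
  by (auto simp: not_expr_def adj_expr_def list_expr_def touched_expr_def touched_by_expr_def near_expr_def
      not_one_expr_def bad_expr_def colour_expr_def four_cycle_expr_def covered_expr_def var_expr_def
      bit_expr_def flip_bit_expr_def flip_expr_def entry_def admissible_expr_def pair_expr_def)

lemma expr_arrs_exprs [simp]:
  "expr_arrs (not_expr x) = expr_arrs x"
  "expr_arrs (adj_expr u v) = {''adj''} \<union> expr_arrs u \<union> expr_arrs v"
  "expr_arrs (list_expr u a) = {''lists''} \<union> expr_arrs u \<union> expr_arrs a"
  "expr_arrs (touched_expr u a) = {''adj''} \<union> expr_arrs u \<union> expr_arrs a"
  "expr_arrs (near_expr u) = {''adj''} \<union> expr_arrs u"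
  "expr_arrs (not_one_expr u) = {''adj''} \<union> expr_arrs u"
  "expr_arrs (bad_expr u a) = {''adj'', ''lists''} \<union> expr_arrs u \<union> expr_arrs a"
  "expr_arrs (colour_expr u t) = {''adj''} \<union> expr_arrs u \<union> expr_arrs t"
  "expr_arrs (four_cycle_expr w x y z) = {''adj''} \<union> expr_arrs w \<union> expr_arrs x \<union> expr_arrs y \<union> expr_arrs z"
  "expr_arrs (covered_expr u v t) = {''adj''} \<union> expr_arrs u \<union> expr_arrs v \<union> expr_arrs t"
  "expr_arrs (var_expr l) = {}" "expr_arrs (bit_expr l) = {}" "expr_arrs (flip_bit_expr l) = {}"
  "expr_arrs (flip_expr l) = {}" "expr_arrs (entry x y) = expr_arrs x \<union> expr_arrs y"
  "expr_arrs admissible_expr = {''adj''}"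
  by (auto simp: not_expr_def adj_expr_def list_expr_def touched_expr_def touched_by_expr_def near_expr_def
      not_one_expr_def bad_expr_def colour_expr_def four_cycle_expr_def covered_expr_def var_expr_def
      bit_expr_def flip_bit_expr_def flip_expr_def entry_def admissible_expr_def pair_expr_def)

lemma edge_fm_locations:
  "free_regs edge_fm = {''n'', ''p'', ''q'', ''r'', ''a'', ''b'', ''c'', ''g'', ''e'', ''l'', ''m''}"
  "bound_regs edge_fm = {''w'', ''x'', ''y'', ''z''}"
  "free_arrs edge_fm = {''adj'', ''lists''}" "bound_arrs edge_fm = {}"
  unfolding edge_fm_def clash_fm_def or_fm_def by auto

lemma closed_fm_locations:
  "free_regs closed_fm = {''n'', ''p'', ''q'', ''r''}" "bound_regs closed_fm = {''w'', ''x''}"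
  "free_arrs closed_fm = {''adj''}" "bound_arrs closed_fm = {}"
  unfolding closed_fm_def by auto

lemma consistent_fm_locations:
  "free_regs consistent_fm = {''n''}" "bound_regs consistent_fm = {''l''}"
  "free_arrs consistent_fm = {''R''}" "bound_arrs consistent_fm = {}"
  unfolding consistent_fm_def by auto

lemma wf_edge_fm: "wf_fm edge_fm"
  unfolding edge_fm_def clash_fm_def or_fm_def by (simp add: clean_def)

lemma wf_closed_fm: "wf_fm closed_fm"
  unfolding closed_fm_def by (simp add: clean_def)

lemma wf_consistent_fm: "wf_fm consistent_fm"
  unfolding consistent_fm_def by (simp add: clean_def)

lemma guess_fm_locations:
  "free_regs guess_fm = {''n'', ''v'', ''p'', ''q'', ''r'', ''a'', ''b'', ''c'', ''g'', ''e''}"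
  "bound_regs guess_fm = {''w'', ''x'', ''y'', ''z'', ''l'', ''m'', ''k''}"
  "free_arrs guess_fm = {''adj'', ''lists''}" "bound_arrs guess_fm = {''R''}"
  unfolding guess_fm_def
  by (auto simp: edge_fm_locations closed_fm_locations consistent_fm_locations)

lemma wf_guess_fm: "wf_fm guess_fm"
  unfolding guess_fm_def
  by (simp add: edge_fm_locations closed_fm_locations consistent_fm_locations
      wf_edge_fm wf_closed_fm wf_consistent_fm clean_def)

text \<open>The conditions that \<open>wf_fm\<close> imposes on the body of a quantifier, in a form
  that the quantified formula inherits. So the nine outer quantifiers can be checked one by
  one.\<close>

definition separated :: "fm \<Rightarrow> bool" where
  "separated f \<longleftrightarrow> wf_fm f \<and> bound_regs f \<inter> free_regs f = {} \<and> bound_arrs f \<inter> free_arrs f = {}"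

lemma separated_Neg: "separated f \<Longrightarrow> separated (Neg f)"
  by (simp add: separated_def)

lemma separated_Ex:
  assumes "separated f" "a \<le> 4" "b \<le> 4" "clean x" "x \<noteq> ''n''" "x \<notin> bound_regs f"
  shows "separated (Ex x a b f)"
  using assms n_not_bound[of f] unfolding separated_def by auto

lemma wf_algorithm: "wf_fm algorithm"
proof -
  have "separated guess_fm" using wf_guess_fm by (simp add: separated_def guess_fm_locations)
  then have "separated algorithm"
    unfolding algorithm_def
    by (intro separated_Neg separated_Ex) (simp_all add: guess_fm_locations clean_def)
  then show ?thesis by (simp add: separated_def)
qed

text \<open>Nine quantifiers surround \<open>guess_fm\<close>, whose deepest part has two loops over
  literals and inside them four over the vertices of a 4-cycle. This makes 15, the loops over the
  four values of \<open>a\<close>, \<open>b\<close>, \<open>c\<close> and \<open>e\<close> being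
  counted like loops over vertices.\<close>

lemma depth_algorithm: "depth algorithm \<le> 16"
  by (simp add: algorithm_def guess_fm_def closed_fm_def consistent_fm_def edge_fm_def clash_fm_def or_fm_def)

lemma inv_state_encode: "inv_state (num_verts x) (encode x)"
  by (cases x) (auto simp: inv_state_def bounded_def encode_def num_verts_def Let_def)

lemma env_encode:
  assumes "(G, L) \<in> P5_free_instances"
  shows "env (card (verts G)) (adjacent G) (\<lambda>u a. a \<in> L u) (encode (G, L))"
proof -
  let ?n = "card (verts G)"
  have adj: "arr (encode (G, L)) ''adj'' (u * ?n + v) \<noteq> 0 \<longleftrightarrow> adjacent G u v" if "u < ?n" "v < ?n" for u v
  proof -
    have "(u * ?n + v) div ?n = u" "(u * ?n + v) mod ?n = v" using that by simp_all
    then show ?thesis using entry_less[OF that] by (simp add: encode_def Let_def adjacent_def)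
  qed
  have lists: "arr (encode (G, L)) ''lists'' (3 * u + a - 1) \<noteq> 0 \<longleftrightarrow> a \<in> L u"
    if "u < ?n" "a \<in> {1, 2, 3}" for u a
  proof -
    obtain b where b: "a = Suc b" "b < 3" using \<open>a \<in> {1, 2, 3}\<close> by (cases a) auto
    then have "3 * u + a - 1 = 3 * u + b" "(3 * u + b) div 3 = u" "(3 * u + b) mod 3 = b" by simp_all
    moreover have "3 * u + b < 3 * ?n" using that(1) b(2) by linarith
    ultimately show ?thesis using b(1) by (simp add: encode_def Let_def)
  qed
  show ?thesis unfolding env_def using adj lists by (simp add: encode_def Let_def)
qed

theorem theorem3:
  "solvable_in_time P5_free_instances num_verts encode list_semi_acyclic_3_colourable
     (\<lambda>n. real n ^ 16)"
proof (rule formula_solvable[OF wf_algorithm depth_algorithm inv_state_encode])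
  fix x
  assume x: "x \<in> P5_free_instances"
  obtain G L where [simp]: "x = (G, L)" by (cases x)
  have inst: "(G, L) \<in> P5_free_instances" using x by simp
  interpret adj_graph "card (verts G)" "adjacent G" by (rule instance_adj_graph[OF inst])
  show "list_semi_acyclic_3_colourable x \<longleftrightarrow> sat algorithm (encode x)"
    using sat_algorithm[OF env_encode[OF inst]] colourable_iff_good_on[OF inst] by simp
qed

end
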